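(* Let $G$ be a finitely generated group, and let $p$ be a prime. Then the following are equivalent: (i) $G$ has an infinite nested sequence of subnormal subgroups, each with index a power of $p$ in $G$, and with linear growth of mod $p$ homology; (ii) $\hat G_{(p)}$ has exponential subgroup growth; (iii) $\limsup_n (\log a_{p^n}^{\triangleleft\triangleleft}(G))/p^n > 0$; (iv) $\inf_{n\geq 1} (\log a_{p^n}^{\triangleleft\triangleleft}(G))/p^n > 0$.
   Context: $\hat G_{(p)}$ denotes the pro-$p$ completion of $G$. For a group $\Gamma$, $s_n(\Gamma)$ is the number of subgroups of $\Gamma$ with index at most $n$; $\Gamma$ has (at least) exponential subgroup growth if $\limsup_n (\log s_n(\Gamma))/n > 0$. A subgroup $H$ of $G$ is subnormal if there is a finite chain $G = H_0 \triangleright H_1 \triangleright \dots \triangleright H_k = H$ with each term normal in the preceding one. $a_n^{\triangleleft\triangleleft}(G)$ is the number of subnormal subgroups of $G$ with index precisely $n$ (with $\log 0 = -\infty$). An infinite nested sequence of subgroups is a sequence $G_1 \geq G_2 \geq \dots$ having infinitely many distinct terms. For a group $H$ and prime $p$, $d_p(H)$ denotes the dimension of $H_1(H;\mathbb{F}_p)$ over the field $\mathbb{F}_p$ of order $p$. A collection $\{G_i\}$ of finite index subgroups of $G$ has linear growth of mod $p$ homology if $\inf_i d_p(G_i)/[G:G_i] > 0$. *)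

theory Defs
  imports
    "HOL-Library.Extended_Real"
    "HOL-Library.Liminf_Limsup"
    "HOL-Number_Theory.Residues"
    "HOL-Algebra.Generated_Groups"
    "HOL-Algebra.Product_Groups"
    "Jordan_Normal_Form.Missing_VectorSpace"
begin

definition finitely_generated :: "('a, 'm) monoid_scheme \<Rightarrow> bool" where
  "finitely_generated G \<longleftrightarrow>
     (\<exists>S. finite S \<and> S \<subseteq> carrier G \<and> generate G S = carrier G)"

definition finite_index :: "('a, 'm) monoid_scheme \<Rightarrow> 'a set \<Rightarrow> bool" where
  "finite_index G H \<longleftrightarrow> subgroup H G \<and> finite (rcosets\<^bsub>G\<^esub> H)"

text \<open>Infinite index is represented by 0.\<close>

definition index :: "('a, 'm) monoid_scheme \<Rightarrow> 'a set \<Rightarrow> nat" where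
  "index G H = card (rcosets\<^bsub>G\<^esub> H)"

definition subnormal :: "('a, 'm) monoid_scheme \<Rightarrow> 'a set \<Rightarrow> bool" where
  "subnormal G H \<longleftrightarrow>
     (\<exists>k C. C 0 = carrier G \<and> C k = H \<and> (\<forall>i<k. C (Suc i) \<lhd> G\<lparr>carrier := C i\<rparr>))"

text \<open>All subgroups of the abstract group are counted; no topology is involved, also when
  the group happens to be profinite.\<close>

definition subgroup_count :: "nat \<Rightarrow> ('a, 'm) monoid_scheme \<Rightarrow> nat" where
  "subgroup_count n \<Gamma> = card {H. finite_index \<Gamma> H \<and> index \<Gamma> H \<le> n}"

definition subnormal_count :: "nat \<Rightarrow> ('a, 'm) monoid_scheme \<Rightarrow> nat" where
  "subnormal_count n G = card {H. finite_index G H \<and> subnormal G H \<and> index G H = n}"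

definition log_count :: "nat \<Rightarrow> ereal" where
  "log_count k = (if k = 0 then -\<infinity> else ereal (ln (real k)))"

definition exponential_subgroup_growth :: "('a, 'm) monoid_scheme \<Rightarrow> bool" where
  "exponential_subgroup_growth \<Gamma> \<longleftrightarrow>
     limsup (\<lambda>n. log_count (subgroup_count n \<Gamma>) / ereal (real n)) > 0"

definition p_power_normal :: "nat \<Rightarrow> ('a, 'm) monoid_scheme \<Rightarrow> 'a set set" where
  "p_power_normal p G = {N. N \<lhd> G \<and> (\<exists>k. index G N = p ^ k)}"

text \<open>The inverse limit of the quotients \<open>G/N\<close>, as the subgroup of compatible families in their
  product: for \<open>N \<subseteq> M\<close> the projection \<open>G/N \<rightarrow> G/M\<close> sends a coset \<open>X\<close> of \<open>N\<close> to \<open>M <#> X\<close>.\<close>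

definition pro_p_completion :: "nat \<Rightarrow> ('a, 'm) monoid_scheme \<Rightarrow> ('a set \<Rightarrow> 'a set) monoid" where
  "pro_p_completion p G =
     (let \<P> = product_group (p_power_normal p G) (\<lambda>N. G Mod N)
      in \<P>\<lparr>carrier := {f \<in> carrier \<P>.
           \<forall>N \<in> p_power_normal p G. \<forall>M \<in> p_power_normal p G.
             N \<subseteq> M \<longrightarrow> f M = M <#>\<^bsub>G\<^esub> f N}\<rparr>)"

text \<open>Group homology with trivial coefficients is the homology of the inhomogeneous bar complex.
  An \<open>n\<close>-chain is a finitely supported function from \<open>n\<close>-tuples of group elements to
  \<open>\<F>\<^sub>p = {0..p-1}\<close>.\<close>

definition bar_chains ::
  "nat \<Rightarrow> ('a, 'm) monoid_scheme \<Rightarrow> nat \<Rightarrow> (int, 'a list \<Rightarrow> int) module" where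
  "bar_chains p G n =
     \<lparr>carrier = {c. (\<forall>xs. c xs \<in> carrier (residue_ring (int p))) \<and> finite {xs. c xs \<noteq> 0} \<and>
                     {xs. c xs \<noteq> 0} \<subseteq> {xs. length xs = n \<and> set xs \<subseteq> carrier G}},
      monoid.mult = undefined, one = undefined,
      zero = (\<lambda>xs. 0),
      add = (\<lambda>c d xs. c xs \<oplus>\<^bsub>residue_ring (int p)\<^esub> d xs),
      smult = (\<lambda>a c xs. a \<otimes>\<^bsub>residue_ring (int p)\<^esub> c xs)\<rparr>"

text \<open>The \<open>i\<close>-th face of \<open>[g\<^sub>1|\<dots>|g\<^sub>n]\<close>, for \<open>0 \<le> i \<le> n\<close>: drop \<open>g\<^sub>1\<close> if \<open>i = 0\<close>, drop \<open>g\<^sub>n\<close> if \<open>i = n\<close>,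
  and otherwise replace \<open>g\<^sub>i, g\<^sub>i\<^sub>+\<^sub>1\<close> by their product.\<close>

definition bar_face :: "('a, 'm) monoid_scheme \<Rightarrow> nat \<Rightarrow> 'a list \<Rightarrow> 'a list" where
  "bar_face G i xs =
     (if i = 0 then tl xs
      else if i = length xs then butlast xs
      else take (i - 1) xs @ [xs ! (i - 1) \<otimes>\<^bsub>G\<^esub> xs ! i] @ drop (Suc i) xs)"

definition bar_boundary ::
  "nat \<Rightarrow> ('a, 'm) monoid_scheme \<Rightarrow> nat \<Rightarrow> ('a list \<Rightarrow> int) \<Rightarrow> ('a list \<Rightarrow> int)" where
  "bar_boundary p G n c = (\<lambda>ys.
     if n = 0 then 0
     else (\<Sum>xs | c xs \<noteq> 0. c xs * (\<Sum>i\<le>n. (-1) ^ i * of_bool (bar_face G i xs = ys))) mod int p)"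

text \<open>Adding \<open>N\<close> makes the scalar multiple of a coset a full coset also for the scalar 0. The
  multiplicative part of the ring record plays no role in a module.\<close>

definition quotient_module :: "('r, 'v, 'm) module_scheme \<Rightarrow> 'v set \<Rightarrow> ('r, 'v set) module" where
  "quotient_module M N =
     \<lparr>carrier = a_rcosets\<^bsub>M\<^esub> N,
      monoid.mult = undefined, one = undefined,
      zero = N,
      add = (\<lambda>X Y. X <+>\<^bsub>M\<^esub> Y),
      smult = (\<lambda>a X. N <+>\<^bsub>M\<^esub> ((\<lambda>x. a \<odot>\<^bsub>M\<^esub> x) ` X))\<rparr>"

definition group_homology ::
  "nat \<Rightarrow> nat \<Rightarrow> ('a, 'm) monoid_scheme \<Rightarrow> (int, ('a list \<Rightarrow> int) set) module" where
  "group_homology p n G =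
     quotient_module
       ((bar_chains p G n)\<lparr>carrier :=
          {c \<in> carrier (bar_chains p G n). bar_boundary p G n c = (\<lambda>_. 0)}\<rparr>)
       (bar_boundary p G (Suc n) ` carrier (bar_chains p G (Suc n)))"

definition d_p :: "nat \<Rightarrow> ('a, 'm) monoid_scheme \<Rightarrow> nat" where
  "d_p p H = vectorspace.dim (residue_ring (int p)) (group_homology p 1 H)"

definition linear_growth_mod_p_homology ::
  "nat \<Rightarrow> ('a, 'm) monoid_scheme \<Rightarrow> 'a set set \<Rightarrow> bool" where
  "linear_growth_mod_p_homology p G \<H> \<longleftrightarrow>
     (\<forall>H \<in> \<H>. finite_index G H) \<and>
     (INF H \<in> \<H>. ereal (real (d_p p (G\<lparr>carrier := H\<rparr>)) / real (index G H))) > 0"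

end

theory Submission
  imports Defs "HOL-Algebra.Sylow" "HOL-Real_Asymp.Real_Asymp"
begin

text \<open>
  Write \<open>d(K)\<close> for the dimension of \<open>H\<^sub>1(K; \<F>\<^sub>p)\<close>, so that \<open>K\<close> has \<open>p\<^bsup>d(K)\<^esup>\<close> homomorphisms to \<open>\<F>\<^sub>p\<close>. The
  subnormal subgroups of \<open>p\<close>-power index are exactly the subgroups that contain a normal subgroup of
  \<open>p\<close>-power index, and each of them other than \<open>G\<close> is normal of index \<open>p\<close> in another one. If \<open>H\<close> is
  normal of index \<open>p\<close> in \<open>K\<close> then \<open>d(H) - 1 \<le> p (d(K) - 1)\<close>, so \<open>(d(K) - 1)/[G : K]\<close> decreases down such
  chains. Since \<open>K\<close> has between \<open>p\<^bsup>d(K) - 1\<^esup>\<close> and \<open>p\<^bsup>d(K)\<^esup>\<close> normal subgroups of index \<open>p\<close>, conditions (iii) and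
  (iv) both say that for some \<open>c > 0\<close> and every \<open>n\<close> there is a \<open>K\<close> of index \<open>p\<^sup>n\<close> with
  \<open>d(K) - 1 \<ge> c p\<^sup>n\<close>; by Koenig's lemma such \<open>K\<close> can be chosen nested, which is (i). Finally every subgroup
  of finite index in the pro-\<open>p\<close> completion is open (Serre), so these subgroups correspond to the
  subnormal subgroups of \<open>p\<close>-power index in \<open>G\<close>, which gives (ii).\<close>

section \<open>Relative indices and subgroups of \<open>p\<close>-power index\<close>

text \<open>Condition (ii) counts all finite-index subgroups of the completion as an abstract group,
  so it says nothing about G until each of them is known to be open; this is the hard step. It rests
  on two facts. Elements of the completion have m-th roots for m prime to p, so its finite quotients
  are p-groups. And modulo every term of the lower central series, an element of the commutator
  subgroup of an r-generated group is a product of r commutators with the generators. As r does not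
  depend on the term, such factorisations in the finite quotients can be chosen compatibly and have
  a limit in the completion.

  A limsup over n can give an infimum over n because large rank at a deep level forces large rank at
  every level above it. Conversely, if d(K) - 1 < c p^n from some level on, each level multiplies
  the number of subgroups by at most p^(1 + c p^n). These exponents form a geometric series up to a
  linear term, so for arbitrarily small c the growth is subexponential.

  Dimensions are compared through numbers of homomorphisms: exact sequences become bounds on
  fibres.\<close>

definition idx :: "('a, 'm) monoid_scheme \<Rightarrow> 'a set \<Rightarrow> 'a set \<Rightarrow> nat" where
  "idx G K H = card ((\<lambda>k. H #>\<^bsub>G\<^esub> k) ` K)"

text \<open>Normality and index are taken relative to one ambient G, so that all subgroups of a
  chain share one multiplication; \<open>normal_iff_nsub\<close> translates where a quotient group
  or a chain from \<open>subnormal\<close> is involved.\<close>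

definition nsub :: "('a, 'm) monoid_scheme \<Rightarrow> 'a set \<Rightarrow> 'a set \<Rightarrow> bool" where
  "nsub G H K \<longleftrightarrow> subgroup H G \<and> subgroup K G \<and> H \<subseteq> K \<and>
     (\<forall>k\<in>K. \<forall>h\<in>H. k \<otimes>\<^bsub>G\<^esub> h \<otimes>\<^bsub>G\<^esub> inv\<^bsub>G\<^esub> k \<in> H)"

text \<open>These are the inverse images in G of the open subgroups of the completion. A p-power
  index alone would be too weak: a subgroup of order 2 in the symmetric group on three letters has
  index 3 but contains no normal subgroup of 3-power index.\<close>

definition p_open :: "nat \<Rightarrow> ('a, 'm) monoid_scheme \<Rightarrow> 'a set \<Rightarrow> bool" where
  "p_open p G K \<longleftrightarrow> subgroup K G \<and> (\<exists>N\<in>p_power_normal p G. N \<subseteq> K)"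

lemma same_fibres_image:
  assumes "\<And>a b. a \<in> K \<Longrightarrow> b \<in> K \<Longrightarrow> f a = f b \<longleftrightarrow> g a = g b"
  shows "card (f ` K) = card (g ` K)" "finite (f ` K) \<longleftrightarrow> finite (g ` K)"
proof -
  have "bij_betw (\<lambda>y. g (inv_into K f y)) (f ` K) (g ` K)"
  proof (rule bij_betwI')
    fix x y assume "x \<in> f ` K" "y \<in> f ` K"
    then show "(g (inv_into K f x) = g (inv_into K f y)) = (x = y)"
      using assms by (metis f_inv_into_f inv_into_into)
  next
    fix x assume "x \<in> f ` K" then show "g (inv_into K f x) \<in> g ` K"
      by (simp add: inv_into_into)
  next
    fix y assume "y \<in> g ` K"
    then obtain a where a: "a \<in> K" "y = g a" by auto
    then have "g (inv_into K f (f a)) = y"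
      using assms by (metis f_inv_into_f image_eqI inv_into_into)
    with a show "\<exists>x\<in>f ` K. y = g (inv_into K f x)"
      by (intro bexI[of _ "f a"]) auto
  qed
  from bij_betw_same_card[OF this] bij_betw_finite[OF this]
  show "card (f ` K) = card (g ` K)" "finite (f ` K) \<longleftrightarrow> finite (g ` K)" .
qed

lemma index_idx: "index G H = idx G (carrier G) H"
  by (simp add: index_def idx_def RCOSETS_def UNION_singleton_eq_range)

lemma nsubD:
  assumes "nsub G H K"
  shows "subgroup H G" "subgroup K G" "H \<subseteq> K"
    "\<And>k h. k \<in> K \<Longrightarrow> h \<in> H \<Longrightarrow> k \<otimes>\<^bsub>G\<^esub> h \<otimes>\<^bsub>G\<^esub> inv\<^bsub>G\<^esub> k \<in> H"
  using assms by (auto simp: nsub_def)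

context group
begin

lemma cancel_left [simp]:
  assumes "a \<in> carrier G" "b \<in> carrier G"
  shows "inv a \<otimes> (a \<otimes> b) = b" "a \<otimes> (inv a \<otimes> b) = b"
  using assms by (simp_all flip: m_assoc)

lemma sub_in: "subgroup H G \<Longrightarrow> x \<in> H \<Longrightarrow> x \<in> carrier G"
  by (rule subgroup.mem_carrier)

lemma sub_m: "subgroup H G \<Longrightarrow> x \<in> H \<Longrightarrow> y \<in> H \<Longrightarrow> x \<otimes> y \<in> H"
  by (rule subgroup.m_closed)

lemma sub_i: "subgroup H G \<Longrightarrow> x \<in> H \<Longrightarrow> inv x \<in> H"
  by (rule subgroup.m_inv_closed)

lemma sub_one: "subgroup H G \<Longrightarrow> \<one> \<in> H"
  by (rule subgroup.one_closed)

lemma sub_pow: "subgroup H G \<Longrightarrow> x \<in> H \<Longrightarrow> x [^] (n::nat) \<in> H"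
  by (induction n) (auto simp: sub_one sub_m)

lemma sub_ipow: "subgroup H G \<Longrightarrow> x \<in> H \<Longrightarrow> x [^] (n::int) \<in> H"
  by (simp add: subgroup_int_pow_closed)

lemma coset_eq_iff:
  assumes "subgroup H G" "a \<in> carrier G" "b \<in> carrier G"
  shows "H #> a = H #> b \<longleftrightarrow> a \<otimes> inv b \<in> H"
proof
  assume "H #> a = H #> b"
  then show "a \<otimes> inv b \<in> H"
    using assms by (metis is_group rcos_self subgroup.rcos_module)
next
  assume "a \<otimes> inv b \<in> H"
  then show "H #> a = H #> b"
    using assms by (metis is_group repr_independence subgroup.rcos_module)
qed

text \<open>An index can be counted with any function whose fibres are the cosets. The tower
  formula, orbit sizes, indices of kernels and indices in the completion are all obtained in this
  way.\<close>

lemma idx_eqI: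
  assumes "subgroup H G" "K \<subseteq> carrier G"
    "\<And>a b. a \<in> K \<Longrightarrow> b \<in> K \<Longrightarrow> f a = f b \<longleftrightarrow> a \<otimes> inv b \<in> H"
  shows "idx G K H = card (f ` K)" "finite ((\<lambda>k. H #> k) ` K) \<longleftrightarrow> finite (f ` K)"
proof -
  have "\<And>a b. a \<in> K \<Longrightarrow> b \<in> K \<Longrightarrow> H #> a = H #> b \<longleftrightarrow> f a = f b"
    using assms coset_eq_iff by (metis subsetD)
  then show "idx G K H = card (f ` K)" "finite ((\<lambda>k. H #> k) ` K) \<longleftrightarrow> finite (f ` K)"
    using same_fibres_image[of K "\<lambda>k. H #> k" f] by (simp_all add: idx_def)
qed

lemma idx_tower:
  assumes "subgroup H G" "subgroup K G" "subgroup M G" "H \<subseteq> K" "K \<subseteq> M"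
  shows "idx G M H = idx G M K * idx G K H"
proof -
  \<comment> \<open>\<open>r a\<close> is a representative in M of the coset K a that depends only
    on that coset. It splits a coset of H in M into a coset of K in M and, through a (r a)^-1, a
    coset of H in K.\<close>
  define r where "r a = (SOME b. b \<in> M \<and> K #> b = K #> a)" for a
  have r: "r a \<in> M \<and> K #> r a = K #> a" if "a \<in> M" for a
    unfolding r_def by (rule someI[of _ a]) (use that in simp)
  have MC: "\<And>a. a \<in> M \<Longrightarrow> a \<in> carrier G" using assms sub_in by blast
  define f where "f a = (K #> a, H #> (a \<otimes> inv (r a)))" for a
  have rK: "a \<otimes> inv (r a) \<in> K" if "a \<in> M" for a
    using r[OF that] coset_eq_iff[OF assms(2), of a "r a"] MC that by metis
  have "f a = f b \<longleftrightarrow> a \<otimes> inv b \<in> H" if ab: "a \<in> M" "b \<in> M" for a b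
  proof -
    have c: "a \<in> carrier G" "b \<in> carrier G" "r a \<in> carrier G" "r b \<in> carrier G"
      using ab r MC by auto
    have K: "K #> a = K #> b \<longleftrightarrow> a \<otimes> inv b \<in> K"
      using coset_eq_iff assms(2) c by blast
    have rr: "K #> a = K #> b \<Longrightarrow> r a = r b" by (simp add: r_def)
    have H: "H #> (a \<otimes> inv (r a)) = H #> (b \<otimes> inv (r b)) \<longleftrightarrow> a \<otimes> inv b \<in> H" if "r a = r b"
      using coset_eq_iff[OF assms(1), of "a \<otimes> inv (r a)" "b \<otimes> inv (r b)"] that c
      by (simp add: m_assoc inv_mult_group)
    show ?thesis using K rr H assms(4) by (auto simp: f_def)
  qed
  then have "idx G M H = card (f ` M)"
    using idx_eqI(1)[OF assms(1), of M f] MC by blast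
  also have "f ` M = ((\<lambda>k. K #> k) ` M) \<times> ((\<lambda>k. H #> k) ` K)"
  proof (intro equalityI subsetI)
    fix x assume "x \<in> f ` M" then show "x \<in> ((\<lambda>k. K #> k) ` M) \<times> ((\<lambda>k. H #> k) ` K)"
      using rK by (auto simp: f_def)
  next
    fix x assume "x \<in> ((\<lambda>k. K #> k) ` M) \<times> ((\<lambda>k. H #> k) ` K)"
    then obtain m k where mk: "m \<in> M" "k \<in> K" "x = (K #> m, H #> k)" by auto
    have c: "m \<in> carrier G" "k \<in> carrier G" "r m \<in> carrier G"
      using mk MC r assms sub_in by auto
    have kM: "k \<otimes> r m \<in> M" using mk r assms sub_m by blast
    have e: "K #> (k \<otimes> r m) = K #> m"
    proof -
      have "K #> (k \<otimes> r m) = K #> r m"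
        using coset_eq_iff[OF assms(2), of "k \<otimes> r m" "r m"] c mk by (simp add: m_assoc)
      then show ?thesis using r mk by simp
    qed
    then have "r (k \<otimes> r m) = r m" by (simp add: r_def)
    then have "f (k \<otimes> r m) = x" using e mk c by (simp add: f_def m_assoc)
    then show "x \<in> f ` M" using kM by blast
  qed
  finally show ?thesis by (simp add: idx_def card_cartesian_product)
qed

lemma idx_self:
  assumes "subgroup H G"
  shows "idx G H H = 1"
proof -
  have "idx G H H = card ((\<lambda>_. 0::nat) ` H)"
    by (rule idx_eqI(1)) (use assms in \<open>auto simp: sub_m sub_i intro: sub_in\<close>)
  moreover have "H \<noteq> {}" using sub_one[OF assms] by auto
  ultimately show ?thesis by (simp add: image_constant_conv)
qed

lemma idx_1_eq:
  assumes "subgroup H G" "subgroup K G" "H \<subseteq> K" "idx G K H = 1"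
  shows "H = K"
proof (rule equalityI[OF assms(3)], rule subsetI)
  fix k assume k: "k \<in> K"
  from assms(4) obtain X where "(\<lambda>k. H #> k) ` K = {X}"
    unfolding idx_def by (metis One_nat_def card_1_singletonE)
  then have "H #> k = H #> \<one>" using k sub_one[OF assms(2)] by blast
  then show "k \<in> H"
    using coset_eq_iff[OF assms(1), of k \<one>] k sub_in[OF assms(2)] by simp
qed

lemma nsub_mult_subgroup:
  assumes "nsub G H K" "subgroup A G" "A \<subseteq> K"
  shows "subgroup {h \<otimes> a |h a. h \<in> H \<and> a \<in> A} G" "{h \<otimes> a |h a. h \<in> H \<and> a \<in> A} \<subseteq> K"
proof -
  note n = nsubD[OF assms(1)]
  have c: "\<And>h. h \<in> H \<Longrightarrow> h \<in> carrier G" "\<And>a. a \<in> A \<Longrightarrow> a \<in> carrier G"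
    using n assms sub_in by auto
  show "subgroup {h \<otimes> a |h a. h \<in> H \<and> a \<in> A} G"
  proof (rule subgroupI)
    show "{h \<otimes> a |h a. h \<in> H \<and> a \<in> A} \<subseteq> carrier G" using c by auto
    show "{h \<otimes> a |h a. h \<in> H \<and> a \<in> A} \<noteq> {}"
      using sub_one[OF n(1)] sub_one[OF assms(2)] by blast
  next
    fix x assume "x \<in> {h \<otimes> a |h a. h \<in> H \<and> a \<in> A}"
    then obtain h a where ha: "h \<in> H" "a \<in> A" "x = h \<otimes> a" by auto
    have "inv x = (inv a \<otimes> inv h \<otimes> inv (inv a)) \<otimes> inv a"
      using ha c by (simp add: inv_mult_group m_assoc)
    moreover have "inv a \<otimes> inv h \<otimes> inv (inv a) \<in> H"
      using n(4)[of "inv a" "inv h"] ha assms(3) sub_i[OF n(1)] sub_i[OF assms(2)] by blast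
    ultimately show "inv x \<in> {h \<otimes> a |h a. h \<in> H \<and> a \<in> A}"
      using ha sub_i[OF assms(2)] by blast
  next
    fix x y assume "x \<in> {h \<otimes> a |h a. h \<in> H \<and> a \<in> A}" "y \<in> {h \<otimes> a |h a. h \<in> H \<and> a \<in> A}"
    then obtain h a h' a' where ha: "h \<in> H" "a \<in> A" "x = h \<otimes> a" "h' \<in> H" "a' \<in> A" "y = h' \<otimes> a'"
      by auto
    have "x \<otimes> y = (h \<otimes> (a \<otimes> h' \<otimes> inv a)) \<otimes> (a \<otimes> a')"
      using ha c by (simp add: m_assoc)
    moreover have "h \<otimes> (a \<otimes> h' \<otimes> inv a) \<in> H"
      using n(4)[of a h'] ha assms(3) sub_m[OF n(1)] by blast
    ultimately show "x \<otimes> y \<in> {h \<otimes> a |h a. h \<in> H \<and> a \<in> A}"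
      using ha sub_m[OF assms(2)] by blast
  qed
  show "{h \<otimes> a |h a. h \<in> H \<and> a \<in> A} \<subseteq> K"
    using n(3) assms(3) sub_m[OF n(2)] by blast
qed

lemma nsub_Int:
  assumes "nsub G H K" "subgroup A G" "A \<subseteq> K"
  shows "nsub G (A \<inter> H) A"
  using nsubD[OF assms(1)] assms(2,3) sub_m[OF assms(2)] sub_i[OF assms(2)]
    subgroups_Inter_pair[of A H] by (auto simp: nsub_def)

text \<open>Second isomorphism theorem: [A : A \<inter> H] = [HA : H], and HA is a subgroup between
  H and K. Divisibility, rather than an inequality, is what preserves powers of p.\<close>

lemma idx_Int_dvd:
  assumes "nsub G H K" "subgroup A G" "A \<subseteq> K"
  shows "idx G A (A \<inter> H) dvd idx G K H"
proof -
  note n = nsubD[OF assms(1)]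
  let ?B = "{h \<otimes> a |h a. h \<in> H \<and> a \<in> A}"
  have c: "\<And>h. h \<in> H \<Longrightarrow> h \<in> carrier G" "\<And>a. a \<in> A \<Longrightarrow> a \<in> carrier G"
    using n assms sub_in by auto
  have HB: "H \<subseteq> ?B" using sub_one[OF assms(2)] c by force
  have "idx G A (A \<inter> H) = card ((\<lambda>k. H #> k) ` A)"
  proof (rule idx_eqI(1))
    show "subgroup (A \<inter> H) G" using nsub_Int[OF assms] by (simp add: nsub_def)
    show "A \<subseteq> carrier G" using c by auto
    show "H #> a = H #> b \<longleftrightarrow> a \<otimes> inv b \<in> A \<inter> H" if "a \<in> A" "b \<in> A" for a b
      using coset_eq_iff[OF n(1)] c that sub_m[OF assms(2)] sub_i[OF assms(2)] by auto
  qed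
  also have "(\<lambda>k. H #> k) ` A = (\<lambda>k. H #> k) ` ?B"
  proof -
    have "H #> (h \<otimes> a) = H #> a" if "h \<in> H" "a \<in> A" for h a
      using coset_eq_iff[OF n(1), of "h \<otimes> a" a] that c by (simp add: m_assoc)
    moreover have "A \<subseteq> ?B" using sub_one[OF n(1)] c by force
    ultimately show ?thesis by fastforce
  qed
  finally have "idx G A (A \<inter> H) = idx G ?B H" by (simp add: idx_def)
  moreover have "idx G K H = idx G K ?B * idx G ?B H"
    using idx_tower[OF n(1) nsub_mult_subgroup(1)[OF assms] n(2) HB nsub_mult_subgroup(2)[OF assms]] .
  ultimately show ?thesis by simp
qed

lemma normal_iff_nsub:
  assumes "subgroup K G"
  shows "H \<lhd> G\<lparr>carrier := K\<rparr> \<longleftrightarrow> nsub G H K"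
proof -
  interpret K: group "G\<lparr>carrier := K\<rparr>" using assms subgroup_imp_group by blast
  have sg: "subgroup H (G\<lparr>carrier := K\<rparr>) \<longleftrightarrow> subgroup H G \<and> H \<subseteq> K"
    using incl_subgroup[OF assms] subgroup_incl[OF _ assms] subgroup.subset[of H "G\<lparr>carrier := K\<rparr>"] by auto
  show ?thesis
    unfolding K.normal_inv_iff sg nsub_def
    using assms m_inv_consistent[OF assms] by auto
qed

lemma normal_iff_nsub_carrier: "H \<lhd> G \<longleftrightarrow> nsub G H (carrier G)"
  unfolding normal_inv_iff nsub_def using subgroup_self subgroup.subset[of H G] by auto

text \<open>Lagrange's theorem in K/H. For infinite index the exponent is 0.\<close>

lemma nsub_pow_idx:
  assumes "nsub G H K" "x \<in> K"
  shows "x [^] (idx G K H) \<in> H"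
proof -
  note n = nsubD[OF assms(1)]
  interpret N: normal H "G\<lparr>carrier := K\<rparr>" using assms n normal_iff_nsub by blast
  interpret F: group "(G\<lparr>carrier := K\<rparr>) Mod H" by (rule N.factorgroup_is_group)
  have ic: "idx G K H = order ((G\<lparr>carrier := K\<rparr>) Mod H)"
    unfolding order_def carrier_FactGroup by (simp add: idx_def)
  have xc: "H #> x \<in> carrier ((G\<lparr>carrier := K\<rparr>) Mod H)"
    using assms by (simp add: carrier_FactGroup)
  have "(H #> x) [^]\<^bsub>(G\<lparr>carrier := K\<rparr>) Mod H\<^esub> n = H #> (x [^] n)" for n :: nat
    using N.FactGroup_pow[of x n] assms(2) by (simp flip: nat_pow_consistent)
  with F.pow_order_eq_1[OF xc] have "H #> (x [^] idx G K H) = H" by (simp add: ic)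
  then show ?thesis
    using coset_eq_iff[OF n(1), of "x [^] idx G K H" \<one>] assms n
      sub_in[OF n(2)] subgroup.subset[OF n(1)] by simp
qed

end

section \<open>Classes of p-power size and indices that are powers of p\<close>

lemma finite_image_factor:
  assumes "\<And>a b. a \<in> S \<Longrightarrow> b \<in> S \<Longrightarrow> h a = h b \<Longrightarrow> f a = f b" "finite (h ` S)"
  shows "finite (f ` S)"
proof (rule finite_subset)
  show "f ` S \<subseteq> (\<lambda>x. f (inv_into S h x)) ` h ` S"
  proof
    fix y assume "y \<in> f ` S"
    then obtain a where a: "a \<in> S" "y = f a" by blast
    have "inv_into S h (h a) \<in> S" "h (inv_into S h (h a)) = h a"
      using a(1) by (simp_all add: inv_into_into f_inv_into_f)
    then have "y = f (inv_into S h (h a))" using assms(1) a by metis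
    with a(1) show "y \<in> (\<lambda>x. f (inv_into S h x)) ` h ` S" by blast
  qed
qed (use assms(2) in blast)

text \<open>Every class that is not a singleton has size divisible by p, so a unique singleton class
  would make the total congruent to 1 modulo p.\<close>

lemma exists_other_singleton_class:
  assumes "finite E" "equiv E r" "\<And>X. X \<in> E // r \<Longrightarrow> \<exists>k. card X = p ^ k"
    and "p dvd card E" "p > (1::nat)" "e \<in> E" "r `` {e} = {e}"
  shows "\<exists>e'\<in>E. e' \<noteq> e \<and> r `` {e'} = {e'}"
proof (rule ccontr)
  assume no: "\<not> ?thesis"
  have eQ: "{e} \<in> E // r" using assms(6,7) by (metis quotientI)
  have finQ: "finite (E // r)" using assms(1,2) by (simp add: equiv_type finite_quotient)
  have "card E = card (\<Union>(E // r))" using assms(2) by (simp add: Union_quotient)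
  also have "\<dots> = (\<Sum>X\<in>E // r. card X)"
  proof (rule card_Union_disjoint)
    show "pairwise disjnt (E // r)"
      using quotient_disj[OF assms(2)] unfolding pairwise_def disjnt_def by blast
    show "finite X" if "X \<in> E // r" for X
      by (rule finite_equiv_class[OF assms(1) equiv_type[OF assms(2)] that])
  qed
  also have "\<dots> = card {e} + (\<Sum>X\<in>E // r - {{e}}. card X)"
    by (rule sum.remove[OF finQ eQ])
  finally have "card E = 1 + (\<Sum>X\<in>E // r - {{e}}. card X)" by simp
  moreover have "p dvd (\<Sum>X\<in>E // r - {{e}}. card X)"
  proof (rule dvd_sum)
    fix X assume X: "X \<in> E // r - {{e}}"
    then obtain x where x: "x \<in> E" "X = r `` {x}" by (auto elim: quotientE)
    obtain k where k: "card X = p ^ k" using assms(3) X by auto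
    have "x \<in> X" using equiv_class_self[OF assms(2) x(1)] x(2) by simp
    have "k \<noteq> 0"
    proof
      assume "k = 0"
      then have "card X = 1" using k by simp
      then have "X = {x}" using \<open>x \<in> X\<close> by (metis card_1_singletonE singletonD)
      then have "x \<noteq> e \<and> r `` {x} = {x}" using X x by auto
      with no x show False by blast
    qed
    then show "p dvd card X" using k by simp
  qed
  ultimately show False using assms(4,5)
    by (metis dvd_add_left_iff nat_dvd_1_iff_1 less_irrefl)
qed

locale group_prime = group G for G (structure) +
  fixes p :: nat
  assumes prime_p: "Factorial_Ring.prime p"
begin

definition pidx :: "'a set \<Rightarrow> 'a set \<Rightarrow> bool" where
  "pidx K H \<longleftrightarrow> (\<exists>k. idx G K H = p ^ k)"

lemma p_gt_1: "p > 1" using prime_p by (rule prime_gt_1_nat)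

lemma dvd_p_power: "m dvd p ^ n \<Longrightarrow> \<exists>k. m = p ^ k"
  using divides_primepow_nat[OF prime_p] by blast

lemma pidxI: "idx G K H dvd p ^ n \<Longrightarrow> pidx K H"
  using dvd_p_power by (auto simp: pidx_def)

text \<open>An infinite index is represented by 0, which is not a power of p.\<close>

lemma pidx_finite: "pidx K H \<Longrightarrow> finite ((\<lambda>k. H #> k) ` K)"
  unfolding pidx_def idx_def using p_gt_1
  by (metis card.infinite gr_implies_not0 power_not_zero)

lemma pidx_tower:
  assumes "subgroup H G" "subgroup K G" "subgroup M G" "H \<subseteq> K" "K \<subseteq> M"
  shows "pidx M H \<longleftrightarrow> pidx M K \<and> pidx K H"
proof
  assume "pidx M H"
  then obtain k where "idx G M K * idx G K H = p ^ k"
    using idx_tower[OF assms] by (auto simp: pidx_def)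
  then have "idx G M K dvd p ^ k" "idx G K H dvd p ^ k" by (metis dvd_triv_left dvd_triv_right)+
  then show "pidx M K \<and> pidx K H" using pidxI by blast
next
  assume "pidx M K \<and> pidx K H"
  then show "pidx M H" using idx_tower[OF assms] by (auto simp: pidx_def simp flip: power_add)
qed

lemma pidx_Int:
  assumes "nsub G H K" "subgroup A G" "A \<subseteq> K" "pidx K H"
  shows "pidx A (A \<inter> H)"
  using idx_Int_dvd[OF assms(1-3)] assms(4) pidxI by (metis pidx_def)

lemma nsub_pidx_Int:
  assumes "nsub G A N" "nsub G B N" "pidx N A" "pidx N B"
  shows "nsub G (A \<inter> B) N" "pidx N (A \<inter> B)"
proof -
  note a = nsubD[OF assms(1)] and b = nsubD[OF assms(2)]
  have s: "subgroup (A \<inter> B) G" by (rule subgroups_Inter_pair[OF a(1) b(1)])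
  then show "nsub G (A \<inter> B) N" using a b by (auto simp: nsub_def)
  show "pidx N (A \<inter> B)"
    using pidx_tower[OF s a(1,2)] a(3) pidx_Int[OF assms(2) a(1) a(3) assms(4)] assms(3) by blast
qed

lemma nsub_pidx_Inter:
  assumes "finite F" "F \<noteq> {}" "\<And>A. A \<in> F \<Longrightarrow> nsub G A N \<and> pidx N A"
  shows "nsub G (\<Inter>F) N \<and> pidx N (\<Inter>F)"
  using assms
proof (induction F rule: finite_ne_induct)
  case (singleton x) then show ?case by auto
next
  case (insert x F)
  then show ?case using nsub_pidx_Int[of x N "\<Inter>F"] by auto
qed

lemma p_power_normal_iff: "N \<in> p_power_normal p G \<longleftrightarrow> nsub G N (carrier G) \<and> pidx (carrier G) N"
  by (simp add: p_power_normal_def normal_iff_nsub_carrier pidx_def index_idx)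

lemma p_open_subgroup: "p_open p G K \<Longrightarrow> subgroup K G"
  by (simp add: p_open_def)

lemma p_openE:
  assumes "p_open p G K"
  obtains N where "nsub G N (carrier G)" "pidx (carrier G) N" "N \<subseteq> K"
  using assms by (auto simp: p_open_def p_power_normal_iff)

lemma p_open_pidx:
  assumes "p_open p G K" shows "pidx (carrier G) K"
proof -
  have K: "subgroup K G" using assms by (rule p_open_subgroup)
  from p_openE[OF assms] obtain N where N: "nsub G N (carrier G)" "pidx (carrier G) N" "N \<subseteq> K" .
  show ?thesis
    using pidx_tower[OF nsubD(1)[OF N(1)] K subgroup_self N(3) subgroup.subset[OF K]] N(2) by simp
qed

lemma p_open_mono: "p_open p G H \<Longrightarrow> subgroup K G \<Longrightarrow> H \<subseteq> K \<Longrightarrow> p_open p G K"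
  by (auto simp: p_open_def)

lemma idx_carrier_self: "idx G (carrier G) (carrier G) = 1"
  using idx_self[OF subgroup_self] .

lemma p_open_carrier: "p_open p G (carrier G)"
proof -
  have "nsub G (carrier G) (carrier G)" using subgroup_self by (simp add: nsub_def)
  moreover have "pidx (carrier G) (carrier G)"
    unfolding pidx_def using idx_carrier_self by (metis power_0)
  ultimately show ?thesis
    unfolding p_open_def using p_power_normal_iff subgroup_self by blast
qed

section \<open>Conjugates and normal cores\<close>

definition conj_set :: "'a \<Rightarrow> 'a set \<Rightarrow> 'a set" where
  "conj_set g A = (\<lambda>a. g \<otimes> a \<otimes> inv g) ` A"

lemma conj_set_iff:
  assumes "A \<subseteq> carrier G" "g \<in> carrier G" "x \<in> carrier G"
  shows "x \<in> conj_set g A \<longleftrightarrow> inv g \<otimes> x \<otimes> g \<in> A"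
proof
  assume "x \<in> conj_set g A"
  then obtain a where "a \<in> A" "x = g \<otimes> a \<otimes> inv g" by (auto simp: conj_set_def)
  then show "inv g \<otimes> x \<otimes> g \<in> A" using assms by (auto simp: m_assoc subset_iff)
next
  assume *: "inv g \<otimes> x \<otimes> g \<in> A"
  have "x = g \<otimes> (inv g \<otimes> x \<otimes> g) \<otimes> inv g" using assms by (simp add: m_assoc)
  with * show "x \<in> conj_set g A" unfolding conj_set_def by (rule rev_image_eqI)
qed

lemma nsub_conj_set:
  assumes "nsub G N (carrier G)" "nsub G A N" "g \<in> carrier G"
  shows "nsub G (conj_set g A) N" "idx G N (conj_set g A) = idx G N A"
proof -
  note n = nsubD[OF assms(1)] and a = nsubD[OF assms(2)]
  have NC: "N \<subseteq> carrier G" and AC: "A \<subseteq> carrier G" using a n by auto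
  have ig: "inv g \<in> carrier G" using assms by simp
  have cjN: "inv g \<otimes> x \<otimes> g \<in> N" if "x \<in> N" for x
    using n(4)[OF ig that] assms by simp
  have NA: "conj_set g A \<subseteq> N" using n(4)[OF assms(3)] a(3) by (auto simp: conj_set_def)
  have iff: "x \<in> conj_set g A \<longleftrightarrow> inv g \<otimes> x \<otimes> g \<in> A" if "x \<in> carrier G" for x
    using conj_set_iff[OF AC assms(3) that] .
  have s: "subgroup (conj_set g A) G"
  proof (rule subgroupI)
    show "conj_set g A \<subseteq> carrier G" using NA NC by auto
    show "conj_set g A \<noteq> {}" using sub_one[OF a(1)] by (auto simp: conj_set_def)
    show "inv x \<in> conj_set g A" if "x \<in> conj_set g A" for x
    proof -
      have x: "x \<in> carrier G" using that NA NC by auto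
      have "inv (inv g \<otimes> x \<otimes> g) \<in> A" using iff[OF x] that sub_i[OF a(1)] by blast
      then show ?thesis using iff[of "inv x"] x assms(3) by (simp add: inv_mult_group m_assoc)
    qed
    show "x \<otimes> y \<in> conj_set g A" if "x \<in> conj_set g A" "y \<in> conj_set g A" for x y
    proof -
      have x: "x \<in> carrier G" "y \<in> carrier G" using that NA NC by auto
      have "(inv g \<otimes> x \<otimes> g) \<otimes> (inv g \<otimes> y \<otimes> g) \<in> A" using iff x that sub_m[OF a(1)] by blast
      then show ?thesis using iff[of "x \<otimes> y"] x assms(3) by (simp add: m_assoc)
    qed
  qed
  show "nsub G (conj_set g A) N"
    unfolding nsub_def
  proof (intro conjI ballI s n(1) NA)
    fix k h assume kh: "k \<in> N" "h \<in> conj_set g A"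
    have c: "k \<in> carrier G" "h \<in> carrier G" using kh NA NC by auto
    have "(inv g \<otimes> k \<otimes> g) \<otimes> (inv g \<otimes> h \<otimes> g) \<otimes> inv (inv g \<otimes> k \<otimes> g) \<in> A"
      using a(4)[OF cjN[OF kh(1)]] iff[OF c(2)] kh(2) by blast
    then have "inv g \<otimes> (k \<otimes> h \<otimes> inv k) \<otimes> g \<in> A"
      using c assms(3) by (simp add: inv_mult_group m_assoc)
    then show "k \<otimes> h \<otimes> inv k \<in> conj_set g A" using iff c by simp
  qed
  have "idx G N (conj_set g A) = card ((\<lambda>x. A #> (inv g \<otimes> x \<otimes> g)) ` N)"
  proof (rule idx_eqI(1)[OF s NC])
    fix x y assume xy: "x \<in> N" "y \<in> N"
    then have c: "x \<in> carrier G" "y \<in> carrier G" using NC by auto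
    show "(A #> (inv g \<otimes> x \<otimes> g) = A #> (inv g \<otimes> y \<otimes> g)) = (x \<otimes> inv y \<in> conj_set g A)"
      using coset_eq_iff[OF a(1), of "inv g \<otimes> x \<otimes> g" "inv g \<otimes> y \<otimes> g"] iff[of "x \<otimes> inv y"] c assms(3)
      by (simp add: inv_mult_group m_assoc)
  qed
  also have "(\<lambda>x. A #> (inv g \<otimes> x \<otimes> g)) ` N = (\<lambda>x. A #> x) ` ((\<lambda>x. inv g \<otimes> x \<otimes> g) ` N)"
    by (simp add: image_image)
  also have "(\<lambda>x. inv g \<otimes> x \<otimes> g) ` N = N"
  proof (intro equalityI subsetI)
    fix x assume x: "x \<in> N"
    then have "x = inv g \<otimes> (g \<otimes> x \<otimes> inv g) \<otimes> g" using NC assms(3) by (auto simp: m_assoc)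
    with n(4)[OF assms(3) x] show "x \<in> (\<lambda>x. inv g \<otimes> x \<otimes> g) ` N" by (rule rev_image_eqI)
  qed (use cjN in auto)
  finally show "idx G N (conj_set g A) = idx G N A" by (simp add: idx_def)
qed

text \<open>The conjugates of \<open>N \<inter> H\<close>, for \<open>N \<le> K\<close> normal in \<open>G\<close>, are finitely many normal subgroups of
  \<open>N\<close> of \<open>p\<close>-power index, so their intersection still has \<open>p\<close>-power index.\<close>

lemma p_open_nsub:
  assumes "p_open p G K" "nsub G H K" "pidx K H"
  shows "p_open p G H"
proof -
  from p_openE[OF assms(1)] obtain N
    where N: "nsub G N (carrier G)" "pidx (carrier G) N" "N \<subseteq> K" .
  note n = nsubD[OF N(1)] and h = nsubD[OF assms(2)]
  define A where "A = N \<inter> H"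
  have A: "nsub G A N" "pidx N A"
    unfolding A_def using nsub_Int[OF assms(2) n(1) N(3)] pidx_Int[OF assms(2) n(1) N(3) assms(3)] by auto
  note a = nsubD[OF A(1)]
  have AC: "A \<subseteq> carrier G" using a n by auto
  define F where "F = (\<lambda>g. conj_set g A) ` carrier G"
  \<comment> \<open>N normalises A, so the conjugate of A by g depends only on the coset of g^-1
    modulo N, and N has finite index.\<close>
  have "finite F"
  proof -
    have "conj_set g A = conj_set g' A" if g: "g \<in> carrier G" "g' \<in> carrier G" "N #> inv g = N #> inv g'" for g g'
    proof -
      have e: "inv g \<otimes> g' \<in> N" using coset_eq_iff[OF n(1), of "inv g" "inv g'"] g by simp
      have e': "inv g' \<otimes> g \<in> N" using sub_i[OF n(1) e] g by (simp add: inv_mult_group)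
      have *: "inv g' \<otimes> x \<otimes> g' \<in> A"
        if g: "g \<in> carrier G" "g' \<in> carrier G" and x: "x \<in> carrier G" "inv g \<otimes> x \<otimes> g \<in> A" "inv g' \<otimes> g \<in> N" for g g' x
        using a(4)[OF x(3,2)] x(1) g by (simp add: inv_mult_group m_assoc)
      have "inv g \<otimes> x \<otimes> g \<in> A \<longleftrightarrow> inv g' \<otimes> x \<otimes> g' \<in> A" if "x \<in> carrier G" for x
        using *[OF g(1,2) that _ e'] *[OF g(2,1) that _ e] by blast
      then have "x \<in> conj_set g A \<longleftrightarrow> x \<in> conj_set g' A" if "x \<in> carrier G" for x
        using conj_set_iff[OF AC g(1) that] conj_set_iff[OF AC g(2) that] that by simp
      moreover have "conj_set g A \<subseteq> carrier G" "conj_set g' A \<subseteq> carrier G" using AC g by (auto simp: conj_set_def)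
      ultimately show ?thesis by blast
    qed
    then have "finite ((\<lambda>g. conj_set g A) ` carrier G)" if "finite ((\<lambda>g. N #> inv g) ` carrier G)"
      using finite_image_factor[of "carrier G" "\<lambda>g. N #> inv g" "\<lambda>g. conj_set g A"] that by blast
    moreover have "(\<lambda>g. N #> inv g) ` carrier G \<subseteq> (\<lambda>g. N #> g) ` carrier G" by auto
    ultimately show ?thesis using pidx_finite[OF N(2)] finite_subset unfolding F_def by blast
  qed
  define M where "M = \<Inter>F"
  have M: "nsub G M N \<and> pidx N M"
    unfolding M_def
  proof (rule nsub_pidx_Inter[OF \<open>finite F\<close>])
    show "F \<noteq> {}" by (auto simp: F_def)
    show "nsub G B N \<and> pidx N B" if "B \<in> F" for B
      using that nsub_conj_set[OF N(1) A(1)] A(2) by (auto simp: F_def pidx_def)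
  qed
  then have m: "subgroup M G" "M \<subseteq> N" by (auto simp: nsub_def)
  have mc: "M \<subseteq> carrier G" using m n(3) by blast
  have iff: "x \<in> M \<longleftrightarrow> (\<forall>g\<in>carrier G. inv g \<otimes> x \<otimes> g \<in> A)" if "x \<in> carrier G" for x
    unfolding M_def F_def using conj_set_iff[OF AC _ that] by auto
  have "nsub G M (carrier G)"
    unfolding nsub_def
  proof (intro conjI ballI m subgroup_self mc)
    fix k x assume k: "k \<in> carrier G" "x \<in> M"
    then have x: "x \<in> carrier G" using mc by auto
    have "inv g \<otimes> (k \<otimes> x \<otimes> inv k) \<otimes> g \<in> A" if "g \<in> carrier G" for g
    proof -
      have "inv (inv k \<otimes> g) \<otimes> x \<otimes> (inv k \<otimes> g) \<in> A" using iff[OF x] k that by blast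
      then show ?thesis using k x that by (simp add: inv_mult_group m_assoc)
    qed
    then show "k \<otimes> x \<otimes> inv k \<in> M" using iff[of "k \<otimes> x \<otimes> inv k"] k x by simp
  qed
  moreover have "pidx (carrier G) M"
    using pidx_tower[OF m(1) n(1,2) m(2) n(3)] N(2) M by simp
  moreover have "M \<subseteq> H"
  proof
    fix x assume "x \<in> M"
    then have x: "x \<in> carrier G" using mc by auto
    then have "inv \<one> \<otimes> x \<otimes> \<one> \<in> A" using iff[OF x] \<open>x \<in> M\<close> by blast
    then show "x \<in> H" using x by (simp add: A_def)
  qed
  ultimately have "M \<in> p_power_normal p G" "M \<subseteq> H" by (simp_all add: p_power_normal_iff)
  with h(1) show ?thesis unfolding p_open_def by (intro conjI bexI[of _ M])
qed

text \<open>The action factors through the finite p-group H/N, though H itself may be infinite.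
  Orbits have size [H : S] for a stabiliser S containing N, hence p-power size, and
  \<open>exists_other_singleton_class\<close> applies.\<close>

lemma fixed_point:
  assumes "subgroup H G" "subgroup N G" "N \<subseteq> H" "pidx H N" "finite E" "p dvd card E"
    and act: "\<And>h e. h \<in> H \<Longrightarrow> e \<in> E \<Longrightarrow> act h e \<in> E" "\<And>e. e \<in> E \<Longrightarrow> act \<one> e = e"
      "\<And>h h' e. h \<in> H \<Longrightarrow> h' \<in> H \<Longrightarrow> e \<in> E \<Longrightarrow> act (h \<otimes> h') e = act h (act h' e)"
    and triv: "\<And>n e. n \<in> N \<Longrightarrow> e \<in> E \<Longrightarrow> act n e = e"
    and e0: "e0 \<in> E" "\<And>h. h \<in> H \<Longrightarrow> act h e0 = e0"
  shows "\<exists>e\<in>E. e \<noteq> e0 \<and> (\<forall>h\<in>H. act h e = e)"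
proof -
  define r where "r = {(e, e'). e \<in> E \<and> e' \<in> E \<and> (\<exists>h\<in>H. e' = act h e)}"
  have HC: "\<And>h. h \<in> H \<Longrightarrow> h \<in> carrier G" using sub_in[OF assms(1)] .
  have inv_act: "act (inv h) (act h e) = e" if "h \<in> H" "e \<in> E" for h e
    using act(3)[of "inv h" h e] act(2) that sub_i[OF assms(1)] HC by simp
  have "equiv E r"
  proof (rule equivI)
    show "r \<subseteq> E \<times> E" by (auto simp: r_def)
    show "refl_on E r" unfolding refl_on_def r_def using act(2) sub_one[OF assms(1)] by force
    show "sym r" unfolding sym_def r_def using inv_act sub_i[OF assms(1)] by force
    show "trans r"
    proof (rule transI)
      fix x y z assume "(x, y) \<in> r" "(y, z) \<in> r"
      then obtain h h' where "x \<in> E" "z \<in> E" "h \<in> H" "h' \<in> H" "z = act h' (act h x)" by (auto simp: r_def)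
      then show "(x, z) \<in> r"
        unfolding r_def using act(3)[of h' h x] sub_m[OF assms(1), of h' h] act(1)
        by (auto intro!: bexI[of _ "h' \<otimes> h"])
    qed
  qed
  have cl: "r `` {e} = (\<lambda>h. act h e) ` H" if "e \<in> E" for e
    using that act(1) by (auto simp: r_def)
  have "\<exists>e\<in>E. e \<noteq> e0 \<and> r `` {e} = {e}"
  proof (rule exists_other_singleton_class[OF assms(5) \<open>equiv E r\<close> _ assms(6) p_gt_1 e0(1)])
    show "r `` {e0} = {e0}" using cl[OF e0(1)] e0(2) sub_one[OF assms(1)] by auto
    fix X assume "X \<in> E // r"
    then obtain e where e: "e \<in> E" "X = (\<lambda>h. act h e) ` H" using cl by (auto elim: quotientE)
    define S where "S = {h \<in> H. act h e = e}"
    have SG: "subgroup S G"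
    proof (rule subgroupI)
      show "S \<subseteq> carrier G" using HC by (auto simp: S_def)
      show "S \<noteq> {}" using act(2)[OF e(1)] sub_one[OF assms(1)] by (auto simp: S_def)
      show "inv a \<in> S" if "a \<in> S" for a
        using that inv_act[of a e] e sub_i[OF assms(1)] by (auto simp: S_def)
      show "a \<otimes> b \<in> S" if "a \<in> S" "b \<in> S" for a b
        using that act(3)[of a b e] e sub_m[OF assms(1)] by (auto simp: S_def)
    qed
    have NS: "N \<subseteq> S" using triv e assms(3) by (auto simp: S_def)
    \<comment> \<open>Indices are counted with right cosets S h, and it is the point h^-1 e, not h
      e, that is constant on them.\<close>
    have "idx G H S = card ((\<lambda>h. act (inv h) e) ` H)"
    proof (rule idx_eqI(1)[OF SG])
      show "H \<subseteq> carrier G" using HC by auto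
      fix a b assume ab: "a \<in> H" "b \<in> H"
      have i: "inv a \<in> H" "inv b \<in> H" using ab sub_i[OF assms(1)] by auto
      have m: "a \<otimes> inv b \<in> H" using ab i sub_m[OF assms(1)] by auto
      have e1: "act (a \<otimes> inv b) e = act a (act (inv b) e)" using act(3)[OF ab(1) i(2) e(1)] .
      have e2: "act a (act (inv a) e) = e" using inv_act[OF i(1) e(1)] ab HC by simp
      show "(act (inv a) e = act (inv b) e) = (a \<otimes> inv b \<in> S)"
      proof
        assume "act (inv a) e = act (inv b) e"
        then show "a \<otimes> inv b \<in> S" using m e1 e2 by (simp add: S_def)
      next
        assume "a \<otimes> inv b \<in> S"
        then have "act a (act (inv b) e) = e" using e1 by (simp add: S_def)
        then show "act (inv a) e = act (inv b) e"
          using inv_act[OF ab(1), of "act (inv b) e"] act(1)[OF i(2) e(1)] by simp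
      qed
    qed
    also have "(\<lambda>h. act (inv h) e) ` H = X"
    proof -
      have "(\<lambda>h. inv h) ` H = H" using sub_i[OF assms(1)] HC by (auto simp: image_iff) (metis inv_inv)
      moreover have "(\<lambda>h. act (inv h) e) ` H = (\<lambda>h. act h e) ` ((\<lambda>h. inv h) ` H)"
        by (simp only: image_image)
      ultimately show ?thesis using e(2) by simp
    qed
    finally have "card X = idx G H S" by simp
    moreover have "pidx H S"
      using pidx_tower[OF assms(2) SG assms(1) NS] assms(4) by (auto simp: S_def)
    ultimately show "\<exists>k. card X = p ^ k" by (simp add: pidx_def)
  qed
  then obtain e where "e \<in> E" "e \<noteq> e0" "r `` {e} = {e}" by blast
  then show ?thesis using cl[of e] by (intro bexI[of _ e]) auto
qed

lemma coset_act:
  assumes "subgroup H G" "a \<in> carrier G" "h \<in> carrier G"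
  shows "(H #> a) #> h = H #> (a \<otimes> h)"
  by (rule coset_mult_assoc[OF subgroup.subset[OF assms(1)] assms(2,3)])

lemma conj_pow:
  assumes "subgroup H G" "x \<in> carrier G" "\<And>h. h \<in> H \<Longrightarrow> x \<otimes> h \<otimes> inv x \<in> H" "h \<in> H"
  shows "x [^] (n::nat) \<otimes> h \<otimes> inv (x [^] n) \<in> H"
proof (induction n)
  case 0 then show ?case using assms sub_in[OF assms(1)] by simp
next
  case (Suc n)
  have c: "h \<in> carrier G" using sub_in[OF assms(1,4)] .
  have "x \<otimes> (x [^] n \<otimes> h \<otimes> inv (x [^] n)) \<otimes> inv x \<in> H" using assms(3) Suc .
  moreover have "x \<otimes> (x [^] n \<otimes> h \<otimes> inv (x [^] n)) \<otimes> inv x = x [^] Suc n \<otimes> h \<otimes> inv (x [^] Suc n)"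
    unfolding nat_pow_Suc2[OF assms(2)] using assms(2) c by (simp add: m_assoc inv_mult_group)
  ultimately show ?case by simp
qed

lemma conj_int_pow:
  assumes "subgroup H G" "x \<in> carrier G" "\<And>h. h \<in> H \<Longrightarrow> x \<otimes> h \<otimes> inv x \<in> H"
    "\<And>h. h \<in> H \<Longrightarrow> inv x \<otimes> h \<otimes> x \<in> H" "h \<in> H"
  shows "x [^] (i::int) \<otimes> h \<otimes> inv (x [^] i) \<in> H"
proof (cases i rule: int_cases2)
  case (nonneg n) then show ?thesis using conj_pow[OF assms(1-3,5)] by (simp add: int_pow_int)
next
  case (nonpos n)
  then show ?thesis
    using conj_pow[of H "inv x" h n] assms by (simp add: int_pow_neg int_pow_int flip: nat_pow_inv)
qed

lemma int_pow_mem_iff: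
  assumes H: "subgroup H G" and x: "x \<in> carrier G" "x \<notin> H" "x [^] p \<in> H"
  shows "x [^] (i::int) \<in> H \<longleftrightarrow> int p dvd i"
proof
  have xp: "x [^] int p \<in> H" using x(3) by (simp only: int_pow_int)
  show "x [^] i \<in> H" if "int p dvd i"
    using that sub_ipow[OF H xp] by (auto simp: int_pow_pow[OF x(1)] elim!: dvdE)
  show "int p dvd i" if xi: "x [^] i \<in> H"
  proof (rule ccontr)
    assume "\<not> int p dvd i"
    then have "coprime i (int p)"
      using prime_p by (metis coprime_commute prime_imp_coprime prime_int_nat_transfer zero_le_imp_eq_int of_nat_0_le_iff nat_int prime_nat_int_transfer)
    then obtain u v where uv: "u * i + v * int p = 1"
      using bezout_int[of i "int p"] by (auto simp: coprime_iff_gcd_eq_1)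
    have "x = x [^] (i * u) \<otimes> x [^] (int p * v)"
      using int_pow_mult[OF x(1)] uv x(1) by (metis int_pow_1 mult.commute)
    also have "\<dots> = (x [^] i) [^] u \<otimes> (x [^] int p) [^] v"
      using int_pow_pow[OF x(1)] by simp
    also have "\<dots> \<in> H" by (rule sub_m[OF H sub_ipow[OF H xi] sub_ipow[OF H xp]])
    finally show False using x(2) by blast
  qed
qed

text \<open>The subgroup generated by H and an x that normalises it; the quotient by H is cyclic of
  order p, generated by x.\<close>

lemma adjoin:
  assumes H: "subgroup H G" and x: "x \<in> carrier G" "x \<notin> H" "x [^] p \<in> H"
    and nx: "\<And>h. h \<in> H \<Longrightarrow> x \<otimes> h \<otimes> inv x \<in> H" "\<And>h. h \<in> H \<Longrightarrow> inv x \<otimes> h \<otimes> x \<in> H"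
  defines "H' \<equiv> {h \<otimes> x [^] (i::int) |h i. h \<in> H}"
  shows "nsub G H H'" "idx G H' H = p" "x \<in> H'"
proof -
  have c: "\<And>h. h \<in> H \<Longrightarrow> h \<in> carrier G" using sub_in[OF H] .
  have cp: "x [^] i \<otimes> h \<otimes> inv (x [^] i) \<in> H" if "h \<in> H" for h and i :: int
    by (rule conj_int_pow[OF H x(1) _ _ that]) (use nx in auto)
  have xi: "x [^] (i::int) \<in> carrier G" for i using x by simp
  have s: "subgroup H' G"
  proof (rule subgroupI)
    show "H' \<subseteq> carrier G" using c x by (auto simp: H'_def)
    show "H' \<noteq> {}" using sub_one[OF H] by (auto simp: H'_def)
  next
    fix y assume "y \<in> H'"
    then obtain h i where y: "y = h \<otimes> x [^] (i::int)" "h \<in> H" by (auto simp: H'_def)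
    have "inv y = (x [^] (-i) \<otimes> inv h \<otimes> inv (x [^] (-i))) \<otimes> x [^] (-i)"
      using y c xi x(1) by (simp add: int_pow_neg inv_mult_group m_assoc)
    then show "inv y \<in> H'" using cp[OF sub_i[OF H y(2)], of "-i"] unfolding H'_def by blast
  next
    fix y z assume "y \<in> H'" "z \<in> H'"
    then obtain h i h' j where y: "y = h \<otimes> x [^] (i::int)" "h \<in> H" "z = h' \<otimes> x [^] (j::int)" "h' \<in> H"
      unfolding H'_def by blast
    have "y \<otimes> z = (h \<otimes> (x [^] i \<otimes> h' \<otimes> inv (x [^] i))) \<otimes> x [^] (i + j)"
      using y c xi x(1) by (simp add: m_assoc int_pow_mult)
    then show "y \<otimes> z \<in> H'" using sub_m[OF H y(2) cp[OF y(4), of i]] unfolding H'_def by blast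
  qed
  have HH: "H \<subseteq> H'"
  proof
    fix h assume "h \<in> H"
    then have "h = h \<otimes> x [^] (0::int)" using c by simp
    then show "h \<in> H'" using \<open>h \<in> H\<close> unfolding H'_def by blast
  qed
  have "x = \<one> \<otimes> x [^] (1::int)" using x by (simp add: int_pow_1)
  then show "x \<in> H'" using sub_one[OF H] unfolding H'_def by blast
  show "nsub G H H'"
    unfolding nsub_def
  proof (intro conjI ballI H s HH)
    fix k h assume "k \<in> H'" and h: "h \<in> H"
    then obtain h' i where k: "k = h' \<otimes> x [^] (i::int)" "h' \<in> H" unfolding H'_def by blast
    have "k \<otimes> h \<otimes> inv k = h' \<otimes> (x [^] i \<otimes> h \<otimes> inv (x [^] i)) \<otimes> inv h'"
      using k h c xi x(1) by (simp add: m_assoc inv_mult_group)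
    then show "k \<otimes> h \<otimes> inv k \<in> H"
      using sub_m[OF H sub_m[OF H k(2) cp[OF h, of i]] sub_i[OF H k(2)]] by simp
  qed
  have "(\<lambda>k. H #> k) ` H' = (\<lambda>i. H #> (x [^] i)) ` {..<p}"
  proof (intro equalityI subsetI)
    fix X assume "X \<in> (\<lambda>k. H #> k) ` H'"
    then obtain h i where k: "X = H #> (h \<otimes> x [^] (i::int))" "h \<in> H" unfolding H'_def by blast
    define j where "j = nat (i mod int p)"
    have j: "j < p" "int j = i mod int p" using p_gt_1 by (simp_all add: j_def nat_less_iff)
    have "(x [^] p) [^] (i div int p) = x [^] (int p * (i div int p))"
      using x(1) by (metis int_pow_int int_pow_pow)
    moreover have "(x [^] p) [^] (i div int p) \<in> H" by (rule sub_ipow[OF H x(3)])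
    moreover have "x [^] i = x [^] (int p * (i div int p)) \<otimes> x [^] j"
      using int_pow_mult[OF x(1), of "int p * (i div int p)" "i mod int p"] j(2)
      by (metis int_pow_int mult_div_mod_eq)
    ultimately have "x [^] i \<otimes> inv (x [^] j) \<in> H" using x(1) by (simp add: m_assoc)
    then have "h \<otimes> x [^] i \<otimes> inv (x [^] j) \<in> H"
      using sub_m[OF H k(2)] k(2) c xi x(1) by (simp add: m_assoc)
    then have "X = H #> (x [^] j)"
      unfolding k(1) using coset_eq_iff[OF H, of "h \<otimes> x [^] i" "x [^] j"] c[OF k(2)] xi x(1) by simp
    then show "X \<in> (\<lambda>i. H #> (x [^] i)) ` {..<p}" using j(1) by blast
  next
    fix X assume "X \<in> (\<lambda>i. H #> (x [^] i)) ` {..<p}"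
    then obtain i :: nat where i: "X = H #> (x [^] i)" by blast
    have "x [^] i = \<one> \<otimes> x [^] int i" using x(1) by (simp add: int_pow_int)
    then have "x [^] i \<in> H'" using sub_one[OF H] unfolding H'_def by blast
    then show "X \<in> (\<lambda>k. H #> k) ` H'" using i by blast
  qed
  moreover have "inj_on (\<lambda>i. H #> (x [^] i)) {..<p}"
  proof -
    have *: False if ij: "i < j" "j < p" "H #> (x [^] i) = H #> (x [^] j)" for i j :: nat
    proof -
      have "x [^] j \<otimes> inv (x [^] i) \<in> H"
        using coset_eq_iff[OF H, of "x [^] j" "x [^] i"] ij x(1) by simp
      moreover have "x [^] j = x [^] (j - i) \<otimes> x [^] i"
        using nat_pow_mult[OF x(1), of "j - i" i] ij by simp
      ultimately have "x [^] (j - i) \<in> H" using x(1) by (simp add: m_assoc)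
      then have "int p dvd int (j - i)" using int_pow_mem_iff[OF H x, of "int (j - i)"] by (simp add: int_pow_int)
      then have "p dvd j - i" by (simp only: int_dvd_int_iff)
      then show False using ij dvd_imp_le[of p "j - i"] by simp
    qed
    show ?thesis
    proof (rule inj_onI)
      fix i j assume "i \<in> {..<p}" "j \<in> {..<p}" "H #> (x [^] i) = H #> (x [^] j)"
      then show "i = j" using *[of i j] *[of j i] by (metis lessThan_iff linorder_neqE_nat)
    qed
  qed
  ultimately show "idx G H' H = p" unfolding idx_def by (simp add: card_image)
qed

lemma idx_pos: "pidx K H \<Longrightarrow> idx G K H > 0"
  unfolding pidx_def using p_gt_1 by auto

lemma pow_least_notin:
  assumes "a \<in> carrier G" "a \<notin> H" "a [^] (p ^ n) \<in> H"
  obtains e where "a [^] (p ^ e) \<notin> H" "(a [^] (p ^ e)) [^] p \<in> H"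
proof -
  define m where "m = (LEAST m. a [^] (p ^ m) \<in> H)"
  have m: "a [^] (p ^ m) \<in> H" unfolding m_def by (rule LeastI[of _ n]) (rule assms(3))
  have "m \<noteq> 0" using m assms by (metis nat_pow_eone power_0)
  then have "a [^] (p ^ (m - 1)) \<notin> H"
    using not_less_Least[of "m - 1" "\<lambda>m. a [^] (p ^ m) \<in> H"] unfolding m_def[symmetric] by simp
  moreover have "(a [^] (p ^ (m - 1))) [^] p \<in> H"
    using m \<open>m \<noteq> 0\<close> assms(1) by (simp add: nat_pow_pow flip: power_Suc2)
  ultimately show thesis by (rule that)
qed

text \<open>\<open>H\<close> acts on its cosets with orbits of \<open>p\<close>-power size; a second fixed point normalises \<open>H\<close>.\<close>

lemma p_open_parent:
  assumes "p_open p G H" "H \<noteq> carrier G"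
  obtains K where "p_open p G K" "nsub G H K" "idx G K H = p"
proof -
  have H: "subgroup H G" by (rule p_open_subgroup[OF assms(1)])
  have HC: "H \<subseteq> carrier G" by (rule subgroup.subset[OF H])
  have c: "\<And>h. h \<in> H \<Longrightarrow> h \<in> carrier G" using HC by blast
  from p_openE[OF assms(1)] obtain N
    where N: "nsub G N (carrier G)" "pidx (carrier G) N" "N \<subseteq> H" .
  note n = nsubD[OF N(1)]
  define E where "E = (\<lambda>k. H #> k) ` carrier G"
  have HN: "pidx H N" using pidx_tower[OF n(1) H subgroup_self N(3) HC] N(2) by simp
  have finE: "finite E" unfolding E_def by (rule pidx_finite[OF p_open_pidx[OF assms(1)]])
  obtain m where m: "card E = p ^ m"
    using p_open_pidx[OF assms(1)] unfolding pidx_def idx_def E_def by blast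
  have "m \<noteq> 0"
    using m idx_1_eq[OF H subgroup_self HC] assms(2) by (auto simp: idx_def E_def)
  \<comment> \<open>Right multiplication by the inverse makes this a left action of H on its right
    cosets. N acts trivially because it is normal in G and contained in H. A fixed coset H a means a
    H a^-1 \<subseteq> H.\<close>
  have "\<exists>e\<in>E. e \<noteq> H \<and> (\<forall>h\<in>H. e #> inv h = e)"
  proof (rule fixed_point[OF H n(1) N(3) HN finE, where act = "\<lambda>h X. X #> inv h"])
    show "p dvd card E" using m \<open>m \<noteq> 0\<close> by simp
    show "H \<in> E" unfolding E_def using coset_mult_one[OF HC] by (metis image_eqI one_closed)
    show "H #> inv h = H" if "h \<in> H" for h
      using coset_eq_iff[OF H, of "inv h" \<one>] that c sub_i[OF H that] coset_mult_one[OF HC] by simp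
  next
    fix h e assume h: "h \<in> H" "e \<in> E"
    then obtain a where a: "a \<in> carrier G" "e = H #> a" by (auto simp: E_def)
    show "e #> inv h \<in> E" unfolding E_def using a c[OF h(1)] coset_act[OF H a(1)] by simp
  next
    fix e assume "e \<in> E"
    then obtain a where a: "a \<in> carrier G" "e = H #> a" by (auto simp: E_def)
    show "e #> inv \<one> = e" using a coset_act[OF H a(1)] by simp
  next
    fix h h' e assume h: "h \<in> H" "h' \<in> H" "e \<in> E"
    then obtain a where a: "a \<in> carrier G" "e = H #> a" by (auto simp: E_def)
    show "e #> inv (h \<otimes> h') = e #> inv h' #> inv h"
      using a c[OF h(1)] c[OF h(2)] coset_act[OF H] by (simp add: inv_mult_group m_assoc)
  next
    fix g e assume h: "g \<in> N" "e \<in> E"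
    then obtain a where a: "a \<in> carrier G" "e = H #> a" by (auto simp: E_def)
    have gc: "g \<in> carrier G" using h(1) n(3) by blast
    have "a \<otimes> inv g \<otimes> inv a \<in> H" using n(4)[OF a(1) sub_i[OF n(1) h(1)]] N(3) by blast
    then show "e #> inv g = e"
      using a gc coset_act[OF H a(1)] coset_eq_iff[OF H, of "a \<otimes> inv g" a] by simp
  qed
  then obtain a where a: "a \<in> carrier G" "H #> a \<noteq> H" "\<And>h. h \<in> H \<Longrightarrow> H #> a #> inv h = H #> a"
    by (auto simp: E_def)
  have aH: "a \<notin> H" using a(1,2) coset_eq_iff[OF H a(1) one_closed] coset_mult_one[OF HC] by auto
  have norm: "a \<otimes> h \<otimes> inv a \<in> H" if "h \<in> H" for h
  proof -
    have "H #> (a \<otimes> h) = H #> a"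
      using a(3)[OF sub_i[OF H that]] c[OF that] coset_act[OF H a(1)] by simp
    then show ?thesis using coset_eq_iff[OF H, of "a \<otimes> h" a] a c[OF that] by simp
  qed
  obtain k where k: "idx G (carrier G) N = p ^ k" using N(2) unfolding pidx_def by blast
  have ak: "a [^] (p ^ k) \<in> H" using nsub_pow_idx[OF N(1) a(1)] k N(3) by auto
  \<comment> \<open>So far only a H a^-1 \<subseteq> H is known. The other inclusion holds because q
    = a^(p^k) lies in H: conjugation by a^-1 is conjugation by q^-1, which preserves H, followed by
    conjugation by a^(p^k - 1).\<close>
  have norm_inv: "inv a \<otimes> h \<otimes> a \<in> H" if h: "h \<in> H" for h
  proof -
    let ?q = "a [^] (p ^ k)" and ?r = "a [^] (p ^ k - 1)"
    have "inv ?q \<otimes> h \<otimes> ?q \<in> H"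
      using sub_m[OF H sub_m[OF H sub_i[OF H ak] h] ak] .
    then have *: "?r \<otimes> (inv ?q \<otimes> h \<otimes> ?q) \<otimes> inv ?r \<in> H" using conj_pow[OF H a(1) norm] by blast
    have e: "Suc (p ^ k - 1) = p ^ k" using p_gt_1 by simp
    have q': "?q = a \<otimes> ?r" using nat_pow_Suc2[OF a(1), of "p ^ k - 1"] unfolding e .
    have "?r \<otimes> (inv ?q \<otimes> h \<otimes> ?q) \<otimes> inv ?r = inv a \<otimes> h \<otimes> a"
    proof -
      have "?r \<otimes> (inv ?q \<otimes> h \<otimes> ?q) \<otimes> inv ?r = (?r \<otimes> inv ?q) \<otimes> h \<otimes> (?q \<otimes> inv ?r)"
        using a(1) c[OF h] by (simp add: m_assoc)
      also have "?r \<otimes> inv ?q = inv a" using a(1) unfolding q' by (simp add: inv_mult_group)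
      also have "?q \<otimes> inv ?r = a" using a(1) unfolding q' by (simp add: m_assoc)
      finally show ?thesis .
    qed
    with * show ?thesis by simp
  qed
  \<comment> \<open>The last of the iterated p-th powers of a that is still outside H: its p-th
    power is in H, so adjoining it gives a group in which H has index exactly p.\<close>
  obtain e where e: "a [^] (p ^ e) \<notin> H" "(a [^] (p ^ e)) [^] p \<in> H"
    using pow_least_notin[OF a(1) aH ak] .
  let ?x = "a [^] (p ^ e)"
  let ?K = "{h \<otimes> ?x [^] (i::int) |h i. h \<in> H}"
  have xc: "?x \<in> carrier G" using a by simp
  have nx: "?x \<otimes> h \<otimes> inv ?x \<in> H" if "h \<in> H" for h using conj_pow[OF H a(1) norm that] .
  have nx': "inv ?x \<otimes> h \<otimes> ?x \<in> H" if "h \<in> H" for h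
    using conj_pow[of H "inv a" h "p ^ e"] H a(1) norm_inv that by (simp flip: nat_pow_inv)
  note K = adjoin[OF H xc e nx nx']
  show thesis
    using that[of ?K] K p_open_mono[OF assms(1) nsubD(2,3)[OF K(1)]] by blast
qed

section \<open>Subnormal subgroups of p-power index\<close>

lemma subnormal_carrier: "subnormal G (carrier G)"
  unfolding subnormal_def by (intro exI[of _ 0] exI[of _ "\<lambda>_. carrier G"]) simp

lemma subnormal_step:
  assumes "subnormal G K" "nsub G H K"
  shows "subnormal G H"
proof -
  obtain k C where C: "C 0 = carrier G" "C k = K" "\<And>i. i < k \<Longrightarrow> C (Suc i) \<lhd> G\<lparr>carrier := C i\<rparr>"
    using assms(1) unfolding subnormal_def by blast
  have "H \<lhd> G\<lparr>carrier := K\<rparr>" using normal_iff_nsub[OF nsubD(2)[OF assms(2)]] assms(2) by blast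
  then show ?thesis
    unfolding subnormal_def using C
    by (intro exI[of _ "Suc k"] exI[of _ "C(Suc k := H)"]) (auto simp: less_Suc_eq)
qed

text \<open>\<open>p_open_parent\<close> leads upwards from H to G through steps of index p; read
  backwards it is an induction starting at the whole group. It is used for G and again for the
  completion.\<close>

lemma p_open_induct [consumes 1, case_names carrier step]:
  assumes "p_open p G H" "P (carrier G)"
    "\<And>H K. p_open p G H \<Longrightarrow> p_open p G K \<Longrightarrow> nsub G H K \<Longrightarrow> idx G K H = p \<Longrightarrow> P K \<Longrightarrow> P H"
  shows "P H"
  using assms(1)
proof (induction "idx G (carrier G) H" arbitrary: H rule: less_induct)
  case less
  show ?case
  proof (cases "H = carrier G")
    case False
    from p_open_parent[OF less.prems False] obtain K
      where K: "p_open p G K" "nsub G H K" "idx G K H = p" .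
    have "idx G (carrier G) H = idx G (carrier G) K * p"
      using idx_tower[OF nsubD(1,2)[OF K(2)] subgroup_self nsubD(3)[OF K(2)]
          subgroup.subset[OF nsubD(2)[OF K(2)]]] K(3) by simp
    then have "idx G (carrier G) K < idx G (carrier G) H"
      using p_gt_1 idx_pos[OF p_open_pidx[OF K(1)]] by simp
    then show ?thesis using less.hyps K assms(3) less.prems by blast
  qed (use assms(2) in simp)
qed

text \<open>By the tower formula all terms of the chain and all its successive indices are powers of
  p, so \<open>p_open_nsub\<close> can be applied down the chain.\<close>

lemma subnormal_imp_p_open:
  assumes "subnormal G H" "pidx (carrier G) H"
  shows "p_open p G H"
proof -
  obtain k C where C: "C 0 = carrier G" "C k = H" "\<And>i. i < k \<Longrightarrow> C (Suc i) \<lhd> G\<lparr>carrier := C i\<rparr>"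
    using assms(1) unfolding subnormal_def by blast
  have sg: "subgroup (C i) G" if "i \<le> k" for i
    using that
  proof (induction i)
    case 0 then show ?case using C(1) subgroup_self by simp
  next
    case (Suc i)
    then show ?case using normal_iff_nsub[of "C i" "C (Suc i)"] C(3)[of i] nsubD(1) by auto
  qed
  have ns: "nsub G (C (Suc i)) (C i)" if "i < k" for i
    using normal_iff_nsub[OF sg[of i], of "C (Suc i)"] C(3)[OF that] that by simp
  have dec: "C k \<subseteq> C i" if "i \<le> k" for i
    using that
  proof (induction rule: inc_induct)
    case (step j) then show ?case using nsubD(3)[OF ns[of j]] by blast
  qed simp
  have pc: "pidx (carrier G) (C i)" if "i \<le> k" for i
    using pidx_tower[OF sg[of k] sg[OF that] subgroup_self dec[OF that] subgroup.subset[OF sg[OF that]]]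
      assms(2) C(2) by simp
  have "p_open p G (C i)" if "i \<le> k" for i
    using that
  proof (induction i)
    case 0 then show ?case using C(1) p_open_carrier by simp
  next
    case (Suc i)
    have "pidx (C i) (C (Suc i))"
      using pidx_tower[OF sg[OF Suc.prems] sg[of i] subgroup_self nsubD(3)[OF ns[of i]] subgroup.subset[OF sg[of i]]]
        pc[OF Suc.prems] Suc.prems by simp
    then show ?case using p_open_nsub[OF _ ns[of i]] Suc by simp
  qed
  then show ?thesis using C(2) by blast
qed

lemma p_open_iff_subnormal: "p_open p G H \<longleftrightarrow> subnormal G H \<and> pidx (carrier G) H"
proof
  assume H: "p_open p G H"
  then have "subnormal G H"
    by (induction rule: p_open_induct) (auto intro: subnormal_carrier subnormal_step)
  then show "subnormal G H \<and> pidx (carrier G) H" using p_open_pidx[OF H] by blast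
qed (use subnormal_imp_p_open in blast)

text \<open>In the finite p-group K/N the nontrivial normal subgroup A/N meets the centre
  nontrivially. The element z represents a second fixed point of conjugation by K on the cosets of N
  in A.\<close>

lemma central_mod:
  assumes "nsub G N K" "pidx K N" "nsub G A K" "N \<subseteq> A" "N \<noteq> A"
  shows "\<exists>z\<in>A. z \<notin> N \<and> (\<forall>k\<in>K. k \<otimes> z \<otimes> inv k \<otimes> inv z \<in> N)"
proof -
  note n = nsubD[OF assms(1)] and a = nsubD[OF assms(3)]
  have KC: "K \<subseteq> carrier G" and NC: "N \<subseteq> carrier G" using subgroup.subset n(1,2) by blast+
  have c: "\<And>k. k \<in> K \<Longrightarrow> k \<in> carrier G" "\<And>k. k \<in> N \<Longrightarrow> k \<in> carrier G" "\<And>k. k \<in> A \<Longrightarrow> k \<in> carrier G"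
    using KC NC a(3) by auto
  have AN: "pidx A N" using pidx_tower[OF n(1) a(1) n(2) assms(4) a(3)] assms(2) by blast
  define E where "E = (\<lambda>k. N #> k) ` A"
  define act where "act k X = (\<lambda>x. k \<otimes> x \<otimes> inv k) ` X" for k X
  have act: "act k (N #> x) = N #> (k \<otimes> x \<otimes> inv k)" if kx: "k \<in> K" "x \<in> A" for k x
  proof (intro equalityI subsetI)
    fix y assume "y \<in> act k (N #> x)"
    then obtain g where g: "g \<in> N" "y = k \<otimes> (g \<otimes> x) \<otimes> inv k" by (auto simp: act_def r_coset_def)
    have "y = (k \<otimes> g \<otimes> inv k) \<otimes> (k \<otimes> x \<otimes> inv k)" using g kx c by (simp add: m_assoc)
    then show "y \<in> N #> (k \<otimes> x \<otimes> inv k)" using n(4)[OF kx(1) g(1)] by (auto simp: r_coset_def)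
  next
    fix y assume "y \<in> N #> (k \<otimes> x \<otimes> inv k)"
    then obtain g where g: "g \<in> N" "y = g \<otimes> (k \<otimes> x \<otimes> inv k)" by (auto simp: r_coset_def)
    have ik: "inv k \<in> K" using sub_i[OF n(2) kx(1)] .
    have gk: "inv k \<otimes> g \<otimes> k \<in> N" using n(4)[OF ik g(1)] c kx by simp
    have "y = k \<otimes> ((inv k \<otimes> g \<otimes> k) \<otimes> x) \<otimes> inv k" using g kx c by (simp add: m_assoc)
    then show "y \<in> act k (N #> x)" unfolding act_def r_coset_def using gk by blast
  qed
  obtain m where m: "card E = p ^ m" using AN unfolding pidx_def idx_def E_def by blast
  have "m \<noteq> 0" using m idx_1_eq[OF n(1) a(1) assms(4)] assms(5) by (auto simp: idx_def E_def)
  have "\<exists>e\<in>E. e \<noteq> N \<and> (\<forall>k\<in>K. act k e = e)"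
  proof (rule fixed_point[OF n(2) n(1) n(3) assms(2)])
    show "finite E" unfolding E_def by (rule pidx_finite[OF AN])
    show "p dvd card E" using m \<open>m \<noteq> 0\<close> by simp
    show N: "N \<in> E" unfolding E_def using coset_mult_one[OF NC] sub_one[OF a(1)] by (metis image_eqI)
    show "act k N = N" if "k \<in> K" for k
      using act[OF that sub_one[OF a(1)]] coset_mult_one[OF NC] that c by simp
    show "act k e \<in> E" if "k \<in> K" "e \<in> E" for k e
      using that act a(4) by (auto simp: E_def)
    show "act \<one> e = e" if "e \<in> E" for e
      using that act[OF sub_one[OF n(2)]] c by (auto simp: E_def)
    show "act (h \<otimes> h') e = act h (act h' e)" if h: "h \<in> K" "h' \<in> K" "e \<in> E" for h h' e
    proof -
      obtain x where x: "x \<in> A" "e = N #> x" using h(3) by (auto simp: E_def)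
      show ?thesis
        using x act[OF sub_m[OF n(2) h(1,2)] x(1)] act[OF h(2) x(1)] act[OF h(1) a(4)[OF h(2) x(1)]] h c
        by (simp add: m_assoc inv_mult_group)
    qed
    show "act g e = e" if h: "g \<in> N" "e \<in> E" for g e
    proof -
      obtain x where x: "x \<in> A" "e = N #> x" using h(2) by (auto simp: E_def)
      have xK: "x \<in> K" using x a(3) by blast
      have "g \<otimes> (x \<otimes> inv g \<otimes> inv x) \<in> N"
        using sub_m[OF n(1) h(1) n(4)[OF xK sub_i[OF n(1) h(1)]]] .
      then have "g \<otimes> x \<otimes> inv g \<otimes> inv x \<in> N" using h x c by (simp add: m_assoc)
      then show ?thesis
        using x act[of g x] h n(3) c coset_eq_iff[OF n(1), of "g \<otimes> x \<otimes> inv g" x] by auto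
    qed
  qed
  then obtain z where z: "z \<in> A" "N #> z \<noteq> N" "\<And>k. k \<in> K \<Longrightarrow> act k (N #> z) = N #> z"
    by (auto simp: E_def)
  have "z \<notin> N" using z(1,2) c coset_eq_iff[OF n(1), of z \<one>] coset_mult_one[OF NC] by auto
  moreover have "k \<otimes> z \<otimes> inv k \<otimes> inv z \<in> N" if "k \<in> K" for k
    using z(3)[OF that] act[OF that z(1)] coset_eq_iff[OF n(1), of "k \<otimes> z \<otimes> inv k" z] that z(1) c by simp
  ultimately show ?thesis using z(1) by blast
qed

end

section \<open>Homomorphisms to the prime field\<close>

text \<open>Values are the integer residues 0, ..., p - 1, and a homomorphism is 0 outside K; so
  homomorphisms that agree on K are equal as functions and their number is meaningful.\<close>

definition homs :: "nat \<Rightarrow> ('a, 'm) monoid_scheme \<Rightarrow> 'a set \<Rightarrow> ('a \<Rightarrow> int) set" where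
  "homs p G K = {\<psi>. (\<forall>g. g \<notin> K \<longrightarrow> \<psi> g = 0) \<and> (\<forall>g\<in>K. \<psi> g \<in> {0..<int p}) \<and>
     (\<forall>g\<in>K. \<forall>h\<in>K. \<psi> (g \<otimes>\<^bsub>G\<^esub> h) = (\<psi> g + \<psi> h) mod int p)}"

lemma card_fibre_bound:
  assumes "finite B" "f ` A \<subseteq> B" "\<And>b. b \<in> B \<Longrightarrow> finite {a \<in> A. f a = b} \<and> card {a \<in> A. f a = b} \<le> n"
  shows "finite A" "card A \<le> n * card B"
proof -
  have A: "A = (\<Union>b\<in>B. {a \<in> A. f a = b})" using assms(2) by blast
  show fin: "finite A" by (subst A) (use assms in blast)
  have "card A \<le> (\<Sum>b\<in>B. card {a \<in> A. f a = b})"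
    by (subst A) (rule card_UN_le[OF assms(1)])
  also have "\<dots> \<le> (\<Sum>b\<in>B. n)" by (rule sum_mono) (use assms(3) in blast)
  finally show "card A \<le> n * card B" by (simp add: mult.commute)
qed

context group_prime
begin

lemma homsD:
  assumes "\<psi> \<in> homs p G K"
  shows "g \<notin> K \<Longrightarrow> \<psi> g = 0" "0 \<le> \<psi> g" "\<psi> g < int p" "\<psi> g mod int p = \<psi> g"
    "g \<in> K \<Longrightarrow> h \<in> K \<Longrightarrow> \<psi> (g \<otimes> h) = (\<psi> g + \<psi> h) mod int p"
  using assms p_gt_1 unfolding homs_def by (cases "g \<in> K"; force)+

lemma homs_cong_eq:
  assumes "\<psi> \<in> homs p G K" "\<phi> \<in> homs p G K" "\<And>g. g \<in> K \<Longrightarrow> \<psi> g = \<phi> g"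
  shows "\<psi> = \<phi>"
  using homsD(1)[OF assms(1)] homsD(1)[OF assms(2)] assms(3) by (metis ext)

lemma homs_one:
  assumes "\<psi> \<in> homs p G K" "subgroup K G"
  shows "\<psi> \<one> = 0"
proof -
  have "\<psi> \<one> = (\<psi> \<one> + \<psi> \<one>) mod int p"
    using homsD(5)[OF assms(1), of \<one> \<one>] sub_one[OF assms(2)] by simp
  then have "(\<psi> \<one> + \<psi> \<one> - \<psi> \<one>) mod int p = 0"
    using homsD(4)[OF assms(1), of \<one>] by (metis cancel_comm_monoid_add_class.diff_cancel mod_0 mod_diff_left_eq)
  then show ?thesis using homsD(4)[OF assms(1), of \<one>] by simp
qed

lemma homs_inv:
  assumes "\<psi> \<in> homs p G K" "subgroup K G" "g \<in> K"
  shows "\<psi> (inv g) = (- \<psi> g) mod int p"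
proof -
  have "(\<psi> g + \<psi> (inv g)) mod int p = 0"
    using homsD(5)[OF assms(1,3) sub_i[OF assms(2,3)]] homs_one[OF assms(1,2)] sub_in[OF assms(2,3)] by simp
  then have "(\<psi> g + \<psi> (inv g) - \<psi> g) mod int p = (0 - \<psi> g) mod int p" by (metis mod_diff_left_eq mod_0)
  then show ?thesis using homsD(4)[OF assms(1), of "inv g"] by simp
qed

lemma homs_pow:
  assumes "\<psi> \<in> homs p G K" "subgroup K G" "g \<in> K"
  shows "\<psi> (g [^] (n::nat)) = (int n * \<psi> g) mod int p"
proof (induction n)
  case 0 then show ?case using homs_one[OF assms(1,2)] by simp
next
  case (Suc n)
  have "\<psi> (g [^] Suc n) = (\<psi> (g [^] n) + \<psi> g) mod int p"
    using homsD(5)[OF assms(1) sub_pow[OF assms(2,3), of n] assms(3)] by simp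
  then show ?case using Suc by (simp add: mod_simps algebra_simps)
qed

lemma homs_ipow:
  assumes "\<psi> \<in> homs p G K" "subgroup K G" "g \<in> K"
  shows "\<psi> (g [^] (i::int)) = (i * \<psi> g) mod int p"
proof (cases i rule: int_cases2)
  case (nonneg n) then show ?thesis using homs_pow[OF assms] by (simp add: int_pow_int)
next
  case (nonpos n)
  have "\<psi> (inv (g [^] n)) = (- (int n * \<psi> g)) mod int p"
    using homs_inv[OF assms(1,2) sub_pow[OF assms(2,3), of n]] homs_pow[OF assms, of n] by (simp add: mod_simps)
  then show ?thesis using nonpos sub_in[OF assms(2,3)] by (simp add: int_pow_neg_int)
qed

lemma homs_conj:
  assumes "\<psi> \<in> homs p G K" "subgroup K G" "g \<in> K" "h \<in> K"
  shows "\<psi> (g \<otimes> h \<otimes> inv g) = \<psi> h"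
proof -
  note i = sub_i[OF assms(2,3)] and m = sub_m[OF assms(2,3,4)]
  have "\<psi> (g \<otimes> h \<otimes> inv g) = (\<psi> g + \<psi> h + - \<psi> g) mod int p"
    using homsD(5)[OF assms(1) m i] homsD(5)[OF assms(1,3,4)] homs_inv[OF assms(1-3)]
    by (simp add: mod_simps)
  then show ?thesis using homsD(4)[OF assms(1), of h] by simp
qed

lemma homs_diff:
  assumes "\<psi> \<in> homs p G K" "\<phi> \<in> homs p G K"
  shows "(\<lambda>g. (\<psi> g - \<phi> g) mod int p) \<in> homs p G K"
  unfolding homs_def
proof (intro CollectI conjI allI impI ballI)
  fix g h assume "g \<in> K" "h \<in> K"
  then show "(\<psi> (g \<otimes> h) - \<phi> (g \<otimes> h)) mod int p = ((\<psi> g - \<phi> g) mod int p + (\<psi> h - \<phi> h) mod int p) mod int p"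
    using homsD(5)[OF assms(1), of g h] homsD(5)[OF assms(2), of g h]
    by (simp add: mod_simps) (simp add: algebra_simps)
qed (use homsD(1)[OF assms(1)] homsD(1)[OF assms(2)] p_gt_1 in auto)

lemma mult_mod_surj:
  assumes "a mod int p \<noteq> 0"
  shows "\<exists>i. (i * a) mod int p = b mod int p"
proof -
  have "coprime a (int p)"
    using prime_p assms by (metis coprime_commute dvd_imp_mod_0 prime_imp_coprime prime_nat_int_transfer)
  then obtain u v where uv: "u * a + v * int p = 1"
    using bezout_int[of a "int p"] by (auto simp: coprime_iff_gcd_eq_1)
  have "b = (b * u) * a + (b * v) * int p" using uv by (metis distrib_left mult.assoc mult.right_neutral)
  then have "b mod int p = ((b * u) * a) mod int p" by (metis mod_mult_self1)
  then show ?thesis by metis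
qed

lemma homs_nonzero:
  assumes "\<psi> \<in> homs p G K" "g \<in> K" "\<psi> g \<noteq> 0"
  shows "\<psi> g mod int p \<noteq> 0"
  using homsD(4)[OF assms(1), of g] assms(3) by simp

lemma hom_kernel:
  assumes "\<psi> \<in> homs p G K" "subgroup K G" "x \<in> K" "\<psi> x \<noteq> 0"
  shows "nsub G {g \<in> K. \<psi> g = 0} K" "idx G K {g \<in> K. \<psi> g = 0} = p"
proof -
  let ?H = "{g \<in> K. \<psi> g = 0}"
  have s: "subgroup ?H G"
  proof (rule subgroupI)
    show "?H \<subseteq> carrier G" using sub_in[OF assms(2)] by blast
    show "?H \<noteq> {}" using homs_one[OF assms(1,2)] sub_one[OF assms(2)] by blast
    show "inv a \<in> ?H" if "a \<in> ?H" for a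
      using that homs_inv[OF assms(1,2), of a] sub_i[OF assms(2)] by simp
    show "a \<otimes> b \<in> ?H" if "a \<in> ?H" "b \<in> ?H" for a b
      using that homsD(5)[OF assms(1), of a b] sub_m[OF assms(2)] by simp
  qed
  show "nsub G ?H K"
    unfolding nsub_def
    using s assms(2) homs_conj[OF assms(1,2)] sub_m[OF assms(2)] sub_i[OF assms(2)] by auto
  have "idx G K ?H = card (\<psi> ` K)"
  proof (rule idx_eqI(1)[OF s subgroup.subset[OF assms(2)]])
    fix a b assume ab: "a \<in> K" "b \<in> K"
    have "\<psi> (a \<otimes> inv b) = (\<psi> a - \<psi> b) mod int p"
      using homsD(5)[OF assms(1) ab(1) sub_i[OF assms(2) ab(2)]] homs_inv[OF assms(1,2) ab(2)]
      by (simp add: mod_simps)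
    moreover have "(\<psi> a - \<psi> b) mod int p = 0 \<longleftrightarrow> \<psi> a = \<psi> b"
      using homsD(4)[OF assms(1), of a] homsD(4)[OF assms(1), of b]
      by (metis dvd_imp_mod_0 mod_0_imp_dvd mod_eq_dvd_iff)
    moreover have "a \<otimes> inv b \<in> K" using ab sub_m[OF assms(2)] sub_i[OF assms(2)] by blast
    ultimately show "(\<psi> a = \<psi> b) = (a \<otimes> inv b \<in> ?H)" by simp
  qed
  also have "\<psi> ` K = {0..<int p}"
  proof (intro equalityI subsetI)
    fix b assume b: "b \<in> {0..<int p}"
    obtain i where "(i * \<psi> x) mod int p = b mod int p"
      using mult_mod_surj[OF homs_nonzero[OF assms(1,3,4)]] by blast
    then have "b = \<psi> (x [^] i)" using b homs_ipow[OF assms(1-3), of i] by simp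
    then show "b \<in> \<psi> ` K" using sub_ipow[OF assms(2,3)] by blast
  qed (use homsD[OF assms(1)] in auto)
  finally show "idx G K ?H = p" by simp
qed

text \<open>H already has index p in the group obtained by adjoining x, so the tower formula leaves
  no room between that group and K.\<close>

lemma nsub_prime_cosets:
  assumes "nsub G H K" "idx G K H = p" "x \<in> K" "x \<notin> H" "k \<in> K"
  shows "\<exists>i::int. k \<otimes> x [^] (- i) \<in> H"
proof -
  note n = nsubD[OF assms(1)]
  have xc: "x \<in> carrier G" using sub_in[OF n(2) assms(3)] .
  have xp: "x [^] p \<in> H" using nsub_pow_idx[OF assms(1,3)] assms(2) by simp
  let ?H' = "{h \<otimes> x [^] (i::int) |h i. h \<in> H}"
  have 1: "x \<otimes> h \<otimes> inv x \<in> H" if "h \<in> H" for h using n(4)[OF assms(3) that] .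
  have 2: "inv x \<otimes> h \<otimes> x \<in> H" if "h \<in> H" for h
    using n(4)[OF sub_i[OF n(2) assms(3)] that] xc by simp
  note A = adjoin[OF n(1) xc assms(4) xp 1 2]
  have sub: "?H' \<subseteq> K" using sub_m[OF n(2)] n(3) sub_ipow[OF n(2) assms(3)] by blast
  have "p = idx G K ?H' * p"
    using idx_tower[OF n(1) nsubD(2)[OF A(1)] n(2) nsubD(3)[OF A(1)] sub] assms(2) A(2) by simp
  then have "idx G K ?H' = 1" using p_gt_1 by simp
  then have "?H' = K" using idx_1_eq[OF nsubD(2)[OF A(1)] n(2) sub] by simp
  then obtain h i where "h \<in> H" "k = h \<otimes> x [^] (i::int)" using assms(5) by blast
  then show ?thesis
    using xc sub_in[OF n(1)] by (intro exI[of _ i]) (simp add: int_pow_neg m_assoc)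
qed

text \<open>K/H is cyclic of order p and generated by x; \<chi> reads off the exponent of x modulo
  p. The normalisation \<chi> x = 1 makes \<chi> a coordinate along x in
  \<open>hom_extend\<close>.\<close>

lemma hom_of_nsub:
  assumes "nsub G H K" "idx G K H = p" "x \<in> K" "x \<notin> H"
  obtains \<chi> where "\<chi> \<in> homs p G K" "{g \<in> K. \<chi> g = 0} = H" "\<chi> x = 1"
proof -
  note n = nsubD[OF assms(1)]
  have xc: "x \<in> carrier G" using sub_in[OF n(2) assms(3)] .
  have xp: "x [^] p \<in> H" using nsub_pow_idx[OF assms(1,3)] assms(2) by simp
  note mem = int_pow_mem_iff[OF n(1) xc assms(4) xp]
  have xi: "x [^] (i::int) \<in> carrier G" for i using xc by simp
  have c: "\<And>k. k \<in> K \<Longrightarrow> k \<in> carrier G" using sub_in[OF n(2)] .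
  have uniq: "i mod int p = j mod int p"
    if "k \<in> K" "k \<otimes> x [^] (- i) \<in> H" "k \<otimes> x [^] (- j) \<in> H" for k i j
  proof -
    have "inv (k \<otimes> x [^] (- i)) \<otimes> (k \<otimes> x [^] (- j)) \<in> H"
      using sub_m[OF n(1) sub_i[OF n(1)]] that by blast
    moreover have "inv (k \<otimes> x [^] (- i)) \<otimes> (k \<otimes> x [^] (- j)) = x [^] (i - j)"
      using xi c[OF that(1)] xc by (simp add: inv_mult_group m_assoc int_pow_neg int_pow_diff)
    ultimately show ?thesis using mem by (simp add: mod_eq_dvd_iff)
  qed
  \<comment> \<open>The chosen exponent is only determined modulo p, by \<open>uniq\<close>;
    reducing it gives a well-defined \<chi>.\<close>
  define t where "t k = (SOME i::int. k \<otimes> x [^] (- i) \<in> H)" for k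
  have t: "k \<otimes> x [^] (- t k) \<in> H" if "k \<in> K" for k
    using someI_ex[OF nsub_prime_cosets[OF assms that]] unfolding t_def .
  define \<chi> where "\<chi> k = (if k \<in> K then t k mod int p else 0)" for k
  have chi: "\<chi> k = i mod int p" if "k \<in> K" "k \<otimes> x [^] (- i) \<in> H" for k i
    using uniq[OF that(1) t[OF that(1)] that(2)] that(1) by (simp add: \<chi>_def)
  have "\<chi> \<in> homs p G K"
    unfolding homs_def
  proof (intro CollectI conjI allI impI ballI)
    fix g h assume gh: "g \<in> K" "h \<in> K"
    let ?i = "t g" and ?j = "t h"
    have e: "x [^] (- (?i + ?j)) = inv (x [^] ?j) \<otimes> inv (x [^] ?i)"
      using int_pow_mult[OF xc, of "- ?j" "- ?i"] xc by (simp add: int_pow_neg add.commute)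
    have "x [^] ?i \<in> K" using sub_ipow[OF n(2) assms(3)] .
    then have "x [^] ?i \<otimes> (h \<otimes> x [^] (- ?j)) \<otimes> inv (x [^] ?i) \<in> H" using n(4) t[OF gh(2)] by blast
    then have "(g \<otimes> x [^] (- ?i)) \<otimes> (x [^] ?i \<otimes> (h \<otimes> x [^] (- ?j)) \<otimes> inv (x [^] ?i)) \<in> H"
      using sub_m[OF n(1) t[OF gh(1)]] by blast
    moreover have "(g \<otimes> x [^] (- ?i)) \<otimes> (x [^] ?i \<otimes> (h \<otimes> x [^] (- ?j)) \<otimes> inv (x [^] ?i))
        = (g \<otimes> h) \<otimes> x [^] (- (?i + ?j))"
      unfolding e using xi c[OF gh(1)] c[OF gh(2)] xc by (simp add: m_assoc int_pow_neg)
    ultimately have "\<chi> (g \<otimes> h) = (?i + ?j) mod int p"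
      using chi[OF sub_m[OF n(2) gh]] by simp
    then show "\<chi> (g \<otimes> h) = (\<chi> g + \<chi> h) mod int p" using gh by (simp add: \<chi>_def mod_simps)
  qed (use p_gt_1 in \<open>auto simp: \<chi>_def\<close>)
  moreover have "{g \<in> K. \<chi> g = 0} = H"
  proof (intro equalityI subsetI)
    fix g assume "g \<in> {g \<in> K. \<chi> g = 0}"
    then have g: "g \<in> K" "int p dvd t g" by (auto simp: \<chi>_def dvd_eq_mod_eq_0)
    have "g \<otimes> x [^] (- t g) \<otimes> x [^] (t g) \<in> H"
      using sub_m[OF n(1) t[OF g(1)]] mem g(2) by blast
    then show "g \<in> H" using xi c[OF g(1)] xc by (simp add: m_assoc int_pow_neg)
  next
    fix g assume g: "g \<in> H"
    then have "g \<in> K" using n(3) by blast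
    moreover have "\<chi> g = 0" using chi[of g 0] g \<open>g \<in> K\<close> c by simp
    ultimately show "g \<in> {g \<in> K. \<chi> g = 0}" by simp
  qed
  moreover have "\<chi> x = 1"
  proof -
    have "x \<otimes> x [^] (- 1 :: int) = \<one>" using xc by (simp add: int_pow_neg int_pow_1)
    then have "\<chi> x = 1 mod int p" using chi[OF assms(3), of 1] sub_one[OF n(1)] by simp
    then show ?thesis using p_gt_1 by simp
  qed
  ultimately show thesis by (rule that)
qed

section \<open>Normal subgroups of index p as kernels\<close>

definition index_p_normals :: "'a set \<Rightarrow> 'a set set" where
  "index_p_normals K = {H. nsub G H K \<and> idx G K H = p}"

lemma index_p_normals_proper:
  assumes "H \<in> index_p_normals K" obtains x where "x \<in> K" "x \<notin> H"
proof -
  have n: "nsub G H K" "idx G K H = p" using assms by (auto simp: index_p_normals_def)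
  have "H \<noteq> K" using idx_self[OF nsubD(1)[OF n(1)]] n(2) p_gt_1 by auto
  then show thesis using that nsubD(3)[OF n(1)] by blast
qed

lemma index_p_normals_upper:
  assumes "finite (homs p G K)"
  shows "finite (index_p_normals K)" "card (index_p_normals K) \<le> card (homs p G K)"
proof -
  have "index_p_normals K \<subseteq> (\<lambda>\<chi>. {g \<in> K. \<chi> g = 0}) ` homs p G K"
  proof
    fix H assume H: "H \<in> index_p_normals K"
    from index_p_normals_proper[OF H] obtain x where x: "x \<in> K" "x \<notin> H" .
    from H have n: "nsub G H K" "idx G K H = p" by (auto simp: index_p_normals_def)
    from hom_of_nsub[OF n x] obtain \<chi> where "\<chi> \<in> homs p G K" "{g \<in> K. \<chi> g = 0} = H" .
    then show "H \<in> (\<lambda>\<chi>. {g \<in> K. \<chi> g = 0}) ` homs p G K" by blast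
  qed
  from finite_subset[OF this finite_imageI[OF assms]] surj_card_le[OF assms this]
  show "finite (index_p_normals K)" "card (index_p_normals K) \<le> card (homs p G K)" .
qed

lemma homs_zero: "(\<lambda>_. 0) \<in> homs p G K"
  using p_gt_1 by (simp add: homs_def)

text \<open>Each of the p^(d+1) - 1 nonzero homomorphisms has a kernel of index p. With kernel H
  fixed and x outside H, a homomorphism is determined by its nonzero value at x, so at most p - 1 of
  them share a kernel.\<close>

lemma index_p_normals_lower:
  assumes "subgroup K G" "finite (homs p G K)" "card (homs p G K) = p ^ Suc d"
  shows "p ^ d \<le> card (index_p_normals K)"
proof -
  let ?A = "homs p G K - {\<lambda>_. 0}" and ?f = "\<lambda>\<chi>. {g \<in> K. \<chi> g = (0::int)}"
  have "card ?A \<le> (p - 1) * card (index_p_normals K)"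
  proof (rule card_fibre_bound(2)[of _ ?f])
    show "finite (index_p_normals K)" by (rule index_p_normals_upper[OF assms(2)])
    show "?f ` ?A \<subseteq> index_p_normals K"
    proof
      fix H assume "H \<in> ?f ` ?A"
      then obtain \<chi> where c: "\<chi> \<in> homs p G K" "\<chi> \<noteq> (\<lambda>_. 0)" "H = ?f \<chi>" by blast
      from c(2) obtain x where x: "\<chi> x \<noteq> 0" by auto
      then have "x \<in> K" using homsD(1)[OF c(1)] by blast
      then show "H \<in> index_p_normals K" using hom_kernel[OF c(1) assms(1) _ x] c(3) by (simp add: index_p_normals_def)
    qed
    fix H assume H: "H \<in> index_p_normals K"
    from index_p_normals_proper[OF H] obtain x where x: "x \<in> K" "x \<notin> H" .
    let ?F = "{\<chi> \<in> ?A. ?f \<chi> = H}"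
    have nz: "\<chi> x \<noteq> 0" if "\<chi> \<in> ?F" for \<chi> using that x by blast
    have "inj_on (\<lambda>\<chi>. \<chi> x) ?F"
    proof (rule inj_onI)
      fix \<psi> \<phi> assume a: "\<psi> \<in> ?F" "\<phi> \<in> ?F" "\<psi> x = \<phi> x"
      then have h: "\<psi> \<in> homs p G K" "\<phi> \<in> homs p G K" by auto
      show "\<psi> = \<phi>"
      proof (rule homs_cong_eq[OF h])
        fix g assume g: "g \<in> K"
        obtain i where i: "(i * \<psi> x) mod int p = \<psi> g mod int p"
          using mult_mod_surj[OF homs_nonzero[OF h(1) x(1) nz[OF a(1)]]] by blast
        have e: "\<xi> (g \<otimes> x [^] (- i)) = (\<xi> g - i * \<xi> x) mod int p" if "\<xi> \<in> homs p G K" for \<xi>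
          using homsD(5)[OF that g sub_ipow[OF assms(1) x(1), of "-i"]] homs_ipow[OF that assms(1) x(1), of "-i"]
          by (simp add: mod_simps)
        have m: "g \<otimes> x [^] (- i) \<in> K" using sub_m[OF assms(1) g sub_ipow[OF assms(1) x(1)]] .
        have "\<psi> (g \<otimes> x [^] (- i)) = 0"
          unfolding e[OF h(1)] using i by (metis mod_eq_dvd_iff mod_0_imp_dvd dvd_imp_mod_0)
        then have "g \<otimes> x [^] (- i) \<in> H" using a(1) m by blast
        then have "\<phi> (g \<otimes> x [^] (- i)) = 0" using a(2) by blast
        then have "\<phi> g mod int p = (i * \<phi> x) mod int p"
          unfolding e[OF h(2)] by (metis mod_eq_dvd_iff mod_0_imp_dvd)
        then show "\<psi> g = \<phi> g" using i a(3) homsD(4)[OF h(1), of g] homsD(4)[OF h(2), of g] by simp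
      qed
    qed
    moreover have "(\<lambda>\<chi>. \<chi> x) ` ?F \<subseteq> {1..<int p}"
    proof
      fix y assume "y \<in> (\<lambda>\<chi>. \<chi> x) ` ?F"
      then obtain \<chi> where "\<chi> \<in> ?F" "y = \<chi> x" by blast
      then show "y \<in> {1..<int p}" using nz[of \<chi>] homsD(2,3)[of \<chi> K x] by force
    qed
    ultimately have "card ?F \<le> card {1..<int p}" by (rule card_inj_on_le) simp
    then show "finite ?F \<and> card ?F \<le> p - 1" using assms(2) p_gt_1 by simp
  qed
  moreover have "card ?A = p ^ Suc d - 1"
    using assms(2,3) homs_zero by (simp add: card_Diff_singleton)
  ultimately have "p ^ Suc d - 1 \<le> (p - 1) * card (index_p_normals K)" by simp
  moreover have "(p - 1) * p ^ d \<le> p ^ Suc d - 1"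
    using p_gt_1 diff_le_mono2[of 1 "p ^ d" "p * p ^ d"] by (simp add: diff_mult_distrib)
  ultimately show ?thesis using p_gt_1 by (meson le_trans mult_le_cancel1 zero_less_diff)
qed

text \<open>A normal subgroup of index p forces positive rank; \<open>rk_step\<close> needs this to
  write the rank of K as a successor.\<close>

lemma homs_nonempty_of_max:
  assumes "H \<in> index_p_normals K" "finite (homs p G K)"
  shows "card (homs p G K) \<ge> 2"
proof -
  from index_p_normals_proper[OF assms(1)] obtain x where x: "x \<in> K" "x \<notin> H" .
  from assms have n: "nsub G H K" "idx G K H = p" by (auto simp: index_p_normals_def)
  from hom_of_nsub[OF n x] obtain \<chi> where c: "\<chi> \<in> homs p G K" "\<chi> x = 1" .
  then have "card {\<chi>, \<lambda>_. 0} \<le> card (homs p G K)"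
    using assms(2) homs_zero by (intro card_mono) auto
  moreover have "\<chi> \<noteq> (\<lambda>_. 0)" using c(2) by auto
  ultimately show ?thesis by simp
qed

section \<open>The operator x - 1 on Hom(H, F_p)\<close>

definition hom_diff :: "('a \<Rightarrow> int) \<Rightarrow> ('a \<Rightarrow> int) \<Rightarrow> 'a \<Rightarrow> int" where
  "hom_diff \<psi> \<phi> = (\<lambda>g. (\<psi> g - \<phi> g) mod int p)"

definition twist :: "'a \<Rightarrow> 'a set \<Rightarrow> ('a \<Rightarrow> int) \<Rightarrow> 'a \<Rightarrow> int" where
  "twist x H \<psi> = (\<lambda>h. if h \<in> H then (\<psi> (x \<otimes> h \<otimes> inv x) - \<psi> h) mod int p else 0)"

lemma hom_diff_homs: "\<psi> \<in> homs p G K \<Longrightarrow> \<phi> \<in> homs p G K \<Longrightarrow> hom_diff \<psi> \<phi> \<in> homs p G K"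
  unfolding hom_diff_def by (rule homs_diff)

lemma hom_diff_inj: "inj_on (\<lambda>\<psi>. hom_diff \<psi> \<phi>) (homs p G K)"
proof (rule inj_onI)
  fix \<psi> \<psi>' assume a: "\<psi> \<in> homs p G K" "\<psi>' \<in> homs p G K" "hom_diff \<psi> \<phi> = hom_diff \<psi>' \<phi>"
  show "\<psi> = \<psi>'"
  proof
    fix g
    have "(\<psi> g - \<phi> g) mod int p = (\<psi>' g - \<phi> g) mod int p" using a(3) by (metis hom_diff_def)
    then have "(\<psi> g - \<phi> g + \<phi> g) mod int p = (\<psi>' g - \<phi> g + \<phi> g) mod int p" by (metis mod_add_left_eq)
    then show "\<psi> g = \<psi>' g" using homsD(4)[OF a(1)] homsD(4)[OF a(2)] by simp
  qed
qed

lemma hom_diff_self: "hom_diff \<psi> \<psi> = (\<lambda>_. 0)" by (simp add: hom_diff_def)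

lemma twist_hom_diff: "twist x H (hom_diff \<psi> \<phi>) = hom_diff (twist x H \<psi>) (twist x H \<phi>)"
proof
  fix h
  show "twist x H (hom_diff \<psi> \<phi>) h = hom_diff (twist x H \<psi>) (twist x H \<phi>) h"
    by (simp add: twist_def hom_diff_def mod_simps) (simp add: algebra_simps)
qed

lemma twist_pow_hom_diff: "(twist x H ^^ n) (hom_diff \<psi> \<phi>) = hom_diff ((twist x H ^^ n) \<psi>) ((twist x H ^^ n) \<phi>)"
  by (induction n) (simp_all add: twist_hom_diff)

lemma twist_homs:
  assumes "nsub G H K" "x \<in> K" "\<psi> \<in> homs p G H"
  shows "twist x H \<psi> \<in> homs p G H"
  unfolding homs_def
proof (intro CollectI conjI allI impI ballI)
  note n = nsubD[OF assms(1)]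
  fix g h assume gh: "g \<in> H" "h \<in> H"
  have c: "x \<in> carrier G" "g \<in> carrier G" "h \<in> carrier G"
    using gh sub_in[OF n(1)] sub_in[OF n(2) assms(2)] by auto
  have "x \<otimes> (g \<otimes> h) \<otimes> inv x = (x \<otimes> g \<otimes> inv x) \<otimes> (x \<otimes> h \<otimes> inv x)" using c by (simp add: m_assoc)
  then have "\<psi> (x \<otimes> (g \<otimes> h) \<otimes> inv x) = (\<psi> (x \<otimes> g \<otimes> inv x) + \<psi> (x \<otimes> h \<otimes> inv x)) mod int p"
    using homsD(5)[OF assms(3) n(4)[OF assms(2) gh(1)] n(4)[OF assms(2) gh(2)]] by simp
  then show "twist x H \<psi> (g \<otimes> h) = (twist x H \<psi> g + twist x H \<psi> h) mod int p"
    using gh sub_m[OF n(1) gh] homsD(5)[OF assms(3) gh]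
    by (simp add: twist_def mod_simps) (simp add: algebra_simps)
qed (use p_gt_1 in \<open>auto simp: twist_def\<close>)

lemma twist_pow_homs:
  assumes "nsub G H K" "x \<in> K" "\<psi> \<in> homs p G H"
  shows "(twist x H ^^ n) \<psi> \<in> homs p G H"
  by (induction n) (simp_all add: assms(3) twist_homs[OF assms(1,2)])

text \<open>Pascal's rule. It is the induction step for expanding (x - 1)^n binomially without
  forming a ring of operators.\<close>

lemma alternating_binomial_Suc:
  fixes a :: "nat \<Rightarrow> int"
  shows "(\<Sum>i\<le>Suc n. int (Suc n choose i) * (-1) ^ (Suc n - i) * a i) =
    (\<Sum>i\<le>n. int (n choose i) * (-1) ^ (n - i) * a (Suc i)) - (\<Sum>i\<le>n. int (n choose i) * (-1) ^ (n - i) * a i)"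
proof -
  have "(\<Sum>i\<le>n. int (n choose i) * (-1) ^ (n - i) * a i) = (\<Sum>i\<le>Suc n. int (n choose i) * (-1) ^ (n - i) * a i)"
    by simp
  also have "\<dots> = (-1) ^ n * a 0 + (\<Sum>i\<le>n. int (n choose Suc i) * (-1) ^ (n - Suc i) * a (Suc i))"
    by (simp only: sum.atMost_Suc_shift) simp
  also have "(\<Sum>i\<le>n. int (n choose Suc i) * (-1) ^ (n - Suc i) * a (Suc i)) =
      (\<Sum>i\<le>n. - (int (n choose Suc i) * (-1) ^ (n - i) * a (Suc i)))"
  proof (rule sum.cong)
    fix i assume "i \<in> {..n}"
    show "int (n choose Suc i) * (-1) ^ (n - Suc i) * a (Suc i) = - (int (n choose Suc i) * (-1) ^ (n - i) * a (Suc i))"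
    proof (cases "i < n")
      case True
      then have "n - i = Suc (n - Suc i)" by simp
      then show ?thesis by simp
    qed (simp add: binomial_eq_0)
  qed simp
  finally have e: "(\<Sum>i\<le>n. int (n choose i) * (-1) ^ (n - i) * a i) =
      (-1) ^ n * a 0 - (\<Sum>i\<le>n. int (n choose Suc i) * (-1) ^ (n - i) * a (Suc i))"
    by (simp add: sum_negf)
  have "(\<Sum>i\<le>Suc n. int (Suc n choose i) * (-1) ^ (Suc n - i) * a i) =
      (-1) ^ Suc n * a 0 + (\<Sum>i\<le>n. int (Suc n choose Suc i) * (-1) ^ (n - i) * a (Suc i))"
    by (simp only: sum.atMost_Suc_shift) simp
  also have "(\<Sum>i\<le>n. int (Suc n choose Suc i) * (-1) ^ (n - i) * a (Suc i)) =
      (\<Sum>i\<le>n. int (n choose i) * (-1) ^ (n - i) * a (Suc i)) + (\<Sum>i\<le>n. int (n choose Suc i) * (-1) ^ (n - i) * a (Suc i))"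
    by (simp add: distrib_right flip: sum.distrib)
  finally show ?thesis unfolding e by simp
qed

lemma twist_pow_formula:
  assumes "nsub G H K" "x \<in> K" "\<psi> \<in> homs p G H" "h \<in> H"
  shows "(twist x H ^^ n) \<psi> h =
    (\<Sum>i\<le>n. int (n choose i) * (-1) ^ (n - i) * \<psi> (x [^] i \<otimes> h \<otimes> inv (x [^] i))) mod int p"
  using assms(4)
proof (induction n arbitrary: h)
  case 0
  then show ?case using homsD(4)[OF assms(3)] sub_in[OF nsubD(1)[OF assms(1)]] by simp
next
  case (Suc n)
  note n = nsubD[OF assms(1)]
  have c: "x \<in> carrier G" "h \<in> carrier G"
    using Suc.prems sub_in[OF n(1)] sub_in[OF n(2) assms(2)] by auto
  have e: "x [^] i \<otimes> (x \<otimes> h \<otimes> inv x) \<otimes> inv (x [^] i) = x [^] Suc i \<otimes> h \<otimes> inv (x [^] Suc i)" for i :: nat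
    using c by (simp add: m_assoc inv_mult_group)
  have "(twist x H ^^ Suc n) \<psi> h = ((twist x H ^^ n) \<psi> (x \<otimes> h \<otimes> inv x) - (twist x H ^^ n) \<psi> h) mod int p"
    using Suc.prems by (simp add: twist_def)
  also have "\<dots> = ((\<Sum>i\<le>n. int (n choose i) * (-1) ^ (n - i) * \<psi> (x [^] Suc i \<otimes> h \<otimes> inv (x [^] Suc i)))
      - (\<Sum>i\<le>n. int (n choose i) * (-1) ^ (n - i) * \<psi> (x [^] i \<otimes> h \<otimes> inv (x [^] i)))) mod int p"
    unfolding Suc.IH[OF Suc.prems] Suc.IH[OF n(4)[OF assms(2) Suc.prems]] e by (simp only: mod_simps)
  finally show ?case
    unfolding alternating_binomial_Suc[of n "\<lambda>i. \<psi> (x [^] i \<otimes> h \<otimes> inv (x [^] i))"] .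
qed

text \<open>The inner binomial coefficients vanish modulo p, which leaves x^p - 1 up to the sign of
  1; and x^p, being in H, acts trivially on Hom(H, F_p).\<close>

lemma twist_pow_p:
  assumes "nsub G H K" "x \<in> K" "x [^] p \<in> H" "\<psi> \<in> homs p G H"
  shows "(twist x H ^^ p) \<psi> = (\<lambda>_. 0)"
proof
  fix h
  note n = nsubD[OF assms(1)]
  show "(twist x H ^^ p) \<psi> h = 0"
  proof (cases "h \<in> H")
    case False then show ?thesis using homsD(1)[OF twist_pow_homs[OF assms(1,2,4)]] by blast
  next
    case True
    let ?t = "\<lambda>i. int (p choose i) * (-1) ^ (p - i) * \<psi> (x [^] i \<otimes> h \<otimes> inv (x [^] i))"
    have c: "x \<in> carrier G" "h \<in> carrier G"
      using True sub_in[OF n(1)] sub_in[OF n(2) assms(2)] by auto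
    have set: "{..p} = insert 0 (insert p {1..<p})" using p_gt_1 by auto
    have s1: "(\<Sum>i\<le>p. ?t i) = ?t 0 + ?t p + (\<Sum>i\<in>{1..<p}. ?t i)"
      unfolding set using p_gt_1 by (simp add: sum.insert)
    have s2: "int p dvd (\<Sum>i\<in>{1..<p}. ?t i)"
    proof (rule dvd_sum)
      fix i assume "i \<in> {1..<p}"
      then have "p dvd (p choose i)" using prime_p p_gt_1 by (intro dvd_choose_prime) auto
      then have "int p dvd int (p choose i)" by (simp only: int_dvd_int_iff)
      then show "int p dvd ?t i" by (metis dvd_mult2)
    qed
    have s3: "?t 0 = (-1) ^ p * \<psi> h" using c by simp
    have s4: "?t p = \<psi> h" using homs_conj[OF assms(4) n(1) assms(3) True] by simp
    \<comment> \<open>The two end terms cancel for odd p; for p = 2 they add up to 2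
      \<psi>(h).\<close>
    have s5: "int p dvd (-1) ^ p * \<psi> h + \<psi> h"
    proof (cases "p = 2")
      case True then show ?thesis by simp
    next
      case False
      then have "odd p" using prime_odd_nat[OF prime_p] p_gt_1 by simp
      then show ?thesis by simp
    qed
    have "int p dvd (\<Sum>i\<le>p. ?t i)" unfolding s1 s3 s4 by (rule dvd_add[OF s5 s2])
    then show ?thesis using twist_pow_formula[OF assms(1,2,4) True, of p] by simp
  qed
qed

lemma homs_fixed_conj:
  assumes "nsub G H K" "x \<in> K" "\<psi> \<in> homs p G H" "twist x H \<psi> = (\<lambda>_. 0)" "h \<in> H"
  shows "\<psi> (x [^] (n::nat) \<otimes> h \<otimes> inv (x [^] n)) = \<psi> h"
  using assms(5)
proof (induction n arbitrary: h)
  case 0 then show ?case using sub_in[OF nsubD(1)[OF assms(1)]] by simp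
next
  case (Suc n)
  note n = nsubD[OF assms(1)]
  have c: "x \<in> carrier G" "h \<in> carrier G"
    using Suc.prems sub_in[OF n(1)] sub_in[OF n(2) assms(2)] by auto
  have e: "x [^] n \<otimes> (x \<otimes> h \<otimes> inv x) \<otimes> inv (x [^] n) = x [^] Suc n \<otimes> h \<otimes> inv (x [^] Suc n)"
    using c by (simp add: m_assoc inv_mult_group)
  have "(\<psi> (x \<otimes> h \<otimes> inv x) - \<psi> h) mod int p = 0"
    using fun_cong[OF assms(4), of h] Suc.prems by (simp add: twist_def)
  then have "\<psi> (x \<otimes> h \<otimes> inv x) mod int p = \<psi> h mod int p"
    by (metis mod_eq_dvd_iff mod_0_imp_dvd)
  then have "\<psi> (x \<otimes> h \<otimes> inv x) = \<psi> h" using homsD(4)[OF assms(3)] by simp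
  then show ?case using Suc.IH[OF n(4)[OF assms(2) Suc.prems]] e by simp
qed

text \<open>Write k = h x^\<chi>(k) with h in H and add the contributions. Invariance of \<psi>
  under x lets powers of x be moved past h, and \<psi>(x^p) = 0 makes the reduction of exponents
  modulo p harmless. The parameter c is the contribution of x.\<close>

lemma hom_extend:
  assumes "nsub G H K" "x \<in> K" "\<psi> \<in> homs p G H" "twist x H \<psi> = (\<lambda>_. 0)" "\<psi> (x [^] p) = 0" "x [^] p \<in> H"
    and chi: "\<chi> \<in> homs p G K" "{g \<in> K. \<chi> g = 0} = H" "\<chi> x = 1"
  shows "(\<lambda>k. if k \<in> K then (\<psi> (k \<otimes> x [^] (- \<chi> k)) + c * \<chi> k) mod int p else 0) \<in> homs p G K"
  unfolding homs_def
proof (intro CollectI conjI allI impI ballI)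
  note n = nsubD[OF assms(1)]
  have xc: "x \<in> carrier G" using sub_in[OF n(2) assms(2)] .
  have xi: "x [^] (i::int) \<in> carrier G" for i using xc by simp
  have H: "k \<otimes> x [^] (- \<chi> k) \<in> H" if "k \<in> K" for k
  proof -
    have "\<chi> (k \<otimes> x [^] (- \<chi> k)) = 0"
      using homsD(5)[OF chi(1) that sub_ipow[OF n(2) assms(2), of "- \<chi> k"]]
        homs_ipow[OF chi(1) n(2) assms(2), of "- \<chi> k"] chi(3) by (simp add: mod_simps)
    then show ?thesis using chi(2) sub_m[OF n(2) that sub_ipow[OF n(2) assms(2)]] by blast
  qed
  fix g h assume gh: "g \<in> K" "h \<in> K"
  have gc: "g \<in> carrier G" "h \<in> carrier G" using gh sub_in[OF n(2)] by auto
  let ?i = "\<chi> g" and ?j = "\<chi> h"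
  let ?g = "g \<otimes> x [^] (- ?i)" and ?h = "h \<otimes> x [^] (- ?j)"
  define s where "s = (?i + ?j) mod int p"
  have s: "\<chi> (g \<otimes> h) = s" using homsD(5)[OF chi(1) gh] by (simp add: s_def)
  \<comment> \<open>The carry in the addition of two exponents modulo p; it contributes (x^p)^q, on
    which \<psi> vanishes.\<close>
  define q where "q = (?i + ?j) div int p"
  have ij: "?i + ?j = s + int p * q" by (simp add: s_def q_def)
  have xpq: "(x [^] p) [^] q \<in> H" "\<psi> ((x [^] p) [^] q) = 0"
    using sub_ipow[OF n(1) assms(6)] homs_ipow[OF assms(3) n(1) assms(6)] assms(5) by simp_all
  have xpq': "(x [^] p) [^] q = x [^] (int p * q)"
    using int_pow_pow[OF xc, of "int p" q] by (simp add: int_pow_int)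
  have "x [^] nat ?i = x [^] ?i" using homsD(2)[OF chi(1), of g] by (simp flip: int_pow_int)
  then have conj_set: "\<psi> (x [^] ?i \<otimes> ?h \<otimes> inv (x [^] ?i)) = \<psi> ?h"
    using homs_fixed_conj[OF assms(1-4) H[OF gh(2)], of "nat ?i"] by simp
  have cjH: "x [^] ?i \<otimes> ?h \<otimes> inv (x [^] ?i) \<in> H"
    using n(4)[OF sub_ipow[OF n(2) assms(2)] H[OF gh(2)]] .
  have e: "x [^] (- s) = inv (x [^] ?j) \<otimes> inv (x [^] ?i) \<otimes> x [^] (int p * q)"
  proof -
    have "- s = - ?j + (- ?i + int p * q)" using ij by simp
    then have "x [^] (- s) = x [^] (- ?j) \<otimes> (x [^] (- ?i) \<otimes> x [^] (int p * q))"
      by (simp only: int_pow_mult[OF xc])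
    then show ?thesis using xc by (simp add: int_pow_neg m_assoc)
  qed
  have "(g \<otimes> h) \<otimes> x [^] (- s) = ?g \<otimes> ((x [^] ?i \<otimes> ?h \<otimes> inv (x [^] ?i)) \<otimes> (x [^] p) [^] q)"
    unfolding e xpq' using gc xc by (simp add: m_assoc int_pow_neg)
  then have "\<psi> ((g \<otimes> h) \<otimes> x [^] (- s)) = (\<psi> ?g + \<psi> ?h) mod int p"
    using homsD(5)[OF assms(3) H[OF gh(1)] sub_m[OF n(1) cjH xpq(1)]] homsD(5)[OF assms(3) cjH xpq(1)] conj_set xpq(2)
    by (simp add: mod_simps)
  moreover have "(c * s) mod int p = (c * ?i + c * ?j) mod int p"
    by (simp add: s_def mod_simps algebra_simps)
  ultimately have "(\<psi> (g \<otimes> h \<otimes> x [^] (- s)) + c * s) mod int p = ((\<psi> ?g + \<psi> ?h) + (c * ?i + c * ?j)) mod int p"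
    by (metis mod_add_eq mod_mod_trivial)
  then show "(if g \<otimes> h \<in> K then (\<psi> (g \<otimes> h \<otimes> x [^] (- \<chi> (g \<otimes> h))) + c * \<chi> (g \<otimes> h)) mod int p else 0) =
    ((if g \<in> K then (\<psi> ?g + c * ?i) mod int p else 0) + (if h \<in> K then (\<psi> ?h + c * ?j) mod int p else 0)) mod int p"
    unfolding s using gh sub_m[OF n(2) gh] by (simp add: mod_simps) (simp add: algebra_simps)
qed (use p_gt_1 in auto)

text \<open>An \<open>x \<in> K - H\<close> acts on \<open>Hom(H, \<F>\<^sub>p)\<close> by conjugation. The operator \<open>twist = x - 1\<close> satisfies
  \<open>twist\<^sup>p = x\<^sup>p - 1 = 0\<close>, so on the invariant subspace \<open>W = {\<psi>. \<psi> (x\<^sup>p) = 0}\<close>, of codimension at most 1,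
  the dimension is at most \<open>p\<close> times that of the kernel, which consists of restrictions of
  homomorphisms on \<open>K\<close>.\<close>

lemma card_homs_nsub:
  assumes "nsub G H K" "idx G K H = p" "finite (homs p G K)"
  shows "finite (homs p G H)" "card (homs p G H) \<le> p * (card (homs p G K) div p) ^ p"
proof -
  note n = nsubD[OF assms(1)]
  have "H \<in> index_p_normals K" using assms by (simp add: index_p_normals_def)
  from index_p_normals_proper[OF this] obtain x where x: "x \<in> K" "x \<notin> H" .
  from hom_of_nsub[OF assms(1,2) x] obtain \<chi>
    where chi: "\<chi> \<in> homs p G K" "{g \<in> K. \<chi> g = 0} = H" "\<chi> x = 1" .
  have xc: "x \<in> carrier G" using sub_in[OF n(2) x(1)] .
  have xp: "x [^] p \<in> H" using nsub_pow_idx[OF assms(1) x(1)] assms(2) by simp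
  have "x \<otimes> x [^] p = x [^] p \<otimes> x" using nat_pow_Suc2[OF xc, of p] by simp
  then have xxp: "x \<otimes> x [^] p \<otimes> inv x = x [^] p" using xc by (simp add: m_assoc)
  let ?t = "twist x H"
  define W where "W = {\<psi> \<in> homs p G H. \<psi> (x [^] p) = 0}"
  define Wn where "Wn k = {\<psi> \<in> W. (?t ^^ k) \<psi> = (\<lambda>_. 0)}" for k
  have tW: "?t \<psi> \<in> W" if "\<psi> \<in> W" for \<psi>
    using that twist_homs[OF assms(1) x(1)] by (auto simp: W_def twist_def xxp)
  have tWn: "(?t ^^ k) \<psi> \<in> W" if "\<psi> \<in> W" for \<psi> k
    by (induction k) (simp_all add: that tW)
  have dW: "hom_diff \<psi> \<phi> \<in> W" if "\<psi> \<in> homs p G H" "\<phi> \<in> homs p G H" "\<psi> (x [^] p) = \<phi> (x [^] p)" for \<psi> \<phi>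
    using that hom_diff_homs[of \<psi> H \<phi>] by (simp add: W_def hom_diff_def)
  \<comment> \<open>\<open>Wn 1\<close> is the kernel of the operator on W. Each of its elements has
    p extensions to K, told apart by their value at x.\<close>
  have W1: "card (Wn 1) * p \<le> card (homs p G K)" "finite (Wn 1)"
  proof -
    define ext where "ext = (\<lambda>(\<psi>, c). \<lambda>k. if k \<in> K then (\<psi> (k \<otimes> x [^] (- \<chi> k)) + c * \<chi> k) mod int p else 0)"
    have eH: "ext (\<psi>, c) h = \<psi> h" if "\<psi> \<in> homs p G H" "h \<in> H" for \<psi> c h
    proof -
      have "h \<in> K" "\<chi> h = 0" using chi(2) that(2) by auto
      then show ?thesis using homsD(4)[OF that(1)] sub_in[OF n(1) that(2)] by (simp add: ext_def)
    qed
    have "x \<otimes> x [^] (- 1 :: int) = \<one>" using xc by (simp add: int_pow_neg int_pow_1)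
    then have ex: "ext (\<psi>, c) x = c" if "\<psi> \<in> homs p G H" "c \<in> {0..<int p}" for \<psi> c
      using that x(1) chi(3) homs_one[OF that(1) n(1)] by (simp add: ext_def)
    have WV: "\<psi> \<in> homs p G H" if "\<psi> \<in> Wn 1" for \<psi> using that by (simp add: Wn_def W_def)
    have inj: "inj_on ext (Wn 1 \<times> {0..<int p})"
    proof (rule inj_onI, clarify)
      fix \<psi> c \<phi> d
      assume a: "\<psi> \<in> Wn 1" "c \<in> {0..<int p}" "\<phi> \<in> Wn 1" "d \<in> {0..<int p}" "ext (\<psi>, c) = ext (\<phi>, d)"
      have "\<psi> = \<phi>"
        by (rule homs_cong_eq[OF WV[OF a(1)] WV[OF a(3)]])
          (use eH[OF WV[OF a(1)], of _ c] eH[OF WV[OF a(3)], of _ d] a(5) in simp)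
      moreover have "c = d" using ex[OF WV[OF a(1)] a(2)] ex[OF WV[OF a(3)] a(4)] a(5) by simp
      ultimately show "\<psi> = \<phi> \<and> c = d" by blast
    qed
    have sub: "ext ` (Wn 1 \<times> {0..<int p}) \<subseteq> homs p G K"
    proof (rule image_subsetI, clarify)
      fix \<psi> c assume a: "\<psi> \<in> Wn 1"
      then have "?t \<psi> = (\<lambda>_. 0)" "\<psi> (x [^] p) = 0" by (simp_all add: Wn_def W_def)
      from hom_extend[OF assms(1) x(1) WV[OF a] this xp chi]
      show "ext (\<psi>, c) \<in> homs p G K" unfolding ext_def by simp
    qed
    have "finite (Wn 1 \<times> {0..<int p})"
      by (rule finite_imageD[OF finite_subset[OF sub assms(3)] inj])
    then show "finite (Wn 1)" using p_gt_1 by (auto dest: finite_cartesian_productD1)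
    show "card (Wn 1) * p \<le> card (homs p G K)"
      using card_inj_on_le[OF inj sub assms(3)] by (simp add: card_cartesian_product)
  qed
  \<comment> \<open>The k-th power of the operator maps \<open>Wn (Suc k)\<close> into
    \<open>Wn 1\<close>, and differences within a fibre lie in \<open>Wn k\<close>. This is the
    counting form of dim ker T^(k+1) \<le> dim ker T^k + dim ker T.\<close>
  have step: "finite (Wn k) \<and> card (Wn k) \<le> card (Wn 1) ^ k" for k
  proof (induction k)
    case 0
    have "Wn 0 \<subseteq> {\<lambda>_. 0}" by (auto simp: Wn_def)
    then show ?case using card_mono[of "{\<lambda>_. 0 :: int}" "Wn 0"] finite_subset by auto
  next
    case (Suc k)
    have img: "(?t ^^ k) ` Wn (Suc k) \<subseteq> Wn 1" using tWn by (auto simp: Wn_def)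
    have fib: "finite {a \<in> Wn (Suc k). (?t ^^ k) a = b} \<and> card {a \<in> Wn (Suc k). (?t ^^ k) a = b} \<le> card (Wn 1) ^ k" for b
    proof (cases "{a \<in> Wn (Suc k). (?t ^^ k) a = b} = {}")
      case True show ?thesis unfolding True by simp
    next
      case False
      let ?F = "{a \<in> Wn (Suc k). (?t ^^ k) a = b}"
      from False obtain a where a: "a \<in> Wn (Suc k)" "(?t ^^ k) a = b" by blast
      have FV: "?F \<subseteq> homs p G H" by (auto simp: Wn_def W_def)
      have i: "inj_on (\<lambda>\<psi>. hom_diff \<psi> a) ?F" using inj_on_subset[OF hom_diff_inj FV] .
      have im: "(\<lambda>\<psi>. hom_diff \<psi> a) ` ?F \<subseteq> Wn k"
        using a dW twist_pow_hom_diff hom_diff_self by (auto simp: Wn_def W_def)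
      show ?thesis
        using finite_subset[OF im] Suc finite_imageD[OF _ i] card_inj_on_le[OF i im] by (meson le_trans)
    qed
    show ?case
      using card_fibre_bound[OF W1(2) img fib] by (simp add: mult.commute)
  qed
  have WW: "Wn p = W" using twist_pow_p[OF assms(1) x(1) xp] by (auto simp: Wn_def W_def)
  \<comment> \<open>Passing from W to all of Hom(H, F_p): evaluation at x^p has at most p values,
    and differences within a fibre lie in W. This is the extra factor p in the bound.\<close>
  have img: "(\<lambda>\<psi>. \<psi> (x [^] p)) ` homs p G H \<subseteq> {0..<int p}" using homsD(2,3) by fastforce
  have fib: "finite {a \<in> homs p G H. a (x [^] p) = b} \<and> card {a \<in> homs p G H. a (x [^] p) = b} \<le> card W" for b
  proof (cases "{a \<in> homs p G H. a (x [^] p) = b} = {}")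
    case True show ?thesis unfolding True by simp
  next
    case False
    let ?F = "{a \<in> homs p G H. a (x [^] p) = b}"
    from False obtain a where a: "a \<in> homs p G H" "a (x [^] p) = b" by blast
    have i: "inj_on (\<lambda>\<psi>. hom_diff \<psi> a) ?F" using inj_on_subset[OF hom_diff_inj, of ?F H] by blast
    have im: "(\<lambda>\<psi>. hom_diff \<psi> a) ` ?F \<subseteq> W" using a dW by auto
    have "finite W" using step[of p] WW by simp
    then show ?thesis
      using finite_subset[OF im] finite_imageD[OF _ i] card_inj_on_le[OF i im] by blast
  qed
  note b = card_fibre_bound[OF _ img fib]
  show "finite (homs p G H)" by (rule b) simp
  have "card (homs p G H) \<le> card W * p" using b(2) by simp
  also have "card W \<le> card (Wn 1) ^ p" using step[of p] WW by simp
  also have "card (Wn 1) \<le> card (homs p G K) div p"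
    using W1(1) p_gt_1 by (simp add: less_eq_div_iff_mult_less_eq)
  finally show "card (homs p G H) \<le> p * (card (homs p G K) div p) ^ p"
    by (simp add: mult.commute power_mono)
qed

end

section \<open>First homology of the bar complex\<close>

lemma quotient_module_coset_ops:
  fixes M :: "('r, 'v, 'm) module_scheme" (structure)
  assumes "module R M" "additive_subgroup N M"
    and smult: "\<forall>a\<in>carrier R. \<forall>n\<in>N. a \<odot>\<^bsub>M\<^esub> n \<in> N"
  shows "x \<in> carrier M \<Longrightarrow> y \<in> carrier M \<Longrightarrow>
      (N +>\<^bsub>M\<^esub> x) \<oplus>\<^bsub>quotient_module M N\<^esub> (N +>\<^bsub>M\<^esub> y) = N +>\<^bsub>M\<^esub> (x \<oplus>\<^bsub>M\<^esub> y)"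
    and "a \<in> carrier R \<Longrightarrow> x \<in> carrier M \<Longrightarrow>
      a \<odot>\<^bsub>quotient_module M N\<^esub> (N +>\<^bsub>M\<^esub> x) = N +>\<^bsub>M\<^esub> (a \<odot>\<^bsub>M\<^esub> x)"
    and "carrier (quotient_module M N) = (\<lambda>x. N +>\<^bsub>M\<^esub> x) ` carrier M"
    and "\<zero>\<^bsub>quotient_module M N\<^esub> = N +>\<^bsub>M\<^esub> \<zero>\<^bsub>M\<^esub>"
    and "x \<in> carrier M \<Longrightarrow> y \<in> carrier M \<Longrightarrow> N +>\<^bsub>M\<^esub> x = N +>\<^bsub>M\<^esub> y \<longleftrightarrow> (\<exists>n\<in>N. x = n \<oplus>\<^bsub>M\<^esub> y)"
proof -
  interpret module R M by fact
  interpret additive_subgroup N M by fact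
  interpret abelian_subgroup N M
    by (rule abelian_subgroupI3) (unfold_locales)
  note NM = a_subset
  show "(N +>\<^bsub>M\<^esub> x) \<oplus>\<^bsub>quotient_module M N\<^esub> (N +>\<^bsub>M\<^esub> y) = N +>\<^bsub>M\<^esub> (x \<oplus>\<^bsub>M\<^esub> y)"
    if "x \<in> carrier M" "y \<in> carrier M"
    using a_rcos_sum[OF that] by (simp add: quotient_module_def)
  show "carrier (quotient_module M N) = (\<lambda>x. N +>\<^bsub>M\<^esub> x) ` carrier M"
    by (auto simp: quotient_module_def A_RCOSETS_def')
  show "\<zero>\<^bsub>quotient_module M N\<^esub> = N +>\<^bsub>M\<^esub> \<zero>\<^bsub>M\<^esub>"
    using a_coset_add_zero[OF NM] by (simp add: quotient_module_def)
  show "N +>\<^bsub>M\<^esub> x = N +>\<^bsub>M\<^esub> y \<longleftrightarrow> (\<exists>n\<in>N. x = n \<oplus>\<^bsub>M\<^esub> y)" if "x \<in> carrier M" "y \<in> carrier M"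
  proof
    assume "N +>\<^bsub>M\<^esub> x = N +>\<^bsub>M\<^esub> y"
    then have "x \<in> N +>\<^bsub>M\<^esub> y" using a_rcos_self[OF that(1)] by simp
    then show "\<exists>n\<in>N. x = n \<oplus>\<^bsub>M\<^esub> y" by (auto simp: a_r_coset_def r_coset_def)
  next
    assume "\<exists>n\<in>N. x = n \<oplus>\<^bsub>M\<^esub> y"
    then have "x \<in> N +>\<^bsub>M\<^esub> y" by (auto simp: a_r_coset_def r_coset_def)
    then show "N +>\<^bsub>M\<^esub> x = N +>\<^bsub>M\<^esub> y" using a_repr_independence'[OF _ that(2)] by simp
  qed
  show "a \<odot>\<^bsub>quotient_module M N\<^esub> (N +>\<^bsub>M\<^esub> x) = N +>\<^bsub>M\<^esub> (a \<odot>\<^bsub>M\<^esub> x)"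
    if "a \<in> carrier R" "x \<in> carrier M"
  proof (intro equalityI subsetI)
    fix y assume "y \<in> a \<odot>\<^bsub>quotient_module M N\<^esub> (N +>\<^bsub>M\<^esub> x)"
    then obtain n n' where n: "n \<in> N" "n' \<in> N" "y = n \<oplus>\<^bsub>M\<^esub> a \<odot>\<^bsub>M\<^esub> (n' \<oplus>\<^bsub>M\<^esub> x)"
      by (auto simp: quotient_module_def set_add_def set_mult_def a_r_coset_def r_coset_def)
    have c: "n \<in> carrier M" "n' \<in> carrier M" using n NM by auto
    have "y = (n \<oplus>\<^bsub>M\<^esub> a \<odot>\<^bsub>M\<^esub> n') \<oplus>\<^bsub>M\<^esub> a \<odot>\<^bsub>M\<^esub> x"
      using n(3) c that by (simp add: smult_r_distr M.a_assoc)
    moreover have "n \<oplus>\<^bsub>M\<^esub> a \<odot>\<^bsub>M\<^esub> n' \<in> N" using n smult that(1) by simp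
    ultimately show "y \<in> N +>\<^bsub>M\<^esub> (a \<odot>\<^bsub>M\<^esub> x)" by (auto simp: a_r_coset_def r_coset_def)
  next
    fix y assume "y \<in> N +>\<^bsub>M\<^esub> (a \<odot>\<^bsub>M\<^esub> x)"
    then obtain n where n: "n \<in> N" "y = n \<oplus>\<^bsub>M\<^esub> a \<odot>\<^bsub>M\<^esub> x" by (auto simp: a_r_coset_def r_coset_def)
    then show "y \<in> a \<odot>\<^bsub>quotient_module M N\<^esub> (N +>\<^bsub>M\<^esub> x)"
      using a_rcos_self[OF that(2)] by (auto simp: quotient_module_def set_add_def set_mult_def)
  qed
qed

lemma module_quotient_module:
  fixes M :: "('r, 'v, 'm) module_scheme" (structure)
  assumes "module R M" "additive_subgroup N M"
    and smult: "\<forall>a\<in>carrier R. \<forall>n\<in>N. a \<odot>\<^bsub>M\<^esub> n \<in> N"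
  shows "module R (quotient_module M N)"
proof -
  interpret M: module R M by fact
  note ops = quotient_module_coset_ops[OF assms]
  have neg: "\<exists>w\<in>carrier M. (N +>\<^bsub>M\<^esub> v) \<oplus>\<^bsub>quotient_module M N\<^esub> (N +>\<^bsub>M\<^esub> w) = N +>\<^bsub>M\<^esub> \<zero>\<^bsub>M\<^esub>" if "v \<in> carrier M" for v
    using that ops(1)[of v "\<ominus>\<^bsub>M\<^esub> v"] M.r_neg by (intro bexI[of _ "\<ominus>\<^bsub>M\<^esub> v"]) auto
  show ?thesis
  proof (rule module_criteria[OF M.R.cring_axioms])
    show "\<zero>\<^bsub>quotient_module M N\<^esub> \<in> carrier (quotient_module M N)" using ops(3,4) by simp
    show "\<forall>v\<in>carrier (quotient_module M N). \<exists>w\<in>carrier (quotient_module M N).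
        v \<oplus>\<^bsub>quotient_module M N\<^esub> w = \<zero>\<^bsub>quotient_module M N\<^esub>"
    proof
      fix v assume "v \<in> carrier (quotient_module M N)"
      then obtain x where x: "x \<in> carrier M" "v = N +>\<^bsub>M\<^esub> x" using ops(3) by auto
      from neg[OF x(1)] obtain w where "w \<in> carrier M"
        "v \<oplus>\<^bsub>quotient_module M N\<^esub> (N +>\<^bsub>M\<^esub> w) = N +>\<^bsub>M\<^esub> \<zero>\<^bsub>M\<^esub>" using x(2) by auto
      then show "\<exists>w\<in>carrier (quotient_module M N). v \<oplus>\<^bsub>quotient_module M N\<^esub> w = \<zero>\<^bsub>quotient_module M N\<^esub>"
        using ops(3,4) by (intro bexI[of _ "N +>\<^bsub>M\<^esub> w"]) auto
    qed
  qed (auto simp: ops(1-4) M.smult_l_distr M.smult_r_distr M.smult_assoc1 M.a_assoc M.a_comm M.a_lcomm)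
qed

text \<open>The hypotheses make \<open>V\<close> dual to \<open>Hom(G, \<F>\<^sub>p)\<close>.\<close>

lemma (in group_prime) card_homs_vectorspace:
  assumes V: "vectorspace (residue_ring (int p)) V" and fd: "vectorspace.fin_dim (residue_ring (int p)) V"
    and s: "\<And>g. g \<in> carrier G \<Longrightarrow> s g \<in> carrier V" "carrier V \<subseteq> s ` carrier G"
      "\<And>g h. g \<in> carrier G \<Longrightarrow> h \<in> carrier G \<Longrightarrow> s (g \<otimes> h) = s g \<oplus>\<^bsub>V\<^esub> s h"
    and fac: "\<And>\<psi> g h. \<psi> \<in> homs p G (carrier G) \<Longrightarrow> g \<in> carrier G \<Longrightarrow> h \<in> carrier G \<Longrightarrow> s g = s h \<Longrightarrow> \<psi> g = \<psi> h"
  shows "finite (homs p G (carrier G))" "card (homs p G (carrier G)) = p ^ vectorspace.dim (residue_ring (int p)) V"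
proof -
  define R where "R = residue_ring (int p)"
  interpret V: vectorspace R V unfolding R_def by (rule V)
  note [simp] = residue_ring_def
  have RC: "carrier R = {0..<int p}" by (auto simp: R_def)
  have fdV: V.fin_dim using fd by (simp add: R_def)
  obtain B where B: "finite B" "V.basis B" using V.finite_basis_exists[OF fdV] by blast
  have BV: "B \<subseteq> carrier V" "V.gen_set B" using B(2) by (auto simp: V.basis_def)
  have dim: "vectorspace.dim (residue_ring (int p)) V = card B" using V.dim_basis[OF B] by (simp add: R_def)
  define F where "F = (B \<rightarrow>\<^sub>E {0..<int p})"
  have cardF: "card F = p ^ card B" "finite F" using B(1) by (simp_all add: F_def card_PiE finite_PiE)
  have coord: "\<exists>!a. a \<in> F \<and> V.lincomb a B = v" if "v \<in> carrier V" for v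
    using V.basis_criterion[OF B(1) BV(1)] B(2) that unfolding F_def RC by blast
  let ?H = "homs p G (carrier G)"
  have "\<forall>b\<in>B. \<exists>g\<in>carrier G. s g = b" using s(2) BV(1) by blast
  then obtain \<gamma> where \<gamma>: "\<And>b. b \<in> B \<Longrightarrow> \<gamma> b \<in> carrier G \<and> s (\<gamma> b) = b" by metis
  have s1: "s \<one> = \<zero>\<^bsub>V\<^esub>"
  proof -
    have "s \<one> \<oplus>\<^bsub>V\<^esub> s \<one> = s \<one>" using s(3)[of \<one> \<one>] by simp
    then show ?thesis using s(1)[of \<one>] by (metis V.module.M.add.l_cancel_one' one_closed)
  qed
  \<comment> \<open>Over a prime field scalar multiplication is repeated addition, so it corresponds
    to taking powers in G; this is why additivity of s suffices.\<close>
  have spow: "(int n mod int p) \<odot>\<^bsub>V\<^esub> s g = s (g [^] n)" if g: "g \<in> carrier G" for g n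
  proof (induction n)
    case 0
    have "\<zero>\<^bsub>R\<^esub> \<odot>\<^bsub>V\<^esub> s g = \<zero>\<^bsub>V\<^esub>" using s(1)[OF g] by simp
    then show ?case using s1 by (simp add: R_def)
  next
    case (Suc n)
    have m: "int n mod int p \<in> carrier R" "1 \<in> carrier R" using p_gt_1 by (simp_all add: RC)
    have "(int n mod int p \<oplus>\<^bsub>R\<^esub> 1) \<odot>\<^bsub>V\<^esub> s g = (int n mod int p) \<odot>\<^bsub>V\<^esub> s g \<oplus>\<^bsub>V\<^esub> 1 \<odot>\<^bsub>V\<^esub> s g"
      by (rule V.smult_l_distr[OF m s(1)[OF g]])
    moreover have "1 \<odot>\<^bsub>V\<^esub> s g = s g" using V.smult_one[OF s(1)[OF g]] by (simp add: R_def)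
    moreover have "int n mod int p \<oplus>\<^bsub>R\<^esub> 1 = int (Suc n) mod int p" by (simp add: R_def mod_simps add.commute)
    ultimately show ?case using Suc s(3)[of "g [^] n" g] g by simp
  qed
  have inj: "inj_on (\<lambda>\<psi>. \<lambda>b\<in>B. \<psi> (\<gamma> b)) ?H"
  proof (rule inj_onI)
    fix \<psi> \<phi> assume a: "\<psi> \<in> ?H" "\<phi> \<in> ?H" "(\<lambda>b\<in>B. \<psi> (\<gamma> b)) = (\<lambda>b\<in>B. \<phi> (\<gamma> b))"
    \<comment> \<open>The subspace on which the two homomorphisms agree. It contains a basis, so it
      is all of V, and by \<open>fac\<close> the homomorphisms agree on G.\<close>
    define U where "U = {v. \<exists>g\<in>carrier G. s g = v \<and> \<psi> g = \<phi> g}"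
    have "LinearCombinations.submodule R U V"
    proof (unfold_locales)
      show "U \<subseteq> carrier V" using s(1) by (auto simp: U_def)
      show "\<zero>\<^bsub>V\<^esub> \<in> U"
        using s1 homs_one[OF a(1) subgroup_self] homs_one[OF a(2) subgroup_self] by (auto simp: U_def)
      show "v \<oplus>\<^bsub>V\<^esub> w \<in> U" if vw: "v \<in> U" "w \<in> U" for v w
      proof -
        obtain g h where gh: "g \<in> carrier G" "s g = v" "\<psi> g = \<phi> g" "h \<in> carrier G" "s h = w" "\<psi> h = \<phi> h"
          using vw by (auto simp: U_def)
        then have "s (g \<otimes> h) = v \<oplus>\<^bsub>V\<^esub> w" "\<psi> (g \<otimes> h) = \<phi> (g \<otimes> h)"
          using s(3) homsD(5)[OF a(1)] homsD(5)[OF a(2)] by auto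
        then show ?thesis using gh by (auto simp: U_def)
      qed
      show "c \<odot>\<^bsub>V\<^esub> v \<in> U" if c: "c \<in> carrier R" and v: "v \<in> U" for c v
      proof -
        obtain g where g: "g \<in> carrier G" "s g = v" "\<psi> g = \<phi> g" using v by (auto simp: U_def)
        have "s (g [^] nat c) = c \<odot>\<^bsub>V\<^esub> v" using spow[OF g(1), of "nat c"] c g(2) by (simp add: RC)
        moreover have "\<psi> (g [^] nat c) = \<phi> (g [^] nat c)"
          using homs_pow[OF a(1) subgroup_self g(1)] homs_pow[OF a(2) subgroup_self g(1)] g(3) by simp
        ultimately show ?thesis unfolding U_def using g(1) by blast
      qed
    qed
    moreover have "B \<subseteq> U"
    proof
      fix b assume b: "b \<in> B"
      then have "\<psi> (\<gamma> b) = \<phi> (\<gamma> b)" using fun_cong[OF a(3), of b] by simp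
      then show "b \<in> U" using \<gamma>[OF b] by (auto simp: U_def)
    qed
    ultimately have "carrier V \<subseteq> U" using V.span_is_subset BV(2) by blast
    show "\<psi> = \<phi>"
    proof (rule homs_cong_eq[OF a(1,2)])
      fix g assume g: "g \<in> carrier G"
      then have "s g \<in> U" using s(1) \<open>carrier V \<subseteq> U\<close> by blast
      then obtain h where "h \<in> carrier G" "s h = s g" "\<psi> h = \<phi> h" by (auto simp: U_def)
      then show "\<psi> g = \<phi> g" using fac[OF a(1) g, of h] fac[OF a(2) g, of h] by simp
    qed
  qed
  have sub: "(\<lambda>\<psi>. \<lambda>b\<in>B. \<psi> (\<gamma> b)) ` ?H \<subseteq> F"
    using homsD(2,3) by (fastforce simp: F_def)
  show fin: "finite ?H" by (rule finite_imageD[OF finite_subset[OF sub cardF(2)] inj])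
  have le: "card ?H \<le> p ^ card B" using card_inj_on_le[OF inj sub cardF(2)] cardF(1) by simp
  define co where "co v = (THE a. a \<in> F \<and> V.lincomb a B = v)" for v
  have co: "co v \<in> F \<and> V.lincomb (co v) B = v" if "v \<in> carrier V" for v
    unfolding co_def by (rule theI'[OF coord[OF that]])
  have co_uniq: "co v = a" if "v \<in> carrier V" "a \<in> F" "V.lincomb a B = v" for v a
    using coord[OF that(1)] co[OF that(1)] that by blast
  \<comment> \<open>The linear functional with values t on the basis B, pulled back to G along s. It
    supplies the reverse inequality.\<close>
  define th where "th t g = (if g \<in> carrier G then (\<Sum>b\<in>B. co (s g) b * t b) mod int p else 0)" for t g
  have thH: "th t \<in> ?H" for t
    unfolding homs_def
  proof (intro CollectI conjI allI impI ballI)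
    fix g h assume gh: "g \<in> carrier G" "h \<in> carrier G"
    note v = s(1)[OF gh(1)] s(1)[OF gh(2)]
    define a where "a = (\<lambda>b\<in>B. (co (s g) b + co (s h) b) mod int p)"
    have cF: "co (s g) \<in> B \<rightarrow> carrier R" "co (s h) \<in> B \<rightarrow> carrier R"
      using co[OF v(1)] co[OF v(2)] by (auto simp: F_def RC PiE_def)
    have "V.lincomb a B = V.lincomb (\<lambda>b. co (s g) b \<oplus>\<^bsub>R\<^esub> co (s h) b) B"
      by (rule V.lincomb_cong[OF refl BV(1)]) (use cF p_gt_1 in \<open>auto simp: a_def R_def\<close>)
    also have "\<dots> = s g \<oplus>\<^bsub>V\<^esub> s h"
      using V.lincomb_sum[OF B(1) BV(1) cF] co v by simp
    finally have "V.lincomb a B = s (g \<otimes> h)" using s(3)[OF gh] by simp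
    moreover have "a \<in> F" using p_gt_1 by (auto simp: a_def F_def)
    ultimately have "co (s (g \<otimes> h)) = a" using co_uniq s(1) gh by simp
    then have "(\<Sum>b\<in>B. co (s (g \<otimes> h)) b * t b) mod int p = (\<Sum>b\<in>B. (co (s g) b + co (s h) b) mod int p * t b) mod int p"
      by (simp add: a_def)
    also have "\<dots> = (\<Sum>b\<in>B. (((co (s g) b + co (s h) b) mod int p * t b) mod int p)) mod int p"
      by (rule mod_sum_eq[symmetric])
    also have "\<dots> = (\<Sum>b\<in>B. (((co (s g) b + co (s h) b) * t b) mod int p)) mod int p"
      by (simp only: mod_mult_left_eq)
    also have "\<dots> = (\<Sum>b\<in>B. (co (s g) b + co (s h) b) * t b) mod int p"
      by (rule mod_sum_eq)
    also have "\<dots> = ((\<Sum>b\<in>B. co (s g) b * t b) + (\<Sum>b\<in>B. co (s h) b * t b)) mod int p"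
      by (simp add: distrib_right sum.distrib)
    finally show "th t (g \<otimes> h) = (th t g + th t h) mod int p"
      using gh by (simp add: th_def mod_simps)
  qed (use p_gt_1 in \<open>auto simp: th_def\<close>)
  have "inj_on th F"
  proof (rule inj_onI)
    fix t t' assume t: "t \<in> F" "t' \<in> F" "th t = th t'"
    have "t b = t' b" if b: "b \<in> B" for b
    proof -
      define a where "a = (\<lambda>c\<in>B. if c = b then 1 else (0::int))"
      have aF: "a \<in> F" using p_gt_1 by (auto simp: a_def F_def)
      then have "a \<in> B \<rightarrow> carrier R" by (auto simp: F_def RC)
      then have v: "V.lincomb a B \<in> carrier V" using V.lincomb_closed[OF BV(1)] by blast
      from subsetD[OF s(2) v] obtain g where g: "g \<in> carrier G" "s g = V.lincomb a B" by (metis imageE)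
      then have "co (s g) = a" using co_uniq[OF v aF] by simp
      moreover have "(\<Sum>c\<in>B. a c * u c) = u b" for u
        using B(1) b by (simp add: a_def if_distrib[of "\<lambda>x. x * _"] sum.delta cong: if_cong)
      ultimately have "th t g = t b mod int p" "th t' g = t' b mod int p" using g by (simp_all add: th_def)
      then show ?thesis using t b by (auto simp: F_def PiE_iff)
    qed
    then show "t = t'" using t(1,2) by (auto simp: F_def intro: PiE_ext)
  qed
  then have "card F \<le> card ?H" by (rule card_inj_on_le) (use thH fin in auto)
  then show "card ?H = p ^ vectorspace.dim (residue_ring (int p)) V" using le cardF dim by simp
qed

section \<open>Chains and boundaries in low degree\<close>

lemma mod_sum_mult_left:
  "(\<Sum>x\<in>S. (f x mod m) * g x) mod m = (\<Sum>x\<in>S. f x * g x) mod (m::int)"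
proof -
  have "(\<Sum>x\<in>S. (f x mod m) * g x) mod m = (\<Sum>x\<in>S. ((f x mod m) * g x) mod m) mod m"
    by (rule mod_sum_eq[symmetric])
  also have "\<dots> = (\<Sum>x\<in>S. (f x * g x) mod m) mod m" by (simp only: mod_mult_left_eq)
  also have "\<dots> = (\<Sum>x\<in>S. f x * g x) mod m" by (rule mod_sum_eq)
  finally show ?thesis .
qed

context group_prime
begin

abbreviation Fp :: "int ring" where "Fp \<equiv> residue_ring (int p)"

abbreviation chains :: "nat \<Rightarrow> (int, 'a list \<Rightarrow> int) module" where "chains n \<equiv> bar_chains p G n"

definition boundaries :: "('a list \<Rightarrow> int) set" where
  "boundaries = bar_boundary p G (Suc 1) ` carrier (chains (Suc 1))"

lemma Fp_field: "field Fp"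
proof -
  interpret residues_prime p Fp using prime_p by unfold_locales (simp_all add: prime_p)
  show ?thesis by (rule field_axioms)
qed

lemma Fp_simps: "carrier Fp = {0..<int p}" "x \<oplus>\<^bsub>Fp\<^esub> y = (x + y) mod int p"
  "x \<otimes>\<^bsub>Fp\<^esub> y = (x * y) mod int p" "\<one>\<^bsub>Fp\<^esub> = 1" "\<zero>\<^bsub>Fp\<^esub> = 0"
  by (auto simp: residue_ring_def)

lemma chains_carrier_iff:
  "c \<in> carrier (chains n) \<longleftrightarrow> (\<forall>xs. 0 \<le> c xs \<and> c xs < int p) \<and> finite {xs. c xs \<noteq> 0} \<and>
     (\<forall>xs. c xs \<noteq> 0 \<longrightarrow> length xs = n \<and> set xs \<subseteq> carrier G)"
  unfolding bar_chains_def by (auto simp: Fp_simps)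

lemma chains_ops:
  "c \<oplus>\<^bsub>chains n\<^esub> d = (\<lambda>xs. (c xs + d xs) mod int p)"
  "a \<odot>\<^bsub>chains n\<^esub> c = (\<lambda>xs. (a * c xs) mod int p)"
  "\<zero>\<^bsub>chains n\<^esub> = (\<lambda>xs. 0)"
  by (simp_all add: bar_chains_def Fp_simps)

lemma chainsD:
  assumes "c \<in> carrier (chains n)"
  shows "0 \<le> c xs" "c xs < int p" "c xs mod int p = c xs" "finite {xs. c xs \<noteq> 0}"
    "c xs \<noteq> 0 \<Longrightarrow> length xs = n" "c xs \<noteq> 0 \<Longrightarrow> set xs \<subseteq> carrier G"
  using assms by (auto simp: chains_carrier_iff)

lemma chains_add_closed:
  assumes "c \<in> carrier (chains n)" "d \<in> carrier (chains n)"
  shows "(\<lambda>xs. (c xs + d xs) mod int p) \<in> carrier (chains n)"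
proof -
  have nz: "c xs \<noteq> 0 \<or> d xs \<noteq> 0" if "(c xs + d xs) mod int p \<noteq> 0" for xs
    using that by auto
  have "finite {xs. (c xs + d xs) mod int p \<noteq> 0}"
    by (rule finite_subset[OF _ finite_UnI[OF chainsD(4)[OF assms(1)] chainsD(4)[OF assms(2)]]])
      (use nz in blast)
  moreover have "length xs = n \<and> set xs \<subseteq> carrier G" if "(c xs + d xs) mod int p \<noteq> 0" for xs
    using nz[OF that] chainsD(5,6)[OF assms(1), of xs] chainsD(5,6)[OF assms(2), of xs] by blast
  ultimately show ?thesis unfolding chains_carrier_iff using p_gt_1 by simp
qed

lemma chains_smult_closed:
  assumes "c \<in> carrier (chains n)"
  shows "(\<lambda>xs. (a * c xs) mod int p) \<in> carrier (chains n)"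
proof -
  have nz: "c xs \<noteq> 0" if "(a * c xs) mod int p \<noteq> 0" for xs
    using that by auto
  have "finite {xs. (a * c xs) mod int p \<noteq> 0}"
    by (rule finite_subset[OF _ chainsD(4)[OF assms(1)]]) (use nz in blast)
  moreover have "length xs = n \<and> set xs \<subseteq> carrier G" if "(a * c xs) mod int p \<noteq> 0" for xs
    using nz[OF that] chainsD(5,6)[OF assms(1), of xs] by blast
  ultimately show ?thesis unfolding chains_carrier_iff using p_gt_1 by simp
qed

lemma chains_module: "module Fp (chains n)"
proof (rule module_criteria)
  show "cring Fp" using Fp_field by (simp add: field.axioms(1) domain.axioms(1) field_def domain_def)
  show "\<zero>\<^bsub>chains n\<^esub> \<in> carrier (chains n)"
    using p_gt_1 by (simp add: chains_ops chains_carrier_iff)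
  show "\<forall>v\<in>carrier (chains n). \<exists>w\<in>carrier (chains n). v \<oplus>\<^bsub>chains n\<^esub> w = \<zero>\<^bsub>chains n\<^esub>"
  proof
    fix v assume v: "v \<in> carrier (chains n)"
    have "(\<lambda>xs. (-1 * v xs) mod int p) \<in> carrier (chains n)" by (rule chains_smult_closed[OF v])
    moreover have "v \<oplus>\<^bsub>chains n\<^esub> (\<lambda>xs. (-1 * v xs) mod int p) = \<zero>\<^bsub>chains n\<^esub>"
      by (simp add: chains_ops mod_simps)
    ultimately show "\<exists>w\<in>carrier (chains n). v \<oplus>\<^bsub>chains n\<^esub> w = \<zero>\<^bsub>chains n\<^esub>" by blast
  qed
  show "\<forall>v w. v \<in> carrier (chains n) \<and> w \<in> carrier (chains n) \<longrightarrow> v \<oplus>\<^bsub>chains n\<^esub> w \<in> carrier (chains n)"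
    using chains_add_closed by (simp add: chains_ops)
  show "\<forall>c v. c \<in> carrier Fp \<and> v \<in> carrier (chains n) \<longrightarrow> c \<odot>\<^bsub>chains n\<^esub> v \<in> carrier (chains n)"
    using chains_smult_closed by (simp add: chains_ops)
qed (use chainsD(3) in \<open>auto simp: chains_ops Fp_simps mod_simps algebra_simps intro!: ext\<close>)

definition face_coeff :: "nat \<Rightarrow> 'a list \<Rightarrow> 'a list \<Rightarrow> int" where
  "face_coeff n xs ys = (\<Sum>i\<le>n. (-1) ^ i * of_bool (bar_face G i xs = ys))"

lemma bar_boundary_eq:
  assumes "finite S" "{xs. c xs \<noteq> 0} \<subseteq> S" "n \<noteq> 0"
  shows "bar_boundary p G n c ys = (\<Sum>xs\<in>S. c xs * face_coeff n xs ys) mod int p"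
proof -
  have "(\<Sum>xs | c xs \<noteq> 0. c xs * face_coeff n xs ys) = (\<Sum>xs\<in>S. c xs * face_coeff n xs ys)"
    by (rule sum.mono_neutral_left[OF assms(1,2)]) simp
  then show ?thesis using assms(3) by (simp add: bar_boundary_def face_coeff_def)
qed

lemma bar_boundary_add:
  assumes "c \<in> carrier (chains n)" "d \<in> carrier (chains n)" "n \<noteq> 0"
  shows "bar_boundary p G n (\<lambda>xs. (c xs + d xs) mod int p) =
    (\<lambda>ys. (bar_boundary p G n c ys + bar_boundary p G n d ys) mod int p)"
proof
  fix ys
  let ?S = "{xs. c xs \<noteq> 0} \<union> {xs. d xs \<noteq> 0}"
  have S: "finite ?S" using chainsD(4) assms by blast
  have sub: "{xs. c xs \<noteq> 0} \<subseteq> ?S" "{xs. d xs \<noteq> 0} \<subseteq> ?S" "{xs. (c xs + d xs) mod int p \<noteq> 0} \<subseteq> ?S"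
    by auto
  show "bar_boundary p G n (\<lambda>xs. (c xs + d xs) mod int p) ys =
    (bar_boundary p G n c ys + bar_boundary p G n d ys) mod int p"
    unfolding bar_boundary_eq[OF S sub(1) assms(3)] bar_boundary_eq[OF S sub(2) assms(3)]
      bar_boundary_eq[OF S sub(3) assms(3)] mod_sum_mult_left
    by (simp add: distrib_right sum.distrib mod_simps)
qed

lemma bar_boundary_smult:
  assumes "c \<in> carrier (chains n)" "n \<noteq> 0"
  shows "bar_boundary p G n (\<lambda>xs. (a * c xs) mod int p) = (\<lambda>ys. (a * bar_boundary p G n c ys) mod int p)"
proof
  fix ys
  let ?S = "{xs. c xs \<noteq> 0}"
  have S: "finite ?S" using chainsD(4) assms by blast
  have sub: "{xs. (a * c xs) mod int p \<noteq> 0} \<subseteq> ?S" by auto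
  show "bar_boundary p G n (\<lambda>xs. (a * c xs) mod int p) ys = (a * bar_boundary p G n c ys) mod int p"
    unfolding bar_boundary_eq[OF S subset_refl assms(2)] bar_boundary_eq[OF S sub assms(2)] mod_sum_mult_left
    by (simp add: sum_distrib_left mult.assoc mod_simps)
qed

lemma face_coeff_pair: "face_coeff (Suc 1) [g, h] ys = of_bool ([h] = ys) - of_bool ([g \<otimes> h] = ys) + of_bool ([g] = ys)"
  by (simp add: face_coeff_def bar_face_def)

lemma length_2_chain:
  assumes "c \<in> carrier (chains (Suc 1))" "c xs \<noteq> 0"
  obtains g h where "xs = [g, h]" "g \<in> carrier G" "h \<in> carrier G"
proof -
  have "length xs = Suc 1" "set xs \<subseteq> carrier G" using chainsD(5,6)[OF assms(1) assms(2)] by auto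
  then show thesis using that by (auto simp: length_Suc_conv)
qed

definition faces :: "'a list \<Rightarrow> 'a list set" where
  "faces xs = (\<lambda>i. bar_face G i xs) ` {..Suc 1}"

lemma faces_pair: "faces [g, h] = {[h], [g \<otimes> h], [g]}"
  by (auto simp: faces_def bar_face_def atMost_Suc image_iff)

text \<open>A finite set that contains the support of the boundary; it allows the double sum in
  \<open>eval_hom_boundary\<close> to be interchanged.\<close>

lemma boundaries_faces:
  assumes "c \<in> carrier (chains (Suc 1))"
  shows "{ys. bar_boundary p G (Suc 1) c ys \<noteq> 0} \<subseteq> (\<Union>xs\<in>{xs. c xs \<noteq> 0}. faces xs)"
    "finite (\<Union>xs\<in>{xs. c xs \<noteq> 0}. faces xs)"
proof -
  show "finite (\<Union>xs\<in>{xs. c xs \<noteq> 0}. faces xs)"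
    using chainsD(4)[OF assms] by (simp add: faces_def)
  show "{ys. bar_boundary p G (Suc 1) c ys \<noteq> 0} \<subseteq> (\<Union>xs\<in>{xs. c xs \<noteq> 0}. faces xs)"
  proof (rule subsetI, rule ccontr)
    fix ys assume a: "ys \<in> {ys. bar_boundary p G (Suc 1) c ys \<noteq> 0}" "ys \<notin> (\<Union>xs\<in>{xs. c xs \<noteq> 0}. faces xs)"
    have "c xs * face_coeff (Suc 1) xs ys = 0" for xs
    proof (cases "c xs = 0")
      case False
      then have "ys \<notin> faces xs" using a(2) by blast
      then have "bar_face G i xs \<noteq> ys" if "i \<le> Suc 1" for i
        using that by (auto simp: faces_def)
      then have "face_coeff (Suc 1) xs ys = 0" unfolding face_coeff_def by (intro sum.neutral) simp
      then show ?thesis by simp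
    qed simp
    then have "bar_boundary p G (Suc 1) c ys = 0"
      unfolding bar_boundary_eq[OF chainsD(4)[OF assms] subset_refl nat.distinct(2)] by (simp only: sum.neutral_const mod_0)
    then show False using a(1) by simp
  qed
qed

lemma boundaries_subset: "boundaries \<subseteq> carrier (chains 1)"
proof
  fix b assume "b \<in> boundaries"
  then obtain c where c: "c \<in> carrier (chains (Suc 1))" "b = bar_boundary p G (Suc 1) c"
    by (auto simp: boundaries_def)
  have "length ys = 1 \<and> set ys \<subseteq> carrier G" if "b ys \<noteq> 0" for ys
  proof -
    have "ys \<in> {ys. bar_boundary p G (Suc 1) c ys \<noteq> 0}" using c(2) that by simp
    then obtain xs where xs: "c xs \<noteq> 0" "ys \<in> faces xs"
      using subsetD[OF boundaries_faces(1)[OF c(1)]] by blast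
    from length_2_chain[OF c(1) xs(1)] obtain g h where gh: "xs = [g, h]" "g \<in> carrier G" "h \<in> carrier G" .
    then show ?thesis using xs(2) by (auto simp: faces_pair)
  qed
  moreover have "finite {ys. b ys \<noteq> 0}" unfolding c(2) by (rule finite_subset[OF boundaries_faces[OF c(1)]])
  moreover have "0 \<le> b ys \<and> b ys < int p" for ys unfolding c(2) bar_boundary_def using p_gt_1 by simp
  ultimately show "b \<in> carrier (chains 1)" by (simp add: chains_carrier_iff)
qed

lemma boundaries_smult:
  assumes "b \<in> boundaries" shows "a \<odot>\<^bsub>chains 1\<^esub> b \<in> boundaries"
proof -
  obtain c where c: "c \<in> carrier (chains (Suc 1))" "b = bar_boundary p G (Suc 1) c"
    using assms by (auto simp: boundaries_def)
  show ?thesis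
    unfolding boundaries_def c(2) chains_ops bar_boundary_smult[OF c(1) nat.distinct(2), symmetric]
    by (rule imageI[OF chains_smult_closed[OF c(1)]])
qed

lemma boundaries_smult_ball: "\<forall>a\<in>carrier Fp. \<forall>b\<in>boundaries. a \<odot>\<^bsub>chains 1\<^esub> b \<in> boundaries"
  using boundaries_smult by blast

lemma boundaries_add:
  assumes "b \<in> boundaries" "b' \<in> boundaries" shows "b \<oplus>\<^bsub>chains 1\<^esub> b' \<in> boundaries"
proof -
  obtain c where c: "c \<in> carrier (chains (Suc 1))" "b = bar_boundary p G (Suc 1) c"
    using assms by (auto simp: boundaries_def)
  obtain d where d: "d \<in> carrier (chains (Suc 1))" "b' = bar_boundary p G (Suc 1) d"
    using assms by (auto simp: boundaries_def)
  show ?thesis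
    unfolding boundaries_def c(2) d(2) chains_ops bar_boundary_add[OF c(1) d(1) nat.distinct(2), symmetric]
    by (rule imageI[OF chains_add_closed[OF c(1) d(1)]])
qed

lemma boundaries_subgroup: "additive_subgroup boundaries (chains 1)"
proof -
  interpret M: module Fp "chains 1" by (rule chains_module)
  have zero: "\<zero>\<^bsub>chains 1\<^esub> \<in> boundaries"
  proof -
    have "(\<lambda>_. 0) \<in> carrier (chains (Suc 1))" using p_gt_1 by (simp add: chains_carrier_iff)
    moreover have "bar_boundary p G (Suc 1) (\<lambda>_. 0) = (\<lambda>_. 0)" by (simp add: bar_boundary_def)
    ultimately show ?thesis unfolding boundaries_def chains_ops by (metis image_eqI)
  qed
  show ?thesis
  proof (rule additive_subgroupI, rule M.add.subgroupI)
    show "boundaries \<subseteq> carrier (chains 1)" by (rule boundaries_subset)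
    show "boundaries \<noteq> {}" using zero by blast
    show "a \<oplus>\<^bsub>chains 1\<^esub> b \<in> boundaries" if "a \<in> boundaries" "b \<in> boundaries" for a b
      using boundaries_add that by blast
    show "\<ominus>\<^bsub>chains 1\<^esub> a \<in> boundaries" if a: "a \<in> boundaries" for a
    proof -
      have ac: "a \<in> carrier (chains 1)" using a boundaries_subset by blast
      have m: "(-1) \<odot>\<^bsub>chains 1\<^esub> a \<in> boundaries" by (rule boundaries_smult[OF a])
      have "(-1) \<odot>\<^bsub>chains 1\<^esub> a \<oplus>\<^bsub>chains 1\<^esub> a = \<zero>\<^bsub>chains 1\<^esub>" by (simp add: chains_ops mod_simps)
      then have "\<ominus>\<^bsub>chains 1\<^esub> a = (-1) \<odot>\<^bsub>chains 1\<^esub> a"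
        using M.minus_equality[OF _ ac] m boundaries_subset by blast
      then show ?thesis using m by simp
    qed
  qed
qed

text \<open>With trivial coefficients every 1-chain is a cycle: both faces of [g] are the empty
  tuple and they occur with opposite signs.\<close>

lemma group_homology_1: "group_homology p 1 G = quotient_module (chains 1) boundaries"
proof -
  have "bar_boundary p G 1 c = (\<lambda>_. 0)" if c: "c \<in> carrier (chains 1)" for c
  proof
    fix ys
    have "c xs * face_coeff 1 xs ys = 0" for xs
    proof (cases "c xs = 0")
      case False
      then have "length xs = 1" using chainsD(5)[OF c] by blast
      then obtain g where "xs = [g]" by (metis One_nat_def length_0_conv length_Suc_conv)
      then show ?thesis by (simp add: face_coeff_def bar_face_def)
    qed simp
    then show "bar_boundary p G 1 c ys = 0"
      unfolding bar_boundary_eq[OF chainsD(4)[OF c] subset_refl one_neq_zero] by (simp only: sum.neutral_const mod_0)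
  qed
  then have "{c \<in> carrier (chains 1). bar_boundary p G 1 c = (\<lambda>_. 0)} = carrier (chains 1)" by auto
  then have "group_homology p 1 G = quotient_module ((chains 1)\<lparr>carrier := carrier (chains 1)\<rparr>) boundaries"
    by (simp add: group_homology_def boundaries_def)
  then show ?thesis by simp
qed

text \<open>The pairing of \<psi> with 1-chains; \<open>hd\<close> reads the entry of a one-element
  tuple. Its vanishing on boundaries makes \<psi> factor through homology.\<close>

definition eval_hom :: "('a \<Rightarrow> int) \<Rightarrow> ('a list \<Rightarrow> int) \<Rightarrow> int" where
  "eval_hom \<psi> c = (\<Sum>xs | c xs \<noteq> 0. c xs * \<psi> (hd xs)) mod int p"

lemma eval_hom_eq:
  assumes "finite S" "{xs. c xs \<noteq> 0} \<subseteq> S"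
  shows "eval_hom \<psi> c = (\<Sum>xs\<in>S. c xs * \<psi> (hd xs)) mod int p"
  unfolding eval_hom_def using sum.mono_neutral_left[OF assms, of "\<lambda>xs. c xs * \<psi> (hd xs)"] by simp

lemma eval_hom_add:
  assumes "c \<in> carrier (chains n)" "d \<in> carrier (chains n)"
  shows "eval_hom \<psi> (c \<oplus>\<^bsub>chains n\<^esub> d) = (eval_hom \<psi> c + eval_hom \<psi> d) mod int p"
proof -
  let ?S = "{xs. c xs \<noteq> 0} \<union> {xs. d xs \<noteq> 0}"
  have S: "finite ?S" using chainsD(4) assms by blast
  have sub: "{xs. c xs \<noteq> 0} \<subseteq> ?S" "{xs. d xs \<noteq> 0} \<subseteq> ?S" "{xs. (c xs + d xs) mod int p \<noteq> 0} \<subseteq> ?S"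
    by auto
  show ?thesis
    unfolding chains_ops eval_hom_eq[OF S sub(1)] eval_hom_eq[OF S sub(2)] eval_hom_eq[OF S sub(3)] mod_sum_mult_left
    by (simp add: distrib_right sum.distrib mod_simps)
qed

text \<open>A homomorphism is a 1-cocycle: on the boundary [h] - [gh] + [g] it takes the value
  \<psi>(h) - \<psi>(gh) + \<psi>(g), a multiple of p.\<close>

lemma eval_hom_boundary:
  assumes "\<psi> \<in> homs p G (carrier G)" "b \<in> boundaries"
  shows "eval_hom \<psi> b = 0"
proof -
  obtain c where c: "c \<in> carrier (chains (Suc 1))" "b = bar_boundary p G (Suc 1) c"
    using assms(2) by (auto simp: boundaries_def)
  let ?S = "{xs. c xs \<noteq> 0}"
  let ?T = "\<Union>xs\<in>?S. faces xs"
  note T = boundaries_faces[OF c(1)]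
  have "eval_hom \<psi> b = (\<Sum>ys\<in>?T. b ys * \<psi> (hd ys)) mod int p"
    by (rule eval_hom_eq[OF T(2)]) (use T(1) c(2) in blast)
  also have "\<dots> = (\<Sum>ys\<in>?T. ((\<Sum>xs\<in>?S. c xs * face_coeff (Suc 1) xs ys) mod int p) * \<psi> (hd ys)) mod int p"
    unfolding c(2) by (simp add: bar_boundary_eq[OF chainsD(4)[OF c(1)] subset_refl])
  also have "\<dots> = (\<Sum>ys\<in>?T. (\<Sum>xs\<in>?S. c xs * face_coeff (Suc 1) xs ys) * \<psi> (hd ys)) mod int p"
    by (rule mod_sum_mult_left)
  also have "(\<Sum>ys\<in>?T. (\<Sum>xs\<in>?S. c xs * face_coeff (Suc 1) xs ys) * \<psi> (hd ys)) =
      (\<Sum>xs\<in>?S. c xs * (\<Sum>ys\<in>?T. face_coeff (Suc 1) xs ys * \<psi> (hd ys)))"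
    by (simp only: sum_distrib_left sum_distrib_right mult.assoc, rule sum.swap)
  finally have eval_hom: "eval_hom \<psi> b = (\<Sum>xs\<in>?S. c xs * (\<Sum>ys\<in>?T. face_coeff (Suc 1) xs ys * \<psi> (hd ys))) mod int p" .
  have "int p dvd (\<Sum>xs\<in>?S. c xs * (\<Sum>ys\<in>?T. face_coeff (Suc 1) xs ys * \<psi> (hd ys)))"
  proof (rule dvd_sum)
    fix xs assume xs: "xs \<in> ?S"
    then obtain g h where gh: "xs = [g, h]" "g \<in> carrier G" "h \<in> carrier G"
      using length_2_chain[OF c(1)] by blast
    have in_T: "[h] \<in> ?T" "[g \<otimes> h] \<in> ?T" "[g] \<in> ?T"
      using xs gh(1) faces_pair by blast+
    have "(\<Sum>ys\<in>?T. of_bool (y = ys) * \<psi> (hd ys)) = \<psi> (hd y)" if "y \<in> ?T" for y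
      using T(2) that by (simp add: of_bool_def if_distrib[of "\<lambda>x. x * _"] cong: if_cong)
    then have "(\<Sum>ys\<in>?T. face_coeff (Suc 1) xs ys * \<psi> (hd ys)) = \<psi> h - \<psi> (g \<otimes> h) + \<psi> g"
      unfolding gh(1) face_coeff_pair distrib_right left_diff_distrib sum.distrib sum_subtractf
      using in_T by simp
    moreover have "int p dvd \<psi> h - \<psi> (g \<otimes> h) + \<psi> g"
    proof -
      have e: "\<psi> h - \<psi> (g \<otimes> h) + \<psi> g = (\<psi> g + \<psi> h) - (\<psi> g + \<psi> h) mod int p"
        using homsD(5)[OF assms(1) gh(2,3)] by simp
      show ?thesis unfolding e by (rule dvd_minus_mod)
    qed
    ultimately show "int p dvd c xs * (\<Sum>ys\<in>?T. face_coeff (Suc 1) xs ys * \<psi> (hd ys))"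
      by (simp add: dvd_mult)
  qed
  then show ?thesis unfolding eval_hom by (rule dvd_imp_mod_0)
qed

definition single :: "'a \<Rightarrow> nat \<Rightarrow> 'a list \<Rightarrow> int" where
  "single g n = (\<lambda>xs. if xs = [g] then int n mod int p else 0)"

lemma single_closed: "g \<in> carrier G \<Longrightarrow> single g n \<in> carrier (chains 1)"
  using p_gt_1 by (auto simp: single_def chains_carrier_iff)

lemma single_add: "single g m \<oplus>\<^bsub>chains 1\<^esub> single g n = single g (m + n)"
  by (auto simp: chains_ops single_def mod_simps)

lemma eval_hom_single:
  assumes "\<psi> \<in> homs p G (carrier G)" shows "eval_hom \<psi> (single g 1) = \<psi> g"
  using eval_hom_eq[of "{[g]}" "single g 1" \<psi>] homsD(4)[OF assms] p_gt_1 by (auto simp: single_def)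

definition homology_class :: "'a \<Rightarrow> ('a list \<Rightarrow> int) set" where
  "homology_class g = boundaries +>\<^bsub>chains 1\<^esub> single g 1"

lemmas hom_ops = quotient_module_coset_ops[OF chains_module boundaries_subgroup boundaries_smult_ball]

text \<open>The boundary of [g, h] is the difference between [g] + [h] and [gh].\<close>

lemma homology_class_mult:
  assumes gh: "g \<in> carrier G" "h \<in> carrier G"
  shows "homology_class (g \<otimes> h) = homology_class g \<oplus>\<^bsub>group_homology p 1 G\<^esub> homology_class h"
proof -
  interpret M: module Fp "chains 1" by (rule chains_module)
  let ?c = "\<lambda>xs. if xs = [g, h] then 1 else (0::int)"
  have c: "?c \<in> carrier (chains (Suc 1))" using p_gt_1 gh by (auto simp: chains_carrier_iff)
  have b: "bar_boundary p G (Suc 1) ?c ys = (of_bool ([h] = ys) - of_bool ([g \<otimes> h] = ys) + of_bool ([g] = ys)) mod int p" for ys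
  proof -
    have "bar_boundary p G (Suc 1) ?c ys = (\<Sum>xs\<in>{[g, h]}. ?c xs * face_coeff (Suc 1) xs ys) mod int p"
      by (rule bar_boundary_eq) auto
    also have "\<dots> = face_coeff (Suc 1) [g, h] ys mod int p" by (simp del: One_nat_def)
    finally show ?thesis by (simp only: face_coeff_pair)
  qed
  have "single g 1 \<oplus>\<^bsub>chains 1\<^esub> single h 1 = bar_boundary p G (Suc 1) ?c \<oplus>\<^bsub>chains 1\<^esub> single (g \<otimes> h) 1"
    unfolding chains_ops b using p_gt_1 by (auto simp: single_def mod_simps fun_eq_iff)
  moreover have "bar_boundary p G (Suc 1) ?c \<in> boundaries" using c by (auto simp: boundaries_def)
  ultimately have "boundaries +>\<^bsub>chains 1\<^esub> (single g 1 \<oplus>\<^bsub>chains 1\<^esub> single h 1) =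
      boundaries +>\<^bsub>chains 1\<^esub> single (g \<otimes> h) 1"
    by (intro hom_ops(5)[THEN iffD2] M.a_closed single_closed gh m_closed) blast
  then show ?thesis
    unfolding homology_class_def group_homology_1 hom_ops(1)[OF single_closed[OF gh(1)] single_closed[OF gh(2)]]
    by (rule sym)
qed

lemma homology_class_closed: "g \<in> carrier G \<Longrightarrow> homology_class g \<in> carrier (group_homology p 1 G)"
  unfolding homology_class_def group_homology_1 hom_ops(3) by (rule imageI[OF single_closed])

lemma homology_vectorspace: "vectorspace Fp (group_homology p 1 G)"
  unfolding vectorspace_def group_homology_1
  using module_quotient_module[OF chains_module boundaries_subgroup boundaries_smult_ball] Fp_field by blast

lemma homology_class_one: "homology_class \<one> = \<zero>\<^bsub>group_homology p 1 G\<^esub>"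
proof -
  interpret V: vectorspace Fp "group_homology p 1 G" by (rule homology_vectorspace)
  have "homology_class \<one> \<oplus>\<^bsub>group_homology p 1 G\<^esub> homology_class \<one> = homology_class \<one>" using homology_class_mult[of \<one> \<one>] by simp
  then show ?thesis using homology_class_closed[of \<one>] by (metis V.module.M.add.l_cancel_one' one_closed)
qed

text \<open>Sums of classes of group elements are classes of products, so by induction on the
  support every 1-chain is homologous to a single group element.
  \<open>card_homs_vectorspace\<close> needs this surjectivity.\<close>

lemma coset_is_homology_class:
  assumes "c \<in> carrier (chains 1)"
  shows "\<exists>g\<in>carrier G. boundaries +>\<^bsub>chains 1\<^esub> c = homology_class g"
proof -
  interpret M: module Fp "chains 1" by (rule chains_module)
  define P where "P c \<longleftrightarrow> (\<exists>g\<in>carrier G. boundaries +>\<^bsub>chains 1\<^esub> c = homology_class g)" for c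
  have P0: "P \<zero>\<^bsub>chains 1\<^esub>"
    unfolding P_def using homology_class_one hom_ops(4) by (metis group_homology_1 one_closed)
  have Padd: "P (c \<oplus>\<^bsub>chains 1\<^esub> d)" if cd: "P c" "P d" "c \<in> carrier (chains 1)" "d \<in> carrier (chains 1)" for c d
  proof -
    obtain g h where "g \<in> carrier G" "boundaries +>\<^bsub>chains 1\<^esub> c = homology_class g" "h \<in> carrier G" "boundaries +>\<^bsub>chains 1\<^esub> d = homology_class h"
      using cd(1,2) unfolding P_def by blast
    then have "boundaries +>\<^bsub>chains 1\<^esub> (c \<oplus>\<^bsub>chains 1\<^esub> d) = homology_class (g \<otimes> h)"
      using homology_class_mult hom_ops(1)[OF cd(3,4)] by (simp add: group_homology_1 del: One_nat_def)
    then show ?thesis unfolding P_def using \<open>g \<in> carrier G\<close> \<open>h \<in> carrier G\<close> by blast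
  qed
  have Psing: "P (single g n)" if g: "g \<in> carrier G" for g n
  proof (induction n)
    case 0
    have "single g 0 = \<zero>\<^bsub>chains 1\<^esub>" by (simp add: single_def chains_ops fun_eq_iff)
    then show ?case using P0 by simp
  next
    case (Suc n)
    have "P (single g 1)" using g by (auto simp: P_def homology_class_def)
    then have "P (single g n \<oplus>\<^bsub>chains 1\<^esub> single g 1)"
      using Padd[OF Suc] single_closed[OF g] by blast
    then show ?case unfolding single_add by simp
  qed
  have "P c" if "finite S" "c \<in> carrier (chains 1)" "{xs. c xs \<noteq> 0} \<subseteq> S" for S c
    using that
  proof (induction S arbitrary: c rule: finite_induct)
    case empty
    then have "c = \<zero>\<^bsub>chains 1\<^esub>" by (auto simp: chains_ops)
    then show ?case using P0 by simp
  next
    case (insert xs S)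
    show ?case
    proof (cases "c xs = 0")
      case True
      then have "{ys. c ys \<noteq> 0} \<subseteq> S" using insert.prems(2) by auto
      then show ?thesis using insert.IH insert.prems(1) by blast
    next
      case False
      then have "length xs = 1" "set xs \<subseteq> carrier G" using chainsD(5,6)[OF insert.prems(1)] by auto
      then obtain g where g: "xs = [g]" "g \<in> carrier G" by (auto simp: length_Suc_conv)
      define d where "d = c(xs := 0)"
      have sd: "{ys. d ys \<noteq> 0} \<subseteq> S" "{ys. d ys \<noteq> 0} \<subseteq> {ys. c ys \<noteq> 0}"
        using insert.prems(2) by (auto simp: d_def)
      have dc: "d \<in> carrier (chains 1)"
        unfolding chains_carrier_iff
      proof (intro conjI allI impI)
        fix ys
        show "0 \<le> d ys" "d ys < int p" using chainsD(1,2)[OF insert.prems(1)] p_gt_1 by (auto simp: d_def)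
        assume "d ys \<noteq> 0"
        then have "c ys \<noteq> 0" using sd(2) by blast
        then show "length ys = 1" "set ys \<subseteq> carrier G" using chainsD(5,6)[OF insert.prems(1)] by blast+
      qed (use finite_subset[OF sd(2) chainsD(4)[OF insert.prems(1)]] in blast)
      have e: "c = d \<oplus>\<^bsub>chains 1\<^esub> single g (nat (c xs))"
        using chainsD(1,3)[OF insert.prems(1)] by (auto simp: chains_ops d_def single_def g(1))
      have "P (d \<oplus>\<^bsub>chains 1\<^esub> single g (nat (c xs)))"
        by (rule Padd[OF insert.IH[OF dc sd(1)] Psing[OF g(2)] dc single_closed[OF g(2)]])
      then show ?thesis unfolding e[symmetric] .
    qed
  qed
  from this[OF chainsD(4)[OF assms] assms subset_refl] show ?thesis by (simp add: P_def)
qed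

lemma homology_class_surj: "carrier (group_homology p 1 G) \<subseteq> homology_class ` carrier G"
  unfolding group_homology_1 hom_ops(3) using coset_is_homology_class by blast

lemma homs_factor:
  assumes "\<psi> \<in> homs p G (carrier G)" "g \<in> carrier G" "h \<in> carrier G" "homology_class g = homology_class h"
  shows "\<psi> g = \<psi> h"
proof -
  obtain b where b: "b \<in> boundaries" "single g 1 = b \<oplus>\<^bsub>chains 1\<^esub> single h 1"
    using hom_ops(5)[OF single_closed[OF assms(2)] single_closed[OF assms(3)]] assms(4)
    unfolding homology_class_def by blast
  have "eval_hom \<psi> (single g 1) = (eval_hom \<psi> b + eval_hom \<psi> (single h 1)) mod int p"
    unfolding b(2) using b(1) boundaries_subset by (intro eval_hom_add single_closed assms(3)) blast
  then show ?thesis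
    unfolding eval_hom_single[OF assms(1)] eval_hom_boundary[OF assms(1) b(1)] using homsD(4)[OF assms(1)] by simp
qed

lemma homology_fin_dim:
  assumes "finitely_generated G"
  shows "vectorspace.fin_dim Fp (group_homology p 1 G)"
proof -
  interpret V: vectorspace Fp "group_homology p 1 G" by (rule homology_vectorspace)
  obtain S where S: "finite S" "S \<subseteq> carrier G" "generate G S = carrier G"
    using assms by (auto simp: finitely_generated_def)
  let ?A = "homology_class ` (S \<union> (\<lambda>x. inv x) ` S)"
  have A: "?A \<subseteq> carrier (group_homology p 1 G)" using S(2) homology_class_closed by auto
  have sp: "LinearCombinations.submodule Fp (V.span ?A) (group_homology p 1 G)"
    by (rule V.span_is_submodule[OF A])
  have own: "?A \<subseteq> V.span ?A" by (rule V.in_own_span[OF A])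
  have "homology_class g \<in> V.span ?A" if "g \<in> generate G S" for g
    using that
  proof (induction rule: generate.induct)
    case one then show ?case using homology_class_one submodule.zero_closed[OF sp] by simp
  next
    case (incl h) then show ?case using own by blast
  next
    case (inv h) then show ?case using own by blast
  next
    case (eng h1 h2)
    then have "h1 \<in> carrier G" "h2 \<in> carrier G" using S(3) by auto
    then show ?case using homology_class_mult submodule.m_closed[OF sp eng.IH] by simp
  qed
  then have "carrier (group_homology p 1 G) \<subseteq> V.span ?A" using homology_class_surj S(3) by blast
  then have "V.gen_set ?A" using V.span_is_subset2[OF A] by blast
  then show ?thesis unfolding V.fin_dim_def using S(1) A by (intro exI[of _ ?A]) simp
qed

lemma card_homs_d_p:
  assumes "finitely_generated G"
  shows "finite (homs p G (carrier G))" "card (homs p G (carrier G)) = p ^ d_p p G"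
proof -
  note c = card_homs_vectorspace[OF homology_vectorspace homology_fin_dim[OF assms],
      OF homology_class_closed homology_class_surj homology_class_mult homs_factor]
  show "finite (homs p G (carrier G))" by (rule c)
  show "card (homs p G (carrier G)) = p ^ d_p p G" unfolding d_p_def by (rule c)
qed

end

section \<open>Ranks and subgroup counts\<close>

text \<open>Schreier's lemma: H is generated by the elements t s r(ts)^-1, where t runs over coset
  representatives, s over generators and their inverses, and r(g) is the representative of H
  g.\<close>

lemma (in group) finitely_generated_finite_index:
  assumes "finitely_generated G" "subgroup H G" "finite ((\<lambda>k. H #> k) ` carrier G)"
  shows "finitely_generated (G\<lparr>carrier := H\<rparr>)"
proof -
  obtain S where S: "finite S" "S \<subseteq> carrier G" "generate G S = carrier G"
    using assms(1) by (auto simp: finitely_generated_def)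
  let ?S = "S \<union> (\<lambda>s. inv s) ` S"
  have SC: "?S \<subseteq> carrier G" using S(2) by auto
  \<comment> \<open>The coset H itself is represented by the identity. Thus the rewriting in
    \<open>key\<close>, started at t = 1 with an element h of H, returns h itself.\<close>
  define rep where "rep X = (if X = H then \<one> else SOME x. x \<in> X)" for X
  define r where "r g = rep (H #> g)" for g
  have r: "r g \<in> carrier G \<and> H #> r g = H #> g" if g: "g \<in> carrier G" for g
  proof (cases "H #> g = H")
    case True
    then show ?thesis using coset_mult_one[OF subgroup.subset[OF assms(2)]] by (simp add: r_def rep_def)
  next
    case False
    have "r g \<in> H #> g"
      using False someI[of "\<lambda>x. x \<in> H #> g" g] rcos_self[OF g assms(2)] by (simp add: r_def rep_def)
    then obtain h where h: "h \<in> H" "r g = h \<otimes> g" by (auto simp: r_coset_def)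
    then have "r g \<in> carrier G" using sub_in[OF assms(2)] g by simp
    moreover have "r g \<otimes> inv g \<in> H" using h sub_in[OF assms(2)] g by (simp add: m_assoc)
    ultimately show ?thesis using coset_eq_iff[OF assms(2)] g by simp
  qed
  have r_cong: "r g = r g'" if "H #> g = H #> g'" for g g' using that by (simp add: r_def)
  have rr: "r (r g) = r g" if "g \<in> carrier G" for g using r[OF that] r_cong by blast
  have r1: "r h = \<one>" if "h \<in> H" for h
    using coset_eq_iff[OF assms(2), of h \<one>] that sub_in[OF assms(2) that] coset_mult_one[OF subgroup.subset[OF assms(2)]]
    by (simp add: r_def rep_def)
  have rH: "g \<otimes> inv (r g) \<in> H" if "g \<in> carrier G" for g
    using r[OF that] coset_eq_iff[OF assms(2) that, of "r g"] by simp
  define T where "T = r ` carrier G"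
  have "T = rep ` (\<lambda>k. H #> k) ` carrier G" by (simp add: T_def r_def image_image)
  then have finT: "finite T" using assms(3) by simp
  have TC: "T \<subseteq> carrier G" using r by (auto simp: T_def)
  define U where "U = (\<lambda>(t, s). t \<otimes> s \<otimes> inv (r (t \<otimes> s))) ` (T \<times> ?S)"
  have finU: "finite U" using finT S(1) by (simp add: U_def)
  have UH: "U \<subseteq> H"
  proof
    fix u assume "u \<in> U"
    then obtain t s where ts: "t \<in> T" "s \<in> ?S" "u = t \<otimes> s \<otimes> inv (r (t \<otimes> s))" by (auto simp: U_def)
    have "t \<otimes> s \<in> carrier G" using subsetD[OF TC ts(1)] subsetD[OF SC ts(2)] by simp
    then show "u \<in> H" using rH ts(3) by simp
  qed
  then have UC: "U \<subseteq> carrier G" using sub_in[OF assms(2)] by blast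
  have L: "subgroup (generate G U) G" by (rule generate_is_subgroup[OF UC])
  have LH: "generate G U \<subseteq> H" by (rule generate_subgroup_incl[OF UH assms(2)])
  have key: "t \<otimes> g \<otimes> inv (r (t \<otimes> g)) \<in> generate G U" if "g \<in> generate G S" "t \<in> T" for g t
    using that
  proof (induction arbitrary: t rule: generate.induct)
    case one
    then have "r t = t" "t \<in> carrier G" using rr TC by (auto simp: T_def)
    then show ?case using sub_one[OF L] by simp
  next
    case (incl h) then show ?case unfolding U_def by (intro generate.incl) auto
  next
    case (inv h) then show ?case unfolding U_def by (intro generate.incl) auto
  next
    case (eng g h)
    have c: "g \<in> carrier G" "h \<in> carrier G" "t \<in> carrier G" using eng S(3) TC by auto
    define t' where "t' = r (t \<otimes> g)"
    have t': "t' \<in> T" "t' \<in> carrier G" using c r by (auto simp: t'_def T_def)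
    have "H #> (t' \<otimes> h) = H #> t' #> h"
      by (rule coset_mult_assoc[symmetric, OF subgroup.subset[OF assms(2)] t'(2) c(2)])
    also have "\<dots> = H #> (t \<otimes> g) #> h" using r[of "t \<otimes> g"] c by (simp add: t'_def)
    also have "\<dots> = H #> (t \<otimes> g \<otimes> h)"
      by (rule coset_mult_assoc[OF subgroup.subset[OF assms(2)]]) (use c in auto)
    also have "t \<otimes> g \<otimes> h = t \<otimes> (g \<otimes> h)" using c by (simp add: m_assoc)
    finally have e: "r (t' \<otimes> h) = r (t \<otimes> (g \<otimes> h))" by (rule r_cong)
    have rc: "r (t \<otimes> (g \<otimes> h)) \<in> carrier G" using r c by simp
    have "(t \<otimes> g \<otimes> inv t') \<otimes> (t' \<otimes> h \<otimes> inv (r (t' \<otimes> h))) \<in> generate G U"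
      using generate.eng[OF eng.IH(1)[OF eng.prems] eng.IH(2)[OF t'(1)]] by (simp add: t'_def)
    moreover have "(t \<otimes> g \<otimes> inv t') \<otimes> (t' \<otimes> h \<otimes> inv (r (t' \<otimes> h))) = t \<otimes> (g \<otimes> h) \<otimes> inv (r (t \<otimes> (g \<otimes> h)))"
      unfolding e using c t'(2) rc by (simp add: m_assoc)
    ultimately show ?case by simp
  qed
  have "H \<subseteq> generate G U"
  proof
    fix h assume h: "h \<in> H"
    have "\<one> \<in> T" using r1[OF sub_one[OF assms(2)]] one_closed unfolding T_def by (metis image_eqI)
    then have "\<one> \<otimes> h \<otimes> inv (r (\<one> \<otimes> h)) \<in> generate G U"
      using key[of h \<one>] sub_in[OF assms(2) h] S(3) by blast
    then show "h \<in> generate G U" using r1[OF h] sub_in[OF assms(2) h] by simp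
  qed
  then have "generate (G\<lparr>carrier := H\<rparr>) U = H"
    using LH generate_consistent[OF UH assms(2)] by simp
  then show ?thesis unfolding finitely_generated_def using finU UH by (intro exI[of _ U]) simp
qed

text \<open>The parent hypothesis provides descending paths of every finite length; since the levels
  are finite, one can always continue with a node from which arbitrarily long paths start.\<close>

lemma koenig:
  fixes X :: "nat \<Rightarrow> 'b set" and R :: "nat \<Rightarrow> 'b \<Rightarrow> 'b \<Rightarrow> bool"
  assumes "\<And>n. finite (X n)" "\<And>n. X n \<noteq> {}"
    and parent: "\<And>n y. y \<in> X (Suc n) \<Longrightarrow> \<exists>x\<in>X n. R n x y"
  shows "\<exists>f. \<forall>n. f n \<in> X n \<and> R n (f n) (f (Suc n))"
proof -
  \<comment> \<open>\<open>D k n x\<close> says that a path with k steps starts at the node x of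
    level n.\<close>
  define D where "D = rec_nat (\<lambda>n x. True) (\<lambda>k P n x. \<exists>z\<in>X (Suc n). R n x z \<and> P (Suc n) z)"
  have D0: "D 0 n x" and DS: "D (Suc k) n x \<longleftrightarrow> (\<exists>z\<in>X (Suc n). R n x z \<and> D k (Suc n) z)" for k n x
    by (simp_all add: D_def)
  have anti: "D k n x" if "D (Suc k) n x" for k n x
    using that by (induction k arbitrary: n x) (use D0 DS in blast)+
  have anti': "D j n x" if "D k n x" "j \<le> k" for j k n x
    using that(2,1) by (induction rule: inc_induct) (use anti in blast)+
  have ex: "\<exists>x\<in>X n. D k n x" for k n
  proof (induction k arbitrary: n)
    case 0 then show ?case using D0 assms(2)[of n] by blast
  next
    case (Suc k)
    then obtain z where z: "z \<in> X (Suc n)" "D k (Suc n) z" by blast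
    then show ?case using parent[OF z(1)] DS by blast
  qed
  have compact: "\<exists>z\<in>Z. \<forall>k. D k n z" if Z: "finite Z" "\<And>k. \<exists>z\<in>Z. D k n z" for Z n
  proof (rule ccontr)
    assume "\<not> ?thesis"
    then obtain \<kappa> where \<kappa>: "\<And>z. z \<in> Z \<Longrightarrow> \<not> D (\<kappa> z) n z" by metis
    obtain z where z: "z \<in> Z" "D (Max (\<kappa> ` Z)) n z" using Z(2) by blast
    have "\<kappa> z \<le> Max (\<kappa> ` Z)" using Z(1) z(1) by simp
    then show False using anti'[OF z(2)] \<kappa>[OF z(1)] by blast
  qed
  have "\<exists>f. \<forall>n. (f n \<in> X n \<and> (\<forall>k. D k n (f n))) \<and> R n (f n) (f (Suc n))"
  proof (rule dependent_nat_choice)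
    show "\<exists>x. x \<in> X 0 \<and> (\<forall>k. D k 0 x)" using compact[OF assms(1)[of 0], of 0] ex[of 0] by blast
  next
    fix x n assume x: "x \<in> X n \<and> (\<forall>k. D k n x)"
    have "\<exists>z\<in>{z \<in> X (Suc n). R n x z}. D k (Suc n) z" for k using x DS[of k n x] by blast
    then show "\<exists>y. (y \<in> X (Suc n) \<and> (\<forall>k. D k (Suc n) y)) \<and> R n x y"
      using compact[of "{z \<in> X (Suc n). R n x z}" "Suc n"] assms(1)[of "Suc n"] by auto
  qed
  then show ?thesis by blast
qed

section \<open>Ranks and numbers of subgroups, level by level\<close>

context group_prime
begin

definition rk :: "'a set \<Rightarrow> nat" where "rk K = d_p p (G\<lparr>carrier := K\<rparr>)"

definition open_of_index :: "nat \<Rightarrow> 'a set set" where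
  "open_of_index n = {K. p_open p G K \<and> idx G (carrier G) K = p ^ n}"

lemma group_prime_subgroup: "subgroup K G \<Longrightarrow> group_prime (G\<lparr>carrier := K\<rparr>) p"
  by (simp add: group_prime_def group_prime_axioms_def subgroup_imp_group prime_p)

lemma p_open_finitely_generated:
  "finitely_generated G \<Longrightarrow> p_open p G K \<Longrightarrow> finitely_generated (G\<lparr>carrier := K\<rparr>)"
  by (rule finitely_generated_finite_index[OF _ p_open_subgroup pidx_finite[OF p_open_pidx]])

lemma card_homs_rk:
  assumes "finitely_generated G" "p_open p G K"
  shows "finite (homs p G K)" "card (homs p G K) = p ^ rk K"
proof -
  interpret K: group_prime "G\<lparr>carrier := K\<rparr>" p
    by (rule group_prime_subgroup[OF p_open_subgroup[OF assms(2)]])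
  have "homs p (G\<lparr>carrier := K\<rparr>) K = homs p G K" by (simp add: homs_def)
  then show "finite (homs p G K)" "card (homs p G K) = p ^ rk K"
    using K.card_homs_d_p[OF p_open_finitely_generated[OF assms]] by (simp_all add: rk_def)
qed

lemma index_p_normals_p_open:
  assumes "p_open p G K" "H \<in> index_p_normals K"
  shows "p_open p G H"
proof (rule p_open_nsub[OF assms(1)])
  show "nsub G H K" using assms(2) by (simp add: index_p_normals_def)
  show "pidx K H" using assms(2) by (auto simp: index_p_normals_def pidx_def intro: exI[of _ 1])
qed

lemma index_p_normals_idx:
  assumes "H \<in> index_p_normals K"
  shows "idx G (carrier G) H = idx G (carrier G) K * p"
proof -
  have n: "nsub G H K" "idx G K H = p" using assms by (auto simp: index_p_normals_def)
  note s = nsubD[OF n(1)]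
  show ?thesis
    using idx_tower[OF s(1,2) subgroup_self s(3) subgroup.subset[OF s(2)]] n(2) by simp
qed

text \<open>The levels of a tree-like structure: \<open>p_open_parent\<close> gives one inclusion
  and \<open>p_open_nsub\<close> the other.\<close>

lemma open_of_index_Suc: "open_of_index (Suc n) = (\<Union>K\<in>open_of_index n. index_p_normals K)"
proof (intro equalityI subsetI)
  fix H assume "H \<in> open_of_index (Suc n)"
  then have H: "p_open p G H" "idx G (carrier G) H = p ^ Suc n" by (auto simp: open_of_index_def)
  have "H \<noteq> carrier G" using H(2) idx_carrier_self p_gt_1 by auto
  from p_open_parent[OF H(1) this] obtain K where K: "p_open p G K" "nsub G H K" "idx G K H = p" .
  then have m: "H \<in> index_p_normals K" by (simp add: index_p_normals_def)
  then have "K \<in> open_of_index n" using index_p_normals_idx[OF m] H(2) K(1) p_gt_1 by (simp add: open_of_index_def)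
  then show "H \<in> (\<Union>K\<in>open_of_index n. index_p_normals K)" using m by blast
next
  fix H assume "H \<in> (\<Union>K\<in>open_of_index n. index_p_normals K)"
  then obtain K where K: "K \<in> open_of_index n" "H \<in> index_p_normals K" by blast
  then show "H \<in> open_of_index (Suc n)" using index_p_normals_p_open[OF _ K(2)] K(1) index_p_normals_idx[OF K(2)] by (simp add: open_of_index_def mult.commute)
qed

lemma open_of_index_0: "open_of_index 0 = {carrier G}"
proof -
  have "K = carrier G" if "p_open p G K" "idx G (carrier G) K = 1" for K
    using idx_1_eq[OF p_open_subgroup[OF that(1)] subgroup_self subgroup.subset[OF p_open_subgroup[OF that(1)]] that(2)] .
  then show ?thesis using p_open_carrier idx_carrier_self by (auto simp: open_of_index_def)
qed

lemma finite_open_of_index: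
  assumes "finitely_generated G" shows "finite (open_of_index n)"
proof (induction n)
  case (Suc n)
  have "finite (index_p_normals K)" if "K \<in> open_of_index n" for K
    using index_p_normals_upper(1)[OF card_homs_rk(1)[OF assms]] that by (simp add: open_of_index_def)
  then show ?case unfolding open_of_index_Suc using Suc by blast
qed (simp add: open_of_index_0)

lemma card_open_of_index_Suc_le:
  assumes "finitely_generated G" "\<And>K. K \<in> open_of_index n \<Longrightarrow> rk K \<le> D"
  shows "card (open_of_index (Suc n)) \<le> card (open_of_index n) * p ^ D"
proof -
  have "card (open_of_index (Suc n)) \<le> (\<Sum>K\<in>open_of_index n. card (index_p_normals K))"
    unfolding open_of_index_Suc by (rule card_UN_le[OF finite_open_of_index[OF assms(1)]])
  also have "\<dots> \<le> (\<Sum>K\<in>open_of_index n. p ^ D)"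
  proof (rule sum_mono)
    fix K assume K: "K \<in> open_of_index n"
    then have o: "p_open p G K" by (simp add: open_of_index_def)
    have "card (index_p_normals K) \<le> p ^ rk K" using index_p_normals_upper(2) card_homs_rk[OF assms(1) o] by metis
    also have "\<dots> \<le> p ^ D" using assms(2)[OF K] p_gt_1 by (simp add: power_increasing)
    finally show "card (index_p_normals K) \<le> p ^ D" .
  qed
  finally show ?thesis by simp
qed

lemma card_open_of_index_Suc_ge:
  assumes "finitely_generated G" "K \<in> open_of_index n" "rk K = Suc d"
  shows "p ^ d \<le> card (open_of_index (Suc n))"
proof -
  have o: "p_open p G K" using assms(2) by (simp add: open_of_index_def)
  have "p ^ d \<le> card (index_p_normals K)"
    using index_p_normals_lower[OF p_open_subgroup[OF o]] card_homs_rk[OF assms(1) o] assms(3) by simp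
  also have "\<dots> \<le> card (open_of_index (Suc n))"
    by (rule card_mono[OF finite_open_of_index[OF assms(1)]]) (use assms(2) in \<open>auto simp: open_of_index_Suc\<close>)
  finally show ?thesis .
qed

text \<open>The base-p logarithm of \<open>card_homs_nsub\<close>, which bounds the number of
  homomorphisms on H by p (p^(rk K - 1))^p. For free groups equality holds by Schreier's formula.
  Stated over the reals, the subtraction is not truncated.\<close>

lemma rk_step:
  assumes "finitely_generated G" "p_open p G K" "H \<in> index_p_normals K"
  shows "real (rk H) - 1 \<le> real p * (real (rk K) - 1)"
proof -
  have n: "nsub G H K" "idx G K H = p" using assms(3) by (auto simp: index_p_normals_def)
  note k = card_homs_rk[OF assms(1,2)]
  have "p ^ rk K \<ge> 2" using homs_nonempty_of_max[OF assms(3) k(1)] k(2) by simp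
  then obtain d where d: "rk K = Suc d" by (cases "rk K") auto
  have "p ^ rk H \<le> p * (p ^ rk K div p) ^ p"
    using card_homs_nsub(2)[OF n k(1)] k(2) card_homs_rk(2)[OF assms(1) index_p_normals_p_open[OF assms(2,3)]] by simp
  also have "\<dots> = p ^ Suc (d * p)" using p_gt_1 d by (simp add: power_mult)
  finally have "rk H \<le> Suc (d * p)" using p_gt_1 power_increasing_iff by blast
  then have "real (rk H) \<le> 1 + real d * real p" by (metis of_nat_Suc of_nat_le_iff of_nat_mult)
  then show ?thesis using d by (simp add: mult.commute)
qed

text \<open>The shift by 1 fits both \<open>rk_step\<close>, which multiplies rank minus 1 by at
  most p, and the lower bound p^(rank - 1) for the number of normal subgroups of index p.\<close>

definition large :: "nat \<Rightarrow> real \<Rightarrow> bool" where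
  "large n c \<longleftrightarrow> (\<exists>K\<in>open_of_index n. c * real p ^ n \<le> real (rk K) - 1)"

lemma large_Suc:
  assumes "finitely_generated G" "H \<in> open_of_index (Suc n)" "c * real p ^ Suc n \<le> real (rk H) - 1"
  obtains K where "K \<in> open_of_index n" "H \<subseteq> K" "c * real p ^ n \<le> real (rk K) - 1"
proof -
  obtain K where K: "K \<in> open_of_index n" "H \<in> index_p_normals K" using assms(2) by (auto simp: open_of_index_Suc)
  have o: "p_open p G K" using K(1) by (simp add: open_of_index_def)
  have "real p * (c * real p ^ n) \<le> real p * (real (rk K) - 1)"
    using rk_step[OF assms(1) o K(2)] assms(3) by (simp add: mult_ac)
  then have "c * real p ^ n \<le> real (rk K) - 1" using p_gt_1 by simp
  moreover have "H \<subseteq> K" using K(2) by (simp add: index_p_normals_def nsub_def)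
  ultimately show thesis using that K(1) by blast
qed

text \<open>Largeness passes to all levels above. This turns information about infinitely many
  levels into information about every level.\<close>

lemma large_mono:
  assumes "finitely_generated G" "large m c" "n \<le> m"
  shows "large n c"
  using assms(3,2)
proof (induction rule: inc_induct)
  case (step n)
  then obtain H where "H \<in> open_of_index (Suc n)" "c * real p ^ Suc n \<le> real (rk H) - 1" by (auto simp: large_def)
  from large_Suc[OF assms(1) this] show ?case unfolding large_def by blast
qed

lemma open_of_index_alt: "{H. finite_index G H \<and> subnormal G H \<and> index G H = p ^ n} = open_of_index n"
proof -
  have "finite_index G H" if "p_open p G H" for H
    using p_open_subgroup[OF that] pidx_finite[OF p_open_pidx[OF that]]
    by (simp add: finite_index_def RCOSETS_def UNION_singleton_eq_range)
  then show ?thesis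
    using p_open_iff_subnormal by (auto simp: open_of_index_def index_idx pidx_def)
qed

lemma subnormal_count_open_of_index: "subnormal_count (p ^ n) G = card (open_of_index n)"
  unfolding subnormal_count_def open_of_index_alt ..

definition logratio :: "nat \<Rightarrow> ereal" where
  "logratio n = log_count (card (open_of_index n)) / ereal (real (p ^ n))"

lemma real_p_pow_ge: "real n \<le> real p ^ n" "1 \<le> real p ^ n"
proof -
  have "n < 2 ^ n" by (rule less_exp)
  also have "\<dots> \<le> p ^ n" using p_gt_1 by (simp add: power_mono)
  finally show "real n \<le> real p ^ n" by (metis less_imp_le of_nat_le_iff of_nat_power)
  show "1 \<le> real p ^ n" using p_gt_1 by simp
qed

text \<open>A large subgroup at level n has at least p^(c p^n) normal subgroups of index p, all
  lying at level n + 1. Dividing the logarithm by p^(n+1) gives the constant c ln p / p.\<close>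

lemma logratio_ge:
  assumes "finitely_generated G" "0 < c" "large n c"
  shows "ereal (c * ln (real p) / real p) \<le> logratio (Suc n)"
proof -
  obtain K where K: "K \<in> open_of_index n" "c * real p ^ n \<le> real (rk K) - 1" using assms(3) by (auto simp: large_def)
  have "0 < c * real p ^ n" using assms(2) p_gt_1 by simp
  then have "rk K \<ge> 1" using K(2) by simp
  then obtain d where d: "rk K = Suc d" by (cases "rk K") auto
  then have cd: "c * real p ^ n \<le> real d" using K(2) by simp
  let ?a = "card (open_of_index (Suc n))"
  have a: "p ^ d \<le> ?a" by (rule card_open_of_index_Suc_ge[OF assms(1) K(1) d])
  have pd: "0 < p ^ d" using p_gt_1 by simp
  then have a0: "0 < ?a" using a by linarith
  have "c * real p ^ n * ln (real p) \<le> real d * ln (real p)"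
    using cd p_gt_1 by (intro mult_right_mono) auto
  also have "\<dots> = ln (real (p ^ d))" using p_gt_1 by (simp add: ln_realpow)
  also have "\<dots> \<le> ln (real ?a)" using a a0 pd by (simp only: ln_le_cancel_iff of_nat_0_less_iff of_nat_le_iff)
  finally have "c * real p ^ n * ln (real p) / real (p ^ Suc n) \<le> ln (real ?a) / real (p ^ Suc n)"
    by (rule divide_right_mono) simp
  moreover have "c * real p ^ n * ln (real p) / real (p ^ Suc n) = c * ln (real p) / real p"
    using p_gt_1 by simp
  ultimately show ?thesis using a0 p_gt_1 by (simp add: logratio_def log_count_def)
qed

text \<open>Level 0 consists of G alone and has ratio 0; every other level has a predecessor, to
  which \<open>logratio_ge\<close> applies.\<close>

lemma inf_logratio_pos:
  assumes "finitely_generated G" "0 < c" "\<And>n. large n c"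
  shows "(INF n\<in>{1..}. logratio n) > 0"
proof -
  have "ereal (c * ln (real p) / real p) \<le> (INF n\<in>{1..}. logratio n)"
  proof (rule INF_greatest)
    fix n :: nat assume "n \<in> {1..}"
    then obtain m where "n = Suc m" by (cases n) auto
    then show "ereal (c * ln (real p) / real p) \<le> logratio n" using logratio_ge[OF assms(1,2) assms(3)] by simp
  qed
  moreover have "0 < ereal (c * ln (real p) / real p)" using assms(2) p_gt_1 by simp
  ultimately show ?thesis by (rule order_less_le_trans[rotated])
qed

lemma limsup_logratio_pos:
  assumes "(INF n\<in>{1..}. logratio n) > 0"
  shows "limsup logratio > 0"
proof -
  have "(INF n\<in>{1..}. logratio n) \<le> liminf logratio"
    by (rule Liminf_bounded) (auto simp: eventually_at_top_linorder intro!: exI[of _ 1] INF_lower)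
  also have "\<dots> \<le> limsup logratio" by (rule Liminf_le_Limsup) simp
  finally show ?thesis using assms by (rule order_less_le_trans[rotated])
qed

text \<open>From level N on all ranks are at most 1 + c p^n, so a step multiplies the count by at
  most p^(1 + c p^n). The exponents are summed by c p^n + c p^n \<le> c p^(n+1), as p \<ge> 2. The
  summand 1 in the first factor keeps the constant at least 1.\<close>

lemma card_open_of_index_growth:
  assumes "finitely_generated G" "0 < c" "\<not> large N c"
  shows "real (card (open_of_index (N + k))) \<le> (1 + real (card (open_of_index N))) * exp (ln (real p) * (real k + c * real p ^ (N + k)))"
proof (induction k)
  case 0
  have "1 \<le> exp (ln (real p) * (c * real p ^ N))" using assms(2) p_gt_1 by simp
  then have "real (card (open_of_index N)) * 1 \<le> (1 + real (card (open_of_index N))) * exp (ln (real p) * (c * real p ^ N))"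
    by (intro mult_mono) auto
  then show ?case by simp
next
  case (Suc k)
  let ?n = "N + k"
  define D where "D = nat \<lfloor>1 + c * real p ^ ?n\<rfloor>"
  have pos: "0 \<le> 1 + c * real p ^ ?n" using assms(2) by simp
  have "\<not> large ?n c" using large_mono[OF assms(1), of ?n c N] assms(3) by auto
  then have "real (rk K) \<le> 1 + c * real p ^ ?n" if "K \<in> open_of_index ?n" for K
    using that by (force simp: large_def)
  then have "rk K \<le> D" if "K \<in> open_of_index ?n" for K
    using that unfolding D_def by (metis le_nat_floor)
  then have "card (open_of_index (Suc ?n)) \<le> card (open_of_index ?n) * p ^ D" by (rule card_open_of_index_Suc_le[OF assms(1)])
  then have *: "real (card (open_of_index (Suc ?n))) \<le> real (card (open_of_index ?n)) * real p ^ D"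
    by (metis of_nat_le_iff of_nat_mult of_nat_power)
  have "real p ^ D = exp (ln (real p) * real D)"
    using p_gt_1 by (simp add: exp_of_nat2_mult)
  moreover have "real D \<le> 1 + c * real p ^ ?n" unfolding D_def by (rule of_nat_floor[OF pos])
  ultimately have "real p ^ D \<le> exp (ln (real p) * (1 + c * real p ^ ?n))"
    using p_gt_1 by (simp add: mult_left_mono)
  then have "real (card (open_of_index ?n)) * real p ^ D \<le> real (card (open_of_index ?n)) * exp (ln (real p) * (1 + c * real p ^ ?n))"
    by (rule mult_left_mono) simp
  with * have "real (card (open_of_index (Suc ?n))) \<le> real (card (open_of_index ?n)) * exp (ln (real p) * (1 + c * real p ^ ?n))"
    by (rule order_trans)
  also have "real (card (open_of_index ?n)) * exp (ln (real p) * (1 + c * real p ^ ?n)) \<le>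
      (1 + real (card (open_of_index N))) * exp (ln (real p) * (real k + c * real p ^ ?n)) * exp (ln (real p) * (1 + c * real p ^ ?n))"
    by (rule mult_right_mono[OF Suc]) simp
  also have "\<dots> = (1 + real (card (open_of_index N))) * exp (ln (real p) * (real (Suc k) + c * (2 * real p ^ ?n)))"
    by (simp add: mult.assoc ring_distribs flip: exp_add) (simp add: algebra_simps)
  also have "\<dots> \<le> (1 + real (card (open_of_index N))) * exp (ln (real p) * (real (Suc k) + c * real p ^ (N + Suc k)))"
  proof -
    have "2 * real p ^ ?n \<le> real p ^ (N + Suc k)" using p_gt_1 by simp
    then have "c * (2 * real p ^ ?n) \<le> c * real p ^ (N + Suc k)" using assms(2) by (intro mult_left_mono) auto
    then have "ln (real p) * (real (Suc k) + c * (2 * real p ^ ?n)) \<le> ln (real p) * (real (Suc k) + c * real p ^ (N + Suc k))"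
      using p_gt_1 by (intro mult_left_mono) auto
    then show ?thesis by (intro mult_left_mono) auto
  qed
  finally show ?case by simp
qed

section \<open>Numbers of subgroups of index at most n\<close>

definition open_count :: "nat \<Rightarrow> nat" where
  "open_count n = card {K. p_open p G K \<and> idx G (carrier G) K \<le> n}"

lemma open_of_index_le: "{K. p_open p G K \<and> idx G (carrier G) K \<le> n} = (\<Union>k\<in>{k. p ^ k \<le> n}. open_of_index k)"
  using p_open_pidx by (fastforce simp: open_of_index_def pidx_def)

lemma pow_le_subset: "{k. p ^ k \<le> n} \<subseteq> {..n}"
proof
  fix k assume "k \<in> {k. p ^ k \<le> n}"
  moreover have "k < p ^ k" using p_gt_1 by (simp add: power_gt_expt)
  ultimately show "k \<in> {..n}" by simp
qed

lemma finite_open_of_index_le: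
  assumes "finitely_generated G"
  shows "finite {K. p_open p G K \<and> idx G (carrier G) K \<le> n}"
  unfolding open_of_index_le using finite_subset[OF pow_le_subset] finite_open_of_index[OF assms] by blast

lemma card_open_of_index_subexp:
  assumes "finitely_generated G" "\<And>c. c > 0 \<Longrightarrow> \<exists>n. \<not> large n c" "\<epsilon> > 0"
  obtains C where "C \<ge> 1" "\<And>k. real (card (open_of_index k)) \<le> C * exp (\<epsilon> * real p ^ k)"
proof -
  define l where "l = ln (real p)"
  have l: "l > 0" using p_gt_1 by (simp add: l_def)
  \<comment> \<open>This c turns the term c p^m of the growth bound into half of \<epsilon> p^m; the
    other half absorbs the linear term l m, up to the constant l M.\<close>
  define c where "c = \<epsilon> / (2 * l)"
  have c: "c > 0" using assms(3) l by (simp add: c_def)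
  from assms(2)[OF c] obtain N where N: "\<not> large N c" by blast
  have "(\<lambda>m. l * real m / 2 ^ m) \<longlonglongrightarrow> 0" by real_asymp
  then have "eventually (\<lambda>m. l * real m / 2 ^ m < \<epsilon> / 2) sequentially"
    using assms(3) by (intro order_tendstoD(2)) auto
  then obtain M where M: "\<And>m. m \<ge> M \<Longrightarrow> l * real m / 2 ^ m < \<epsilon> / 2"
    by (auto simp: eventually_sequentially)
  have lm: "l * real m \<le> l * real M + \<epsilon> / 2 * real p ^ m" for m
  proof (cases "m \<ge> M")
    case True
    have "l * real m \<le> \<epsilon> / 2 * 2 ^ m" using M[OF True] by (simp add: field_simps)
    also have "\<dots> \<le> \<epsilon> / 2 * real p ^ m" using p_gt_1 assms(3) by (intro mult_left_mono power_mono) auto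
    also have "\<dots> \<le> l * real M + \<epsilon> / 2 * real p ^ m" using l by simp
    finally show ?thesis .
  next
    case False
    have "0 \<le> \<epsilon> / 2 * real p ^ m" using assms(3) by simp
    moreover have "l * real m \<le> l * real M" using False l by simp
    ultimately show ?thesis by linarith
  qed
  define A where "A = (1 + real (card (open_of_index N))) * exp (l * real M)"
  \<comment> \<open>A serves the levels from N on; the sum covers the finitely many levels below
    N.\<close>
  define C where "C = A + (\<Sum>j<N. real (card (open_of_index j)))"
  have "1 \<le> exp (l * real M)" using l by simp
  then have "1 * 1 \<le> A" unfolding A_def by (intro mult_mono) auto
  moreover have S: "0 \<le> (\<Sum>j<N. real (card (open_of_index j)))" by (intro sum_nonneg) simp
  ultimately have C1: "C \<ge> 1" "A \<le> C" by (simp_all add: C_def)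
  have "real (card (open_of_index m)) \<le> C * exp (\<epsilon> * real p ^ m)" for m
  proof (cases "m \<ge> N")
    case True
    then obtain k where k: "m = N + k" using le_iff_add by blast
    have "real k \<le> real m" using k by simp
    then have "l * (real k + c * real p ^ m) \<le> l * real m + \<epsilon> / 2 * real p ^ m"
      using l by (simp add: c_def field_simps)
    also have "\<dots> \<le> l * real M + \<epsilon> * real p ^ m" using lm[of m] by simp
    finally have e: "exp (l * (real k + c * real p ^ m)) \<le> exp (l * real M) * exp (\<epsilon> * real p ^ m)"
      by (simp flip: exp_add)
    have "real (card (open_of_index m)) \<le> (1 + real (card (open_of_index N))) * exp (l * (real k + c * real p ^ m))"
      using card_open_of_index_growth[OF assms(1) c N, of k] by (simp add: k l_def)
    also have "\<dots> \<le> (1 + real (card (open_of_index N))) * (exp (l * real M) * exp (\<epsilon> * real p ^ m))"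
      by (rule mult_left_mono[OF e]) simp
    also have "\<dots> = A * exp (\<epsilon> * real p ^ m)" by (simp add: A_def)
    also have "\<dots> \<le> C * exp (\<epsilon> * real p ^ m)" using C1(2) by simp
    finally show ?thesis .
  next
    case False
    then have "real (card (open_of_index m)) \<le> (\<Sum>j<N. real (card (open_of_index j)))" by (intro member_le_sum) auto
    also have "\<dots> \<le> C" using \<open>1 * 1 \<le> A\<close> by (simp add: C_def)
    also have "\<dots> = C * 1" by simp
    also have "\<dots> \<le> C * exp (\<epsilon> * real p ^ m)" using C1(1) assms(3) by (intro mult_left_mono) auto
    finally show ?thesis .
  qed
  then show thesis using that C1(1) by blast
qed

lemma limsup_open_count_imp_large:
  assumes "finitely_generated G" "limsup (\<lambda>n. log_count (open_count n) / ereal (real n)) > 0"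
  shows "\<exists>c>0. \<forall>n. large n c"
proof (rule ccontr)
  assume no: "\<not> ?thesis"
  let ?L = "\<lambda>n. log_count (open_count n) / ereal (real n)"
  obtain \<epsilon> where \<epsilon>: "0 < ereal \<epsilon>" "ereal \<epsilon> < limsup ?L" using ereal_dense2[OF assms(2)] by blast
  \<comment> \<open>Half of \<epsilon> bounds the count at each level; the other half absorbs the
    constant C and the at most n + 1 levels that contribute to index at most n.\<close>
  define e where "e = \<epsilon> / 2"
  have e: "e > 0" using \<epsilon>(1) by (simp add: e_def)
  obtain C where C: "C \<ge> 1" "\<And>k. real (card (open_of_index k)) \<le> C * exp (e * real p ^ k)"
    using card_open_of_index_subexp[OF assms(1) _ e] no by blast
  have "(\<lambda>n. (real n + 1) * C / exp (e * real n)) \<longlonglongrightarrow> 0" using e by real_asymp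
  then have "eventually (\<lambda>n. (real n + 1) * C / exp (e * real n) < 1) sequentially"
    by (intro order_tendstoD(2)) auto
  then have "eventually (\<lambda>n. ?L n \<le> ereal \<epsilon>) sequentially"
    using eventually_gt_at_top[of 0]
  proof eventually_elim
    case (elim n)
    have "real (open_count n) \<le> (\<Sum>k\<in>{k. p ^ k \<le> n}. real (card (open_of_index k)))"
      unfolding open_count_def open_of_index_le using card_UN_le[OF finite_subset[OF pow_le_subset]]
      by (metis finite_atMost of_nat_le_iff of_nat_sum)
    also have "\<dots> \<le> (\<Sum>k\<in>{k. p ^ k \<le> n}. C * exp (e * real n))"
    proof (rule sum_mono)
      fix k assume "k \<in> {k. p ^ k \<le> n}"
      then have "real p ^ k \<le> real n" by (metis mem_Collect_eq of_nat_le_iff of_nat_power)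
      then have "C * exp (e * real p ^ k) \<le> C * exp (e * real n)" using e C(1) by simp
      then show "real (card (open_of_index k)) \<le> C * exp (e * real n)" using C(2)[of k] by linarith
    qed
    also have "\<dots> = real (card {k. p ^ k \<le> n}) * (C * exp (e * real n))" by simp
    also have "\<dots> \<le> (real n + 1) * (C * exp (e * real n))"
    proof (rule mult_right_mono)
      have "card {k. p ^ k \<le> n} \<le> card {..n}" by (rule card_mono[OF finite_atMost pow_le_subset])
      then show "real (card {k. p ^ k \<le> n}) \<le> real n + 1" by simp
    qed (use C(1) in simp)
    also have "\<dots> \<le> exp (e * real n) * exp (e * real n)"
    proof -
      have "(real n + 1) * C \<le> exp (e * real n)" using elim(1) by (simp add: divide_simps)
      from mult_right_mono[OF this, of "exp (e * real n)"] show ?thesis by (simp add: mult.assoc)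
    qed
    also have "\<dots> = exp (\<epsilon> * real n)" by (simp add: e_def flip: exp_add)
    finally have le: "real (open_count n) \<le> exp (\<epsilon> * real n)" .
    show ?case
    proof (cases "open_count n = 0")
      case True then show ?thesis using elim(2) by (simp add: log_count_def)
    next
      case False
      then have "ln (real (open_count n)) \<le> \<epsilon> * real n" using le by (metis ln_exp ln_le_cancel_iff exp_gt_zero of_nat_0_less_iff gr0I)
      then show ?thesis using False elim(2) by (simp add: log_count_def field_simps)
    qed
  qed
  then have "limsup ?L \<le> ereal \<epsilon>" by (rule Limsup_bounded)
  then show False using \<epsilon>(2) by simp
qed

text \<open>Compare along the subsequence of powers of p: a subgroup of index exactly p^n is among
  those of index at most p^n.\<close>

lemma limsup_logratio_imp_open_count:
  assumes "finitely_generated G" "limsup logratio > 0"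
  shows "limsup (\<lambda>n. log_count (open_count n) / ereal (real n)) > 0"
proof -
  let ?L = "\<lambda>n. log_count (open_count n) / ereal (real n)"
  have sm: "strict_mono (\<lambda>n. p ^ n)" using p_gt_1 by (simp add: strict_mono_Suc_iff)
  have "logratio n \<le> (?L \<circ> (\<lambda>n. p ^ n)) n" for n
  proof -
    have "card (open_of_index n) \<le> open_count (p ^ n)"
      unfolding open_count_def by (rule card_mono[OF finite_open_of_index_le[OF assms(1)]]) (auto simp: open_of_index_def)
    then have "log_count (card (open_of_index n)) \<le> log_count (open_count (p ^ n))" by (auto simp: log_count_def)
    then show ?thesis unfolding logratio_def comp_def using p_gt_1 by (intro ereal_divide_right_mono) auto
  qed
  then have "limsup logratio \<le> limsup (?L \<circ> (\<lambda>n. p ^ n))" by (intro Limsup_mono) auto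
  also have "\<dots> \<le> limsup ?L" by (rule limsup_subseq_mono[OF sm])
  finally show ?thesis using assms(2) by (rule order_less_le_trans[rotated])
qed

text \<open>Only finitely many subgroups lie at each level, so infinitely many distinct ones reach
  arbitrarily deep levels, and largeness there passes upwards.\<close>

lemma nested_imp_large:
  assumes "finitely_generated G"
    and H: "infinite (range H)" "\<And>i. p_open p G (H i)" "0 < c" "\<And>i. c \<le> real (rk (H i)) / real (idx G (carrier G) (H i))"
  shows "large n (c / 2)"
proof -
  \<comment> \<open>At depth k \<ge> M one has p^k \<ge> 2/c, so replacing c by c/2 compensates for
    the passage from the rank to the rank minus 1.\<close>
  obtain M where M: "2 / c \<le> real M" using real_arch_simple by blast
  define m where "m = max n M"
  have "finite (\<Union>k<m. open_of_index k)" using finite_open_of_index[OF assms(1)] by blast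
  then obtain i where i: "H i \<notin> (\<Union>k<m. open_of_index k)" using H(1) by (meson finite_subset image_subsetI)
  obtain k where k: "idx G (carrier G) (H i) = p ^ k" using p_open_pidx[OF H(2)] by (auto simp: pidx_def)
  then have Hk: "H i \<in> open_of_index k" using H(2) by (simp add: open_of_index_def)
  then have km: "m \<le> k" using i by (meson UN_iff lessThan_iff not_le)
  have "real M \<le> real k" using km by (simp add: m_def)
  then have "2 / c \<le> real p ^ k" using M real_p_pow_ge(1)[of k] by linarith
  then have "1 \<le> c / 2 * real p ^ k" using H(3) by (simp add: field_simps)
  moreover have "c * real p ^ k \<le> real (rk (H i))" using H(4)[of i] k p_gt_1 by (simp add: field_simps)
  ultimately have "c / 2 * real p ^ k \<le> real (rk (H i)) - 1" by simp
  then have "large k (c / 2)" using Hk by (auto simp: large_def)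
  then show ?thesis using large_mono[OF assms(1)] km by (simp add: m_def)
qed

lemma large_imp_nested:
  assumes "finitely_generated G" "\<And>n. large n c"
  obtains H where "\<And>i. H (Suc i) \<subseteq> H i" "\<And>i. H i \<in> open_of_index i" "\<And>i. c * real p ^ i \<le> real (rk (H i)) - 1"
proof -
  define X where "X n = {K \<in> open_of_index n. c * real p ^ n \<le> real (rk K) - 1}" for n
  have "\<exists>f. \<forall>n. f n \<in> X n \<and> f (Suc n) \<subseteq> f n"
  proof (rule koenig[where R = "\<lambda>_ K H. H \<subseteq> K"])
    show "finite (X n)" for n using finite_open_of_index[OF assms(1)] by (simp add: X_def)
    show "X n \<noteq> {}" for n using assms(2)[of n] by (auto simp: X_def large_def)
    show "\<exists>K\<in>X n. H \<subseteq> K" if "H \<in> X (Suc n)" for n H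
    proof -
      from that have "H \<in> open_of_index (Suc n)" "c * real p ^ Suc n \<le> real (rk H) - 1" by (auto simp: X_def)
      from large_Suc[OF assms(1) this] show ?thesis unfolding X_def by blast
    qed
  qed
  then show thesis using that by (auto simp: X_def)
qed

end

section \<open>Products of commutators\<close>

lemma set_map2_subset:
  assumes "\<And>a b. a \<in> set as \<Longrightarrow> b \<in> set bs \<Longrightarrow> f a b \<in> C"
  shows "set (map2 f as bs) \<subseteq> C"
  using assms by (auto dest: set_zip_leftD set_zip_rightD)

context group
begin

definition commut :: "'a \<Rightarrow> 'a \<Rightarrow> 'a" where
  "commut x a = x \<otimes> a \<otimes> inv x \<otimes> inv a"

text \<open>The product of the commutators [x, a] of corresponding entries. The first list will be a
  fixed list of generators, so the number of factors is fixed and only the second list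
  varies.\<close>

primrec commut_prod :: "'a list \<Rightarrow> 'a list \<Rightarrow> 'a" where
  "commut_prod [] as = \<one>"
| "commut_prod (x # xs) as = commut x (hd as) \<otimes> commut_prod xs (tl as)"

text \<open>Numbered from 0: \<open>lower_central n\<close> is the (n+1)-st term in the usual
  numbering of the lower central series, and \<open>lower_central 1\<close> is the commutator
  subgroup.\<close>

primrec lower_central :: "nat \<Rightarrow> 'a set" where
  "lower_central 0 = carrier G"
| "lower_central (Suc n) = generate G {commut k a |k a. k \<in> carrier G \<and> a \<in> lower_central n}"

lemma commut_closed [simp]: "x \<in> carrier G \<Longrightarrow> a \<in> carrier G \<Longrightarrow> commut x a \<in> carrier G"
  by (simp add: commut_def)

lemma commut_one [simp]: "x \<in> carrier G \<Longrightarrow> commut x \<one> = \<one>" "a \<in> carrier G \<Longrightarrow> commut \<one> a = \<one>"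
  by (simp_all add: commut_def)

lemma commut_prod_closed:
  "set xs \<subseteq> carrier G \<Longrightarrow> set as \<subseteq> carrier G \<Longrightarrow> length as = length xs \<Longrightarrow> commut_prod xs as \<in> carrier G"
proof (induction xs arbitrary: as)
  case (Cons x xs)
  then obtain a as' where "as = a # as'" by (cases as) auto
  then show ?case using Cons by simp
qed simp

lemma commut_prod_ones: "set xs \<subseteq> carrier G \<Longrightarrow> commut_prod xs (replicate (length xs) \<one>) = \<one>"
  by (induction xs) auto

lemma commut_mult_right:
  assumes "x \<in> carrier G" "a \<in> carrier G" "w \<in> carrier G" "commut x w \<otimes> inv a = inv a \<otimes> commut x w"
  shows "commut x (a \<otimes> w) = commut x a \<otimes> commut x w"
proof -
  have "commut x (a \<otimes> w) = x \<otimes> a \<otimes> inv x \<otimes> (commut x w \<otimes> inv a)"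
    using assms(1-3) by (simp add: commut_def m_assoc inv_mult_group)
  also have "\<dots> = x \<otimes> a \<otimes> inv x \<otimes> (inv a \<otimes> commut x w)" by (simp only: assms(4))
  also have "\<dots> = commut x a \<otimes> commut x w" using assms(1-3) by (simp add: commut_def m_assoc)
  finally show ?thesis .
qed

lemma commut_mult_left:
  assumes "x \<in> carrier G" "y \<in> carrier G" "a \<in> carrier G" "commut y a \<otimes> x = x \<otimes> commut y a"
  shows "commut (x \<otimes> y) a = commut y a \<otimes> commut x a"
proof -
  have "commut (x \<otimes> y) a = (x \<otimes> commut y a) \<otimes> a \<otimes> inv x \<otimes> inv a"
    using assms(1-3) by (simp add: commut_def m_assoc inv_mult_group)
  also have "\<dots> = (commut y a \<otimes> x) \<otimes> a \<otimes> inv x \<otimes> inv a" by (simp only: assms(4))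
  also have "\<dots> = commut y a \<otimes> commut x a" using assms(1-3) by (simp add: commut_def m_assoc)
  finally show ?thesis .
qed

context
  fixes A :: "'a set"
  assumes A: "subgroup A G"
    and central: "\<And>k a g. k \<in> carrier G \<Longrightarrow> a \<in> A \<Longrightarrow> g \<in> carrier G \<Longrightarrow> commut k a \<otimes> g = g \<otimes> commut k a"
begin

text \<open>Commutators with entries from A are central, so [x, a w] = [x, a] [x, w], and the
  factors [x, w] can be collected on the right.\<close>

lemma commut_prod_mult:
  "set xs \<subseteq> carrier G \<Longrightarrow> set as \<subseteq> carrier G \<Longrightarrow> set ws \<subseteq> A \<Longrightarrow> length as = length xs \<Longrightarrow> length ws = length xs
    \<Longrightarrow> commut_prod xs (map2 (\<otimes>) as ws) = commut_prod xs as \<otimes> commut_prod xs ws"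
proof (induction xs arbitrary: as ws)
  case (Cons x xs)
  then obtain a as' where as: "as = a # as'" by (cases as) auto
  from Cons obtain w ws' where ws: "ws = w # ws'" by (cases ws) auto
  have c: "x \<in> carrier G" "a \<in> carrier G" "w \<in> A" "w \<in> carrier G" using Cons.prems as ws sub_in[OF A] by auto
  have wsc: "set ws' \<subseteq> carrier G" using Cons.prems ws sub_in[OF A] by auto
  have cc: "commut_prod xs as' \<in> carrier G" "commut_prod xs ws' \<in> carrier G"
    using Cons.prems as ws wsc by (auto intro!: commut_prod_closed)
  have "commut_prod (x # xs) (map2 (\<otimes>) as ws) = commut x (a \<otimes> w) \<otimes> (commut_prod xs as' \<otimes> commut_prod xs ws')"
    using Cons as ws by simp
  also have "commut x (a \<otimes> w) = commut x a \<otimes> commut x w"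
    using commut_mult_right[OF c(1,2,4)] central[OF c(1,3)] c by simp
  also have "commut x a \<otimes> commut x w \<otimes> (commut_prod xs as' \<otimes> commut_prod xs ws') = commut x a \<otimes> (commut x w \<otimes> commut_prod xs as') \<otimes> commut_prod xs ws'"
    using c cc by (simp add: m_assoc)
  also have "commut x w \<otimes> commut_prod xs as' = commut_prod xs as' \<otimes> commut x w" by (rule central[OF c(1,3) cc(1)])
  finally show ?case using as ws c cc by (simp add: m_assoc)
qed simp

lemma commut_prod_single:
  "set xs \<subseteq> carrier G \<Longrightarrow> x \<in> set xs \<Longrightarrow> a \<in> A \<Longrightarrow>
    \<exists>ws. set ws \<subseteq> A \<and> length ws = length xs \<and> commut x a = commut_prod xs ws"
proof (induction xs)
  case (Cons y ys)
  have ac: "a \<in> carrier G" using sub_in[OF A] Cons.prems by simp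
  show ?case
  proof (cases "x = y")
    case True
    have "set (a # replicate (length ys) \<one>) \<subseteq> A" using Cons.prems(3) sub_one[OF A] by auto
    moreover have "commut_prod (y # ys) (a # replicate (length ys) \<one>) = commut x a"
      using True Cons.prems commut_prod_ones[of ys] ac by simp
    ultimately show ?thesis by (intro exI[of _ "a # replicate (length ys) \<one>"]) simp
  next
    case False
    then obtain ws where ws: "set ws \<subseteq> A" "length ws = length ys" "commut x a = commut_prod ys ws" using Cons by auto
    have "commut_prod ys ws \<in> carrier G"
      using commut_prod_closed[of ys ws] ws Cons.prems(1) subgroup.subset[OF A] by simp
    then have "commut_prod (y # ys) (\<one> # ws) = commut x a" using ws Cons.prems(1) by simp
    then show ?thesis using ws sub_one[OF A] by (intro exI[of _ "\<one> # ws"]) auto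
  qed
qed simp

lemma commut_prod_subgroup:
  assumes "set xs \<subseteq> carrier G"
  shows "subgroup {commut_prod xs ws |ws. set ws \<subseteq> A \<and> length ws = length xs} G" (is "subgroup ?C G")
proof (rule subgroupI)
  have AC: "A \<subseteq> carrier G" using subgroup.subset[OF A] .
  show "?C \<subseteq> carrier G" using commut_prod_closed[OF assms] AC by blast
  have "\<one> \<in> ?C" using commut_prod_ones[OF assms] sub_one[OF A]
    by (intro CollectI exI[of _ "replicate (length xs) \<one>"]) auto
  then show "?C \<noteq> {}" by blast
  show "c \<otimes> d \<in> ?C" if cd: "c \<in> ?C" "d \<in> ?C" for c d
  proof -
    obtain ws vs where w: "c = commut_prod xs ws" "set ws \<subseteq> A" "length ws = length xs"
      "d = commut_prod xs vs" "set vs \<subseteq> A" "length vs = length xs" using cd by blast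
    have "c \<otimes> d = commut_prod xs (map2 (\<otimes>) ws vs)"
      using commut_prod_mult[OF assms _ w(5) w(3,6)] w AC by auto
    moreover have "set (map2 (\<otimes>) ws vs) \<subseteq> A"
      by (rule set_map2_subset) (use w sub_m[OF A] in blast)
    ultimately show ?thesis using w by (intro CollectI exI[of _ "map2 (\<otimes>) ws vs"]) simp
  qed
  show "inv c \<in> ?C" if c: "c \<in> ?C" for c
  proof -
    obtain ws where w: "c = commut_prod xs ws" "set ws \<subseteq> A" "length ws = length xs" using c by blast
    let ?v = "map (\<lambda>x. inv x) ws"
    have v: "set ?v \<subseteq> A" using w(2) sub_i[OF A] by auto
    have "map2 (\<otimes>) ?v ws = replicate (length xs) \<one>"
    proof (rule nth_equalityI)
      fix i assume "i < length (map2 (\<otimes>) ?v ws)"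
      then have i: "i < length ws" by simp
      then have "ws ! i \<in> carrier G" using w(2) AC by (meson nth_mem subsetD)
      then show "map2 (\<otimes>) ?v ws ! i = replicate (length xs) \<one> ! i" using i w(3) by simp
    qed (use w(3) in simp)
    then have "commut_prod xs ?v \<otimes> c = \<one>"
      using commut_prod_mult[OF assms _ w(2) _ w(3), of ?v] v AC w(1,3) commut_prod_ones[OF assms] by auto
    then have "inv c = commut_prod xs ?v"
      using inv_equality[of "commut_prod xs ?v" c] commut_prod_closed[OF assms, of ws] commut_prod_closed[OF assms, of ?v] w v AC by auto
    then show ?thesis using v w(3) by (intro CollectI exI[of _ ?v]) simp
  qed
qed

text \<open>For fixed a in A the map sending k to [k, a] is multiplicative with central values, so
  it is enough to consider generators k.\<close>

lemma commut_in_commut_prods: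
  assumes "set xs \<subseteq> carrier G" "k \<in> generate G (set xs)" "a \<in> A"
  shows "commut k a \<in> {commut_prod xs ws |ws. set ws \<subseteq> A \<and> length ws = length xs}" (is "_ \<in> ?C")
  using assms(2)
proof (induction rule: generate.induct)
  have ac: "a \<in> carrier G" using sub_in[OF A assms(3)] .
  note C = commut_prod_subgroup[OF assms(1)]
  {
    case one show ?case using sub_one[OF C] ac by simp
  next
    case (incl h) show ?case using commut_prod_single[OF assms(1) incl assms(3)] by blast
  next
    case (inv h)
    have h: "h \<in> carrier G" using inv assms(1) by blast
    have "commut h a \<otimes> commut (inv h) a = \<one>"
      using commut_mult_left[of "inv h" h a] central[OF h assms(3), of "inv h"] h ac by simp
    then have "commut (inv h) a = inv (commut h a)" using h ac by (metis inv_unique' commut_closed inv_closed inv_equality inv_inv)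
    moreover have "commut h a \<in> ?C" using commut_prod_single[OF assms(1) inv assms(3)] by blast
    ultimately show ?case using sub_i[OF C] by simp
  next
    case (eng g h)
    have c: "g \<in> carrier G" "h \<in> carrier G" using eng generate_in_carrier[OF assms(1)] by auto
    have "commut (g \<otimes> h) a = commut h a \<otimes> commut g a"
      using commut_mult_left[OF c ac] central[OF c(2) assms(3) c(1)] by simp
    then show ?case using sub_m[OF C eng.IH(2,1)] by simp
  }
qed

text \<open>The error z is itself a product of commutators of the same shape with entries from A;
  bimultiplicativity merges it into the given product without adding factors.\<close>

lemma commut_prod_absorb:
  assumes "set xs \<subseteq> carrier G" "generate G (set xs) = carrier G" "set as \<subseteq> carrier G" "length as = length xs"
    "z \<in> generate G {commut k a |k a. k \<in> carrier G \<and> a \<in> A}"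
  shows "\<exists>bs. set bs \<subseteq> carrier G \<and> length bs = length xs \<and> commut_prod xs as \<otimes> z = commut_prod xs bs"
proof -
  have "{commut k a |k a. k \<in> carrier G \<and> a \<in> A} \<subseteq> {commut_prod xs ws |ws. set ws \<subseteq> A \<and> length ws = length xs}"
    using commut_in_commut_prods[OF assms(1)] assms(2) by blast
  from generate_subgroup_incl[OF this commut_prod_subgroup[OF assms(1)]] assms(5)
  obtain ws where w: "z = commut_prod xs ws" "set ws \<subseteq> A" "length ws = length xs" by blast
  have "set (map2 (\<otimes>) as ws) \<subseteq> carrier G"
    by (rule set_map2_subset, rule m_closed) (use assms(3) w(2) subgroup.subset[OF A] in blast)+
  then show ?thesis
    using commut_prod_mult[OF assms(1,3) w(2) assms(4) w(3)] w assms(4) by (intro exI[of _ "map2 (\<otimes>) as ws"]) simp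
qed

end

lemma lower_central_subset: "lower_central n \<subseteq> carrier G"
proof (induction n)
  case (Suc n)
  have "{commut k a |k a. k \<in> carrier G \<and> a \<in> lower_central n} \<subseteq> carrier G" using Suc by auto
  then show ?case using generate_incl by simp
qed simp

lemma lower_central_subgroup: "subgroup (lower_central n) G"
proof (cases n)
  case (Suc m)
  have "{commut k a |k a. k \<in> carrier G \<and> a \<in> lower_central m} \<subseteq> carrier G" using lower_central_subset[of m] by auto
  then show ?thesis using Suc generate_is_subgroup by simp
qed (simp add: subgroup_self)

lemma commut_lower_central: "k \<in> carrier G \<Longrightarrow> a \<in> lower_central n \<Longrightarrow> commut k a \<in> lower_central (Suc n)"
  by (auto intro!: generate.incl)

lemma lower_central_Suc_subset: "lower_central (Suc n) \<subseteq> lower_central n"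
proof (induction n)
  case 0 then show ?case using lower_central_subset[of 1] by simp
next
  case (Suc n)
  show ?case unfolding lower_central.simps(2)[of "Suc n"]
  proof (rule generate_subgroup_incl[OF _ lower_central_subgroup])
    show "{commut k a |k a. k \<in> carrier G \<and> a \<in> lower_central (Suc n)} \<subseteq> lower_central (Suc n)"
      using Suc commut_lower_central by blast
  qed
qed

lemma nsub_lower_central: "nsub G (lower_central n) (carrier G)"
  unfolding nsub_def
proof (intro conjI ballI lower_central_subgroup lower_central_subset subgroup_self)
  fix k a assume ka: "k \<in> carrier G" "a \<in> lower_central n"
  have ac: "a \<in> carrier G" using ka lower_central_subset by blast
  have "k \<otimes> a \<otimes> inv k = commut k a \<otimes> a" using ka ac by (simp add: commut_def m_assoc)
  moreover have "commut k a \<in> lower_central n" using commut_lower_central[OF ka] lower_central_Suc_subset by blast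
  ultimately show "k \<otimes> a \<otimes> inv k \<in> lower_central n" using sub_m[OF lower_central_subgroup _ ka(2)] by simp
qed

end

lemma commut_prod_hom:
  assumes "group G" "group H" "h \<in> hom G H"
  shows "x \<in> carrier G \<Longrightarrow> a \<in> carrier G \<Longrightarrow> h (group.commut G x a) = group.commut H (h x) (h a)"
    and "set xs \<subseteq> carrier G \<Longrightarrow> set as \<subseteq> carrier G \<Longrightarrow> length as = length xs \<Longrightarrow>
      h (group.commut_prod G xs as) = group.commut_prod H (map h xs) (map h as)"
proof -
  interpret G: group G by fact
  interpret H: group H by fact
  interpret h: group_hom G H h by unfold_locales (rule assms(3))
  show 1: "h (G.commut x a) = H.commut (h x) (h a)" if "x \<in> carrier G" "a \<in> carrier G" for x a
    using that by (simp add: G.commut_def H.commut_def)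
  show "h (G.commut_prod xs as) = H.commut_prod (map h xs) (map h as)"
    if "set xs \<subseteq> carrier G" "set as \<subseteq> carrier G" "length as = length xs"
    using that
  proof (induction xs arbitrary: as)
    case (Cons x xs)
    then obtain a as' where as: "as = a # as'" by (cases as) auto
    then show ?case using Cons 1 G.commut_prod_closed[of xs as'] by simp
  qed simp
qed

text \<open>In \<open>G/\<gamma>\<^sub>n\<^sub>+\<^sub>2\<close> the commutators \<open>[x, w]\<close> with \<open>w \<in> \<gamma>\<^sub>n\<close> are central and bimultiplicative, so an error
  term in \<open>\<gamma>\<^sub>n\<^sub>+\<^sub>1\<close> can be absorbed into the arguments of a product of commutators with the generators.\<close>

lemma (in group) derived_width:
  assumes xs: "set xs \<subseteq> carrier G" "generate G (set xs) = carrier G" and "b \<in> lower_central 1"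
  shows "\<exists>as. set as \<subseteq> carrier G \<and> length as = length xs \<and> inv (commut_prod xs as) \<otimes> b \<in> lower_central (Suc n)"
proof (induction n)
  case 0
  have "b \<in> carrier G" using assms(3) lower_central_subset by blast
  then have "inv (commut_prod xs (replicate (length xs) \<one>)) \<otimes> b \<in> lower_central (Suc 0)"
    using assms(3) commut_prod_ones[OF xs(1)] by simp
  moreover have "set (replicate (length xs) \<one>) \<subseteq> carrier G" by auto
  ultimately show ?case by (intro exI[of _ "replicate (length xs) \<one>"]) simp
next
  case (Suc n)
  then obtain as where as: "set as \<subseteq> carrier G" "length as = length xs" "inv (commut_prod xs as) \<otimes> b \<in> lower_central (Suc n)" by blast
  have bc: "b \<in> carrier G" using assms(3) lower_central_subset by blast
  \<comment> \<open>One term further than the error: modulo M, the commutators of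
    \<open>lower_central n\<close> with the group are central, as \<open>commut_prod_absorb\<close>
    requires.\<close>
  define M where "M = lower_central (Suc (Suc n))"
  have M: "nsub G M (carrier G)" unfolding M_def by (rule nsub_lower_central)
  have cmM: "commut k a \<in> M" if "k \<in> carrier G" "a \<in> lower_central (Suc n)" for k a
    unfolding M_def by (rule commut_lower_central[OF that])
  interpret N: normal M G using M normal_iff_nsub_carrier by blast
  let ?Q = "G Mod M"
  interpret Q: group ?Q by (rule N.factorgroup_is_group)
  define \<pi> where "\<pi> = (\<lambda>g. M #> g)"
  have hom: "\<pi> \<in> hom G ?Q" unfolding \<pi>_def by (rule N.r_coset_hom_Mod)
  interpret \<pi>: group_hom G ?Q \<pi> by (intro group_hom.intro group_hom_axioms.intro is_group Q.is_group hom)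
  have car: "carrier ?Q = \<pi> ` carrier G" by (simp add: carrier_FactGroup \<pi>_def)
  have eq: "\<pi> u = \<pi> v \<longleftrightarrow> u \<otimes> inv v \<in> M" if "u \<in> carrier G" "v \<in> carrier G" for u v
    unfolding \<pi>_def using coset_eq_iff[OF nsubD(1)[OF M] that] .
  note ch = commut_prod_hom[OF is_group Q.is_group hom]
  let ?A = "\<pi> ` lower_central n"
  have A: "subgroup ?A ?Q" by (rule \<pi>.subgroup_img_is_subgroup[OF lower_central_subgroup])
  have central: "Q.commut X B \<otimes>\<^bsub>?Q\<^esub> Y = Y \<otimes>\<^bsub>?Q\<^esub> Q.commut X B"
    if XBY: "X \<in> carrier ?Q" "B \<in> ?A" "Y \<in> carrier ?Q" for X B Y
  proof -
    obtain k a y where k: "k \<in> carrier G" "X = \<pi> k" "a \<in> lower_central n" "B = \<pi> a" "y \<in> carrier G" "Y = \<pi> y"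
      using XBY car by auto
    have ac: "a \<in> carrier G" using k(3) lower_central_subset by blast
    define z where "z = commut k a"
    have z: "z \<in> lower_central (Suc n)" "z \<in> carrier G" unfolding z_def by (rule commut_lower_central[OF k(1,3)], rule commut_closed[OF k(1) ac])
    have "\<pi> (y \<otimes> z) = \<pi> (z \<otimes> y)"
      using eq[of "y \<otimes> z" "z \<otimes> y"] cmM[OF k(5) z(1)] k(5) z(2) by (simp add: commut_def m_assoc inv_mult_group)
    moreover have "Q.commut X B = \<pi> z" using ch(1)[OF k(1) ac] k by (simp add: z_def)
    ultimately show ?thesis using k z(2) by simp
  qed
  have gen: "generate ?Q (set (map \<pi> xs)) = carrier ?Q"
    using \<pi>.generate_img[OF xs(1)] xs(2) car by simp
  have xsQ: "set (map \<pi> xs) \<subseteq> carrier ?Q" "set (map \<pi> as) \<subseteq> carrier ?Q" using xs(1) as(1) by auto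
  define c where "c = inv (commut_prod xs as) \<otimes> b"
  have cp: "commut_prod xs as \<in> carrier G" by (rule commut_prod_closed[OF xs(1) as(1,2)])
  have cc: "c \<in> carrier G" "b = commut_prod xs as \<otimes> c" using cp bc by (simp_all add: c_def)
  have "\<pi> c \<in> \<pi> ` generate G {commut k a |k a. k \<in> carrier G \<and> a \<in> lower_central n}"
    using as(3) unfolding c_def lower_central.simps(2)[of n] by (rule imageI)
  also have "\<dots> = generate ?Q (\<pi> ` {commut k a |k a. k \<in> carrier G \<and> a \<in> lower_central n})"
    by (rule \<pi>.generate_img[symmetric]) (use lower_central_subset[of n] in auto)
  also have "\<pi> ` {commut k a |k a. k \<in> carrier G \<and> a \<in> lower_central n} = {Q.commut X B |X B. X \<in> carrier ?Q \<and> B \<in> ?A}"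
  proof -
    have "\<pi> (commut k a) = Q.commut (\<pi> k) (\<pi> a)" if "k \<in> carrier G" "a \<in> lower_central n" for k a
      using ch(1)[OF that(1)] that(2) lower_central_subset by blast
    then show ?thesis unfolding car by (fastforce simp: image_iff)
  qed
  finally have pc: "\<pi> c \<in> generate ?Q {Q.commut X B |X B. X \<in> carrier ?Q \<and> B \<in> ?A}" .
  obtain Bs where Bs: "set Bs \<subseteq> carrier ?Q" "length Bs = length (map \<pi> xs)"
      "Q.commut_prod (map \<pi> xs) (map \<pi> as) \<otimes>\<^bsub>?Q\<^esub> \<pi> c = Q.commut_prod (map \<pi> xs) Bs"
    using Q.commut_prod_absorb[OF A central xsQ(1) gen xsQ(2) _ pc] as(2) by auto
  define bs where "bs = map (inv_into (carrier G) \<pi>) Bs"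
  have bs: "set bs \<subseteq> carrier G" "length bs = length xs" "map \<pi> bs = Bs"
    using Bs(1,2) unfolding bs_def car
    by (auto intro!: inv_into_into map_idI simp: f_inv_into_f comp_def subset_iff)
  have bp: "commut_prod xs bs \<in> carrier G" by (rule commut_prod_closed[OF xs(1) bs(1,2)])
  have "\<pi> b = \<pi> (commut_prod xs bs)"
    using Bs(3) ch(2)[OF xs(1) as(1,2)] ch(2)[OF xs(1) bs(1,2)] bs(3) cc cp by simp
  then have "b \<otimes> inv (commut_prod xs bs) \<in> M" using eq[OF bc bp] by simp
  \<comment> \<open>Conjugation moves the approximating product from the right of b to its left, the
    side used in the statement.\<close>
  then have "inv (commut_prod xs bs) \<otimes> (b \<otimes> inv (commut_prod xs bs)) \<otimes> inv (inv (commut_prod xs bs)) \<in> M"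
    using nsubD(4)[OF M] bp by blast
  then have "inv (commut_prod xs bs) \<otimes> b \<in> M" using bc bp by (simp add: m_assoc)
  then show ?case using bs(1,2) unfolding M_def by blast
qed

section \<open>Nilpotency of finite p-quotients and the Frattini subgroup\<close>

context group_prime
begin

text \<open>Finite p-groups are nilpotent. The induction replaces N by the preimage of the centre of
  G/N, which has smaller index by \<open>central_mod\<close>.\<close>

lemma lower_central_le_p_power_index:
  assumes "nsub G N (carrier G)" "pidx (carrier G) N"
  shows "\<exists>n. lower_central n \<subseteq> N"
  using assms
proof (induction "idx G (carrier G) N" arbitrary: N rule: less_induct)
  case less
  note n = nsubD[OF less.prems(1)]
  show ?case
  proof (cases "N = carrier G")
    case True then show ?thesis using lower_central_subset by blast
  next
    case False
    \<comment> \<open>The preimage in G of the centre of G/N.\<close>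
    define Z where "Z = {z \<in> carrier G. \<forall>k\<in>carrier G. commut k z \<in> N}"
    have Nc: "\<And>x. x \<in> N \<Longrightarrow> x \<in> carrier G" using n(3) by blast
    have s: "subgroup Z G"
    proof (rule subgroupI)
      show "Z \<subseteq> carrier G" by (auto simp: Z_def)
      show "Z \<noteq> {}" using sub_one[OF n(1)] by (auto simp: Z_def intro!: exI[of _ \<one>])
      show "inv z \<in> Z" if z: "z \<in> Z" for z
      proof -
        have zc: "z \<in> carrier G" using z by (simp add: Z_def)
        have "commut k (inv z) \<in> N" if k: "k \<in> carrier G" for k
        proof -
          have "inv z \<otimes> inv (commut k z) \<otimes> inv (inv z) \<in> N"
            using n(4)[OF inv_closed[OF zc] sub_i[OF n(1)]] z k by (simp add: Z_def)
          moreover have "inv z \<otimes> inv (commut k z) \<otimes> inv (inv z) = commut k (inv z)"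
            using zc k by (simp add: commut_def m_assoc inv_mult_group)
          ultimately show ?thesis by simp
        qed
        then show ?thesis using zc by (simp add: Z_def)
      qed
      show "z \<otimes> w \<in> Z" if zw: "z \<in> Z" "w \<in> Z" for z w
      proof -
        have c: "z \<in> carrier G" "w \<in> carrier G" using zw by (simp_all add: Z_def)
        have "commut k (z \<otimes> w) \<in> N" if k: "k \<in> carrier G" for k
        proof -
          have "z \<otimes> commut k w \<otimes> inv z \<in> N" using n(4)[OF c(1)] zw(2) k by (simp add: Z_def)
          then have "commut k z \<otimes> (z \<otimes> commut k w \<otimes> inv z) \<in> N" using sub_m[OF n(1)] zw(1) k by (simp add: Z_def)
          moreover have "commut k z \<otimes> (z \<otimes> commut k w \<otimes> inv z) = commut k (z \<otimes> w)"
            using c k by (simp add: commut_def m_assoc inv_mult_group)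
          ultimately show ?thesis by simp
        qed
        then show ?thesis using c by (simp add: Z_def)
      qed
    qed
    have NZ: "N \<subseteq> Z"
    proof
      fix x assume x: "x \<in> N"
      have "commut k x \<in> N" if "k \<in> carrier G" for k
        unfolding commut_def using sub_m[OF n(1) n(4)[OF that x] sub_i[OF n(1) x]] .
      then show "x \<in> Z" using Nc[OF x] by (simp add: Z_def)
    qed
    have nZ: "nsub G Z (carrier G)"
      unfolding nsub_def
    proof (intro conjI ballI s subgroup_self subgroup.subset[OF s])
      fix g z assume gz: "g \<in> carrier G" "z \<in> Z"
      have zc: "z \<in> carrier G" using gz(2) by (simp add: Z_def)
      have "commut k (g \<otimes> z \<otimes> inv g) \<in> N" if k: "k \<in> carrier G" for k
      proof -
        have "commut (inv g \<otimes> k \<otimes> g) z \<in> N" using gz k by (simp add: Z_def)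
        then have "g \<otimes> commut (inv g \<otimes> k \<otimes> g) z \<otimes> inv g \<in> N" using n(4)[OF gz(1)] by blast
        moreover have "g \<otimes> commut (inv g \<otimes> k \<otimes> g) z \<otimes> inv g = commut k (g \<otimes> z \<otimes> inv g)"
          using gz(1) zc k by (simp add: commut_def m_assoc inv_mult_group)
        ultimately show ?thesis by simp
      qed
      then show "g \<otimes> z \<otimes> inv g \<in> Z" using gz(1) zc by (simp add: Z_def)
    qed
    have "nsub G (carrier G) (carrier G)" using subgroup_self by (simp add: nsub_def)
    from central_mod[OF less.prems this n(3) False] obtain z
      where "z \<in> carrier G" "z \<notin> N" "\<forall>k\<in>carrier G. k \<otimes> z \<otimes> inv k \<otimes> inv z \<in> N" by blast
    then have "N \<noteq> Z" by (auto simp: Z_def commut_def)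
    have t: "idx G (carrier G) N = idx G (carrier G) Z * idx G Z N"
      by (rule idx_tower[OF n(1) s subgroup_self NZ subgroup.subset[OF s]])
    have pZ: "pidx (carrier G) Z" "pidx Z N"
      using pidx_tower[OF n(1) s subgroup_self NZ subgroup.subset[OF s]] less.prems(2) by auto
    have "idx G Z N \<noteq> 1" using idx_1_eq[OF n(1) s NZ] \<open>N \<noteq> Z\<close> by blast
    then have "idx G (carrier G) Z < idx G (carrier G) N"
      using t idx_pos[OF pZ(1)] idx_pos[OF pZ(2)] by (simp add: nat_neq_iff)
    from less.hyps[OF this nZ pZ(1)] obtain m where m: "lower_central m \<subseteq> Z" by blast
    have "lower_central (Suc m) \<subseteq> N"
      unfolding lower_central.simps(2)
    proof (rule generate_subgroup_incl[OF _ n(1)])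
      show "{commut k a |k a. k \<in> carrier G \<and> a \<in> lower_central m} \<subseteq> N" using m by (auto simp: Z_def)
    qed
    then show ?thesis by blast
  qed
qed

text \<open>The subgroup \<open>G\<^sup>p[G, G]\<close>, since \<open>lower_central 1\<close> is the commutator subgroup.\<close>

definition frattini :: "'a set" where
  "frattini = {g \<in> carrier G. \<exists>y\<in>carrier G. g \<otimes> inv (y [^] p) \<in> lower_central 1}"

text \<open>Modulo the commutator subgroup a product of p-th powers is again a p-th power, so a
  single p-th power is enough in the definition. The factorisation in \<open>p_open_frattini\<close>
  therefore has only one.\<close>

lemma frattini_subgroup: "subgroup frattini G" "lower_central 1 \<subseteq> frattini" "x \<in> carrier G \<Longrightarrow> x [^] p \<in> frattini"
proof -
  define D where "D = lower_central 1"
  have D: "nsub G D (carrier G)" unfolding D_def by (rule nsub_lower_central)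
  note d = nsubD[OF D]
  interpret N: normal D G using D normal_iff_nsub_carrier by blast
  let ?Q = "G Mod D"
  interpret Q: group ?Q by (rule N.factorgroup_is_group)
  define \<pi> where "\<pi> = (\<lambda>g. D #> g)"
  have hom: "\<pi> \<in> hom G ?Q" unfolding \<pi>_def by (rule N.r_coset_hom_Mod)
  interpret \<pi>: group_hom G ?Q \<pi> by (intro group_hom.intro group_hom_axioms.intro is_group Q.is_group hom)
  have eq: "\<pi> u = \<pi> v \<longleftrightarrow> u \<otimes> inv v \<in> D" if "u \<in> carrier G" "v \<in> carrier G" for u v
    unfolding \<pi>_def using coset_eq_iff[OF d(1) that] .
  have comm: "\<pi> u \<otimes>\<^bsub>?Q\<^esub> \<pi> v = \<pi> v \<otimes>\<^bsub>?Q\<^esub> \<pi> u" if uv: "u \<in> carrier G" "v \<in> carrier G" for u v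
  proof -
    have "commut u v \<in> D" unfolding D_def using commut_lower_central[of u v 0] uv by simp
    then have "\<pi> (u \<otimes> v) = \<pi> (v \<otimes> u)"
      using eq[of "u \<otimes> v" "v \<otimes> u"] uv by (simp add: commut_def m_assoc inv_mult_group)
    then show ?thesis using uv by simp
  qed
  have frattini: "frattini = {g \<in> carrier G. \<exists>y\<in>carrier G. \<pi> g = \<pi> y [^]\<^bsub>?Q\<^esub> p}"
    unfolding frattini_def D_def[symmetric] using eq by (auto simp flip: \<pi>.hom_nat_pow)
  have power: "x [^] p \<in> frattini" if "x \<in> carrier G" for x
    unfolding frattini using that by (auto simp: \<pi>.hom_nat_pow)
  then show "x [^] p \<in> frattini" if "x \<in> carrier G" using that .
  show "subgroup frattini G"
  proof (rule subgroupI)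
    show "frattini \<subseteq> carrier G" by (auto simp: frattini_def)
    show "frattini \<noteq> {}" using power[OF one_closed] by blast
    show "inv g \<in> frattini" if g: "g \<in> frattini" for g
    proof -
      obtain y where y: "g \<in> carrier G" "y \<in> carrier G" "\<pi> g = \<pi> y [^]\<^bsub>?Q\<^esub> p" using g by (auto simp: frattini)
      have "\<pi> (inv g) = \<pi> (inv y) [^]\<^bsub>?Q\<^esub> p" using y by (simp add: Q.nat_pow_inv)
      then show ?thesis unfolding frattini using y by blast
    qed
    show "g \<otimes> h \<in> frattini" if gh: "g \<in> frattini" "h \<in> frattini" for g h
    proof -
      obtain y z where y: "g \<in> carrier G" "y \<in> carrier G" "\<pi> g = \<pi> y [^]\<^bsub>?Q\<^esub> p"
        "h \<in> carrier G" "z \<in> carrier G" "\<pi> h = \<pi> z [^]\<^bsub>?Q\<^esub> p" using gh by (auto simp: frattini)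
      have "\<pi> (g \<otimes> h) = \<pi> (y \<otimes> z) [^]\<^bsub>?Q\<^esub> p"
        using y Q.pow_mult_distrib[OF comm[OF y(2,5)], of p] by simp
      then show ?thesis unfolding frattini using y by blast
    qed
  qed
  show "lower_central 1 \<subseteq> frattini"
  proof
    fix g assume g: "g \<in> lower_central 1"
    have gc: "g \<in> carrier G" using g lower_central_subset by blast
    have "g \<otimes> inv (\<one> [^] p) \<in> lower_central 1" using g gc by (simp del: lower_central.simps)
    then show "g \<in> frattini" unfolding frattini_def using gc by blast
  qed
qed

text \<open>A subgroup containing the commutator subgroup is normal, since k a k^-1 = [k, a]
  a.\<close>

lemma frattini_above:
  assumes "subgroup A G" "lower_central 1 \<subseteq> A" "k \<in> carrier G" "a \<in> A"
  shows "k \<otimes> a \<otimes> inv k \<in> A"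
proof -
  have ac: "a \<in> carrier G" using sub_in[OF assms(1,4)] .
  have "commut k a \<in> lower_central 1" using commut_lower_central[of k a 0] assms(3) ac by simp
  then have "commut k a \<otimes> a \<in> A" using sub_m[OF assms(1) _ assms(4)] assms(2) by blast
  then show ?thesis using assms(3) ac by (simp add: commut_def m_assoc)
qed

lemma nsub_frattini: "nsub G frattini (carrier G)"
  unfolding nsub_def using frattini_subgroup frattini_above subgroup_self subgroup.subset by blast

text \<open>Adjoin the generators to the Frattini subgroup one at a time. All groups on the way are
  normal and contain all p-th powers, so each step has index 1 or p.\<close>

lemma pidx_frattini:
  assumes "set xs \<subseteq> carrier G" "generate G (set xs) = carrier G"
  shows "pidx (carrier G) frattini"
proof -
  note fr = frattini_subgroup
  have "\<exists>A. subgroup A G \<and> frattini \<subseteq> A \<and> set xs \<subseteq> A \<and> pidx A frattini"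
    using assms(1)
  proof (induction xs)
    case Nil
    have "pidx frattini frattini" unfolding pidx_def using idx_self[OF fr(1)] by (metis power_0)
    then show ?case using fr(1) by auto
  next
    case (Cons x xs)
    then obtain A where A: "subgroup A G" "frattini \<subseteq> A" "set xs \<subseteq> A" "pidx A frattini" by auto
    show ?case
    proof (cases "x \<in> A")
      case True then show ?thesis using A by auto
    next
      case False
      have x: "x \<in> carrier G" using Cons.prems by simp
      have xp: "x [^] p \<in> A" using fr(3)[OF x] A(2) by blast
      have lA: "lower_central 1 \<subseteq> A" using fr(2) A(2) by blast
      have n1: "x \<otimes> h \<otimes> inv x \<in> A" if "h \<in> A" for h by (rule frattini_above[OF A(1) lA x that])
      have n2: "inv x \<otimes> h \<otimes> x \<in> A" if "h \<in> A" for h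
        using frattini_above[OF A(1) lA inv_closed[OF x] that] x by simp
      define B where "B = {h \<otimes> x [^] (i::int) |h i. h \<in> A}"
      note B = adjoin[OF A(1) x False xp n1 n2, folded B_def]
      note b = nsubD[OF B(1)]
      have "pidx B A" unfolding pidx_def using B(2) by (metis power_one_right)
      then have "pidx B frattini" using pidx_tower[OF fr(1) A(1) b(2) A(2) b(3)] A(4) by blast
      then show ?thesis using b A B(3) by (intro exI[of _ B]) auto
    qed
  qed
  then obtain A where A: "subgroup A G" "set xs \<subseteq> A" "pidx A frattini" by blast
  have "carrier G \<subseteq> A" using generate_subgroup_incl[OF A(2,1)] assms(2) by simp
  then have "A = carrier G" using subgroup.subset[OF A(1)] by blast
  then show ?thesis using A(3) by simp
qed

section \<open>The pro-p completion\<close>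

abbreviation NN :: "'a set set" where "NN \<equiv> p_power_normal p G"

abbreviation Gm :: "('a set \<Rightarrow> 'a set) monoid" where "Gm \<equiv> pro_p_completion p G"

lemma NND:
  assumes "N \<in> NN"
  shows "nsub G N (carrier G)" "pidx (carrier G) N" "subgroup N G" "N \<subseteq> carrier G" "normal N G" "p_open p G N"
  using assms nsubD[of G N "carrier G"] normal_iff_nsub_carrier by (auto simp: p_power_normal_iff p_open_def)

lemma NN_Int: "N \<in> NN \<Longrightarrow> M \<in> NN \<Longrightarrow> N \<inter> M \<in> NN"
  using nsub_pidx_Int by (simp add: p_power_normal_iff)

lemma NN_mult: "N \<in> NN \<Longrightarrow> g \<in> carrier G \<Longrightarrow> h \<in> carrier G \<Longrightarrow> (N #> g) <#> (N #> h) = N #> (g \<otimes> h)"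
  using normal.rcos_sum[OF NND(5)] by blast

lemma NN_proj:
  assumes "N \<in> NN" "M \<in> NN" "N \<subseteq> M" "g \<in> carrier G"
  shows "M <#> (N #> g) = M #> g"
proof (intro equalityI subsetI)
  fix x assume "x \<in> M <#> (N #> g)"
  then obtain m n where mn: "m \<in> M" "n \<in> N" "x = m \<otimes> (n \<otimes> g)" by (auto simp: set_mult_def r_coset_def)
  have c: "m \<in> carrier G" "n \<in> carrier G" using mn NND(4) assms by blast+
  have "m \<otimes> n \<in> M" using mn assms(3) sub_m[OF NND(3)[OF assms(2)]] by blast
  then show "x \<in> M #> g" unfolding r_coset_def mn(3) using c assms(4) by (auto simp: m_assoc intro!: bexI[of _ "m \<otimes> n"])
next
  fix x assume "x \<in> M #> g"
  then obtain m where m: "m \<in> M" "x = m \<otimes> g" by (auto simp: r_coset_def)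
  have "\<one> \<otimes> g \<in> N #> g" using sub_one[OF NND(3)[OF assms(1)]] by (auto simp: r_coset_def)
  then show "x \<in> M <#> (N #> g)" using m assms(4) by (auto simp: set_mult_def)
qed

lemma Gm_carrier_iff:
  "f \<in> carrier Gm \<longleftrightarrow> f \<in> extensional NN \<and> (\<forall>N\<in>NN. \<exists>g\<in>carrier G. f N = N #> g) \<and>
     (\<forall>N\<in>NN. \<forall>M\<in>NN. N \<subseteq> M \<longrightarrow> f M = M <#> f N)"
  unfolding pro_p_completion_def Let_def by (auto simp: PiE_def Pi_def carrier_FactGroup image_iff)

lemma Gm_mult: "(f \<otimes>\<^bsub>Gm\<^esub> h) = (\<lambda>N\<in>NN. f N <#> h N)"
  unfolding pro_p_completion_def Let_def by simp

lemma Gm_one: "\<one>\<^bsub>Gm\<^esub> = (\<lambda>N\<in>NN. N)"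
  unfolding pro_p_completion_def Let_def by simp

text \<open>The element g of G approximates f modulo N. Calculations in the completion are reduced
  to calculations with such representatives; membership of N in \<open>NN\<close> is included so
  that it need not be carried along separately.\<close>

definition repr :: "('a set \<Rightarrow> 'a set) \<Rightarrow> 'a set \<Rightarrow> 'a \<Rightarrow> bool" where
  "repr f N g \<longleftrightarrow> N \<in> NN \<and> g \<in> carrier G \<and> f N = N #> g"

definition rp :: "('a set \<Rightarrow> 'a set) \<Rightarrow> 'a set \<Rightarrow> 'a" where
  "rp f N = (SOME g. repr f N g)"

lemma repr_rp:
  assumes "f \<in> carrier Gm" "N \<in> NN" shows "repr f N (rp f N)"
proof -
  have "\<forall>N\<in>NN. \<exists>g\<in>carrier G. f N = N #> g"
    using assms(1) unfolding Gm_carrier_iff by (elim conjE)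
  then obtain g where "g \<in> carrier G" "f N = N #> g" using assms(2) by (elim ballE bexE) blast+
  then have "repr f N g" using assms(2) by (simp add: repr_def)
  then show ?thesis unfolding rp_def by (rule someI)
qed

lemma reprD: "repr f N g \<Longrightarrow> N \<in> NN" "repr f N g \<Longrightarrow> g \<in> carrier G" "repr f N g \<Longrightarrow> f N = N #> g"
  by (simp_all add: repr_def)

lemma repr_eq: "repr f N a \<Longrightarrow> repr h N b \<Longrightarrow> f N = h N \<longleftrightarrow> a \<otimes> inv b \<in> N"
  using coset_eq_iff[OF NND(3)] by (simp add: repr_def)

lemma repr_compat:
  assumes "f \<in> carrier Gm" "repr f N g" "M \<in> NN" "N \<subseteq> M"
  shows "repr f M g"
proof -
  note r = reprD[OF assms(2)]
  have "\<forall>N\<in>NN. \<forall>M\<in>NN. N \<subseteq> M \<longrightarrow> f M = M <#> f N"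
    using assms(1) unfolding Gm_carrier_iff by (elim conjE)
  from mp[OF bspec[OF bspec[OF this r(1)] assms(3)] assms(4)] have "f M = M <#> f N" .
  then show ?thesis using NN_proj[OF r(1) assms(3,4) r(2)] r(2,3) assms(3) by (simp add: repr_def)
qed

lemma GmI:
  assumes "f \<in> extensional NN" "\<And>N. N \<in> NN \<Longrightarrow> repr f N (g N)"
    "\<And>N M. N \<in> NN \<Longrightarrow> M \<in> NN \<Longrightarrow> N \<subseteq> M \<Longrightarrow> M #> g M = M #> g N"
  shows "f \<in> carrier Gm"
  unfolding Gm_carrier_iff
proof (intro conjI ballI impI)
  show "f \<in> extensional NN" by (rule assms(1))
  show "\<exists>h\<in>carrier G. f N = N #> h" if "N \<in> NN" for N
    using reprD(2,3)[OF assms(2)[OF that]] by (intro bexI[of _ "g N"])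
  show "f M = M <#> f N" if "N \<in> NN" "M \<in> NN" "N \<subseteq> M" for N M
    using reprD(3)[OF assms(2)[OF that(1)]] reprD(3)[OF assms(2)[OF that(2)]] assms(3)[OF that]
      NN_proj[OF that reprD(2)[OF assms(2)[OF that(1)]]] by simp
qed

lemma Gm_ext: "f \<in> carrier Gm \<Longrightarrow> f \<in> extensional NN"
  unfolding Gm_carrier_iff by (rule conjunct1)

lemma Gm_eqI:
  assumes "f \<in> carrier Gm" "h \<in> carrier Gm" "\<And>N. N \<in> NN \<Longrightarrow> f N = h N"
  shows "f = h"
  by (rule extensionalityI[OF Gm_ext[OF assms(1)] Gm_ext[OF assms(2)] assms(3)])

lemma repr_eqI:
  assumes "f \<in> carrier Gm" "h \<in> carrier Gm" "\<And>N. N \<in> NN \<Longrightarrow> \<exists>a. repr f N a \<and> repr h N a"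
  shows "f = h"
proof (rule Gm_eqI[OF assms(1,2)])
  fix N assume "N \<in> NN"
  from assms(3)[OF this] show "f N = h N" by (auto simp: repr_def)
qed

lemma repr_mult: "repr f N a \<Longrightarrow> repr h N b \<Longrightarrow> repr (f \<otimes>\<^bsub>Gm\<^esub> h) N (a \<otimes> b)"
  by (simp add: repr_def Gm_mult NN_mult)

lemma repr_one: "N \<in> NN \<Longrightarrow> repr \<one>\<^bsub>Gm\<^esub> N \<one>"
  by (simp add: repr_def Gm_one coset_mult_one NND(4))

lemma rp_coset:
  assumes "f \<in> carrier Gm" "N \<in> NN" "M \<in> NN" "N \<subseteq> M"
  shows "M #> rp f M = M #> rp f N"
  using reprD(3)[OF repr_rp[OF assms(1,3)]] reprD(3)[OF repr_compat[OF assms(1) repr_rp[OF assms(1,2)] assms(3,4)]] by simp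

lemma Gm_mult_closed:
  assumes "f \<in> carrier Gm" "h \<in> carrier Gm" shows "f \<otimes>\<^bsub>Gm\<^esub> h \<in> carrier Gm"
proof (rule GmI)
  show "f \<otimes>\<^bsub>Gm\<^esub> h \<in> extensional NN" by (simp add: Gm_mult)
  show "repr (f \<otimes>\<^bsub>Gm\<^esub> h) N (rp f N \<otimes> rp h N)" if "N \<in> NN" for N
    by (rule repr_mult[OF repr_rp[OF assms(1) that] repr_rp[OF assms(2) that]])
  fix N M assume NM: "N \<in> NN" "M \<in> NN" "N \<subseteq> M"
  note c = reprD(2)[OF repr_rp[OF assms(1) NM(1)]] reprD(2)[OF repr_rp[OF assms(1) NM(2)]]
    reprD(2)[OF repr_rp[OF assms(2) NM(1)]] reprD(2)[OF repr_rp[OF assms(2) NM(2)]]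
  show "M #> (rp f M \<otimes> rp h M) = M #> (rp f N \<otimes> rp h N)"
    unfolding NN_mult[OF NM(2) c(2,4), symmetric] NN_mult[OF NM(2) c(1,3), symmetric]
      rp_coset[OF assms(1) NM] rp_coset[OF assms(2) NM] ..
qed

lemma Gm_one_closed: "\<one>\<^bsub>Gm\<^esub> \<in> carrier Gm"
proof (rule GmI)
  show "\<one>\<^bsub>Gm\<^esub> \<in> extensional NN" by (simp add: Gm_one)
qed (rule repr_one, assumption, rule refl)

lemma Gm_group: "group Gm"
proof (rule groupI)
  show "f \<otimes>\<^bsub>Gm\<^esub> h \<otimes>\<^bsub>Gm\<^esub> k = f \<otimes>\<^bsub>Gm\<^esub> (h \<otimes>\<^bsub>Gm\<^esub> k)" if fhk: "f \<in> carrier Gm" "h \<in> carrier Gm" "k \<in> carrier Gm" for f h k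
  proof (rule repr_eqI)
    fix N assume N: "N \<in> NN"
    note r = repr_rp[OF fhk(1) N] repr_rp[OF fhk(2) N] repr_rp[OF fhk(3) N]
    have "repr (f \<otimes>\<^bsub>Gm\<^esub> h \<otimes>\<^bsub>Gm\<^esub> k) N (rp f N \<otimes> rp h N \<otimes> rp k N)"
      by (rule repr_mult[OF repr_mult[OF r(1,2)] r(3)])
    moreover have "repr (f \<otimes>\<^bsub>Gm\<^esub> (h \<otimes>\<^bsub>Gm\<^esub> k)) N (rp f N \<otimes> (rp h N \<otimes> rp k N))"
      by (rule repr_mult[OF r(1) repr_mult[OF r(2,3)]])
    ultimately show "\<exists>a. repr (f \<otimes>\<^bsub>Gm\<^esub> h \<otimes>\<^bsub>Gm\<^esub> k) N a \<and> repr (f \<otimes>\<^bsub>Gm\<^esub> (h \<otimes>\<^bsub>Gm\<^esub> k)) N a"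
      using r[THEN reprD(2)] by (auto simp: m_assoc)
  qed (intro Gm_mult_closed fhk)+
  show "\<one>\<^bsub>Gm\<^esub> \<otimes>\<^bsub>Gm\<^esub> f = f" if f: "f \<in> carrier Gm" for f
  proof (rule repr_eqI[OF Gm_mult_closed[OF Gm_one_closed f] f])
    fix N assume N: "N \<in> NN"
    note r = repr_rp[OF f N]
    show "\<exists>a. repr (\<one>\<^bsub>Gm\<^esub> \<otimes>\<^bsub>Gm\<^esub> f) N a \<and> repr f N a"
      using repr_mult[OF repr_one[OF N] r] r reprD(2)[OF r] by auto
  qed
  show "\<exists>h\<in>carrier Gm. h \<otimes>\<^bsub>Gm\<^esub> f = \<one>\<^bsub>Gm\<^esub>" if f: "f \<in> carrier Gm" for f
  proof -
    define h where "h = (\<lambda>N\<in>NN. N #> inv (rp f N))"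
    have rh: "repr h N (inv (rp f N))" if "N \<in> NN" for N
      using that reprD(2)[OF repr_rp[OF f that]] by (simp add: h_def repr_def)
    have h: "h \<in> carrier Gm"
    proof (rule GmI[OF _ rh])
      fix N M assume NM: "N \<in> NN" "M \<in> NN" "N \<subseteq> M"
      show "M #> inv (rp f M) = M #> inv (rp f N)"
        using normal.rcos_inv[OF NND(5)[OF NM(2)] reprD(2)[OF repr_rp[OF f NM(1)]]]
          normal.rcos_inv[OF NND(5)[OF NM(2)] reprD(2)[OF repr_rp[OF f NM(2)]]] rp_coset[OF f NM] by simp
    qed (simp_all add: h_def)
    have "h \<otimes>\<^bsub>Gm\<^esub> f = \<one>\<^bsub>Gm\<^esub>"
    proof (rule repr_eqI[OF Gm_mult_closed[OF h f] Gm_one_closed])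
      fix N assume N: "N \<in> NN"
      show "\<exists>a. repr (h \<otimes>\<^bsub>Gm\<^esub> f) N a \<and> repr \<one>\<^bsub>Gm\<^esub> N a"
        using repr_mult[OF rh[OF N] repr_rp[OF f N]] repr_one[OF N] reprD(2)[OF repr_rp[OF f N]] by auto
    qed
    then show ?thesis using h by blast
  qed
qed (intro Gm_mult_closed Gm_one_closed; assumption)+

lemma Gm_group_prime: "group_prime Gm p"
  by (simp add: group_prime_def group_prime_axioms_def Gm_group prime_p)

lemma repr_inv:
  assumes f: "f \<in> carrier Gm" and r: "repr f N a"
  shows "repr (inv\<^bsub>Gm\<^esub> f) N (inv a)"
proof -
  interpret Gm: group Gm by (rule Gm_group)
  note a = reprD[OF r]
  have fi: "inv\<^bsub>Gm\<^esub> f \<in> carrier Gm" using f by simp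
  note ri = repr_rp[OF fi a(1)]
  note b = reprD[OF ri]
  have "rp (inv\<^bsub>Gm\<^esub> f) N \<otimes> a \<in> N"
    using repr_eq[OF repr_mult[OF ri r] repr_one[OF a(1)]] Gm.l_inv[OF f] a(2) b(2) by simp
  then have "N #> rp (inv\<^bsub>Gm\<^esub> f) N = N #> inv a"
    using coset_eq_iff[OF NND(3)[OF a(1)] b(2), of "inv a"] a(2) by simp
  then show ?thesis using ri a(2) by (simp add: repr_def)
qed

definition emb :: "'a \<Rightarrow> 'a set \<Rightarrow> 'a set" where "emb g = (\<lambda>N\<in>NN. N #> g)"

lemma repr_emb: "N \<in> NN \<Longrightarrow> g \<in> carrier G \<Longrightarrow> repr (emb g) N g" by (simp add: emb_def repr_def)

lemma emb_closed: "g \<in> carrier G \<Longrightarrow> emb g \<in> carrier Gm"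
  by (rule GmI[OF _ repr_emb]) (simp_all add: emb_def)

lemma emb_mult:
  assumes "g \<in> carrier G" "h \<in> carrier G" shows "emb (g \<otimes> h) = emb g \<otimes>\<^bsub>Gm\<^esub> emb h"
proof (rule repr_eqI)
  fix N assume N: "N \<in> NN"
  show "\<exists>a. repr (emb (g \<otimes> h)) N a \<and> repr (emb g \<otimes>\<^bsub>Gm\<^esub> emb h) N a"
    using repr_mult[OF repr_emb[OF N assms(1)] repr_emb[OF N assms(2)]] repr_emb[OF N m_closed[OF assms]] by blast
qed (intro Gm_mult_closed emb_closed m_closed assms)+

text \<open>The closure of the image of \<open>K\<close> in the completion.\<close>

definition hat :: "'a set \<Rightarrow> ('a set \<Rightarrow> 'a set) set" where
  "hat K = {f \<in> carrier Gm. \<exists>N\<in>NN. N \<subseteq> K \<and> f N \<subseteq> K}"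

lemma coset_subset_iff:
  assumes "subgroup K G" "repr f N g" "N \<subseteq> K"
  shows "f N \<subseteq> K \<longleftrightarrow> g \<in> K"
proof
  note r = reprD[OF assms(2)]
  show "g \<in> K" if "f N \<subseteq> K" using that rcos_self[OF r(2) NND(3)[OF r(1)]] r(3) by blast
  show "f N \<subseteq> K" if "g \<in> K"
    unfolding r(3) r_coset_def using assms(3) sub_m[OF assms(1) _ that] by blast
qed

text \<open>Membership in the closure can be tested at any N contained in K, with any
  representative. Two choices of N are compared at their intersection.\<close>

lemma hat_iff:
  assumes "subgroup K G" "f \<in> carrier Gm" "repr f N g" "N \<subseteq> K"
  shows "f \<in> hat K \<longleftrightarrow> g \<in> K"
proof
  assume "g \<in> K"
  then have "f N \<subseteq> K" using coset_subset_iff[OF assms(1,3,4)] by simp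
  then show "f \<in> hat K" using assms(2,4) reprD(1)[OF assms(3)] unfolding hat_def by blast
next
  assume "f \<in> hat K"
  then obtain M where M: "M \<in> NN" "M \<subseteq> K" "f M \<subseteq> K" by (auto simp: hat_def)
  let ?L = "N \<inter> M"
  have r: "repr f ?L (rp f ?L)" by (rule repr_rp[OF assms(2) NN_Int[OF reprD(1)[OF assms(3)] M(1)]])
  have "repr f M (rp f ?L)" by (rule repr_compat[OF assms(2) r M(1)]) blast
  then have "rp f ?L \<in> K" using coset_subset_iff[OF assms(1) _ M(2)] M(3) by blast
  moreover have "repr f N (rp f ?L)" by (rule repr_compat[OF assms(2) r reprD(1)[OF assms(3)]]) blast
  ultimately have "f N \<subseteq> K" using coset_subset_iff[OF assms(1) _ assms(4)] by blast
  then show "g \<in> K" using coset_subset_iff[OF assms(1,3,4)] by simp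
qed

lemma p_open_NN: assumes "p_open p G K" obtains N where "N \<in> NN" "N \<subseteq> K"
  using assms by (auto simp: p_open_def)

lemma emb_hat:
  assumes "p_open p G K" "g \<in> carrier G"
  shows "emb g \<in> hat K \<longleftrightarrow> g \<in> K"
proof -
  from p_open_NN[OF assms(1)] obtain N where N: "N \<in> NN" "N \<subseteq> K" .
  show ?thesis by (rule hat_iff[OF p_open_subgroup[OF assms(1)] emb_closed[OF assms(2)] repr_emb[OF N(1) assms(2)] N(2)])
qed

lemma hat_subset: "hat K \<subseteq> carrier Gm" by (auto simp: hat_def)

lemma hat_subgroup:
  assumes "p_open p G K" shows "subgroup (hat K) Gm"
proof -
  interpret Gm: group Gm by (rule Gm_group)
  from p_open_NN[OF assms(1)] obtain N where N: "N \<in> NN" "N \<subseteq> K" .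
  have K: "subgroup K G" by (rule p_open_subgroup[OF assms])
  have iff: "f \<in> hat K \<longleftrightarrow> g \<in> K" if "f \<in> carrier Gm" "repr f N g" for f g
    by (rule hat_iff[OF K that N(2)])
  show ?thesis
  proof (rule Gm.subgroupI[OF hat_subset])
    show "hat K \<noteq> {}" using emb_hat[OF assms one_closed] sub_one[OF K] by blast
    show "inv\<^bsub>Gm\<^esub> f \<in> hat K" if f: "f \<in> hat K" for f
    proof -
      have fc: "f \<in> carrier Gm" using f hat_subset by blast
      note r = repr_rp[OF fc N(1)]
      have "inv (rp f N) \<in> K" using iff[OF fc r] f sub_i[OF K] by blast
      then show ?thesis using iff[OF Gm.inv_closed[OF fc] repr_inv[OF fc r]] by simp
    qed
    show "f \<otimes>\<^bsub>Gm\<^esub> h \<in> hat K" if fh: "f \<in> hat K" "h \<in> hat K" for f h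
    proof -
      have c: "f \<in> carrier Gm" "h \<in> carrier Gm" using fh hat_subset by blast+
      note r = repr_rp[OF c(1) N(1)] repr_rp[OF c(2) N(1)]
      have "rp f N \<otimes> rp h N \<in> K" using iff[OF c(1) r(1)] iff[OF c(2) r(2)] fh sub_m[OF K] by blast
      then show ?thesis using iff[OF Gm_mult_closed[OF c] repr_mult[OF r]] by simp
    qed
  qed
qed

lemma idx_hat:
  assumes "p_open p G K" shows "idx Gm (carrier Gm) (hat K) = idx G (carrier G) K"
proof -
  interpret Gm: group Gm by (rule Gm_group)
  from p_open_NN[OF assms(1)] obtain N where N: "N \<in> NN" "N \<subseteq> K" .
  have K: "subgroup K G" by (rule p_open_subgroup[OF assms])
  have "idx Gm (carrier Gm) (hat K) = card ((\<lambda>f. K #> rp f N) ` carrier Gm)"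
  proof (rule Gm.idx_eqI(1)[OF hat_subgroup[OF assms] subset_refl])
    fix f h assume fh: "f \<in> carrier Gm" "h \<in> carrier Gm"
    note r = repr_rp[OF fh(1) N(1)] repr_rp[OF fh(2) N(1)]
    have "repr (f \<otimes>\<^bsub>Gm\<^esub> inv\<^bsub>Gm\<^esub> h) N (rp f N \<otimes> inv (rp h N))"
      by (rule repr_mult[OF r(1) repr_inv[OF fh(2) r(2)]])
    then show "(K #> rp f N = K #> rp h N) = (f \<otimes>\<^bsub>Gm\<^esub> inv\<^bsub>Gm\<^esub> h \<in> hat K)"
      using hat_iff[OF K _ _ N(2), of "f \<otimes>\<^bsub>Gm\<^esub> inv\<^bsub>Gm\<^esub> h"] coset_eq_iff[OF K reprD(2)[OF r(1)] reprD(2)[OF r(2)]] fh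
      by simp
  qed
  also have "(\<lambda>f. K #> rp f N) ` carrier Gm = (\<lambda>g. K #> g) ` carrier G"
  proof (intro equalityI subsetI)
    fix X assume "X \<in> (\<lambda>g. K #> g) ` carrier G"
    then obtain g where g: "g \<in> carrier G" "X = K #> g" by blast
    note r = repr_rp[OF emb_closed[OF g(1)] N(1)]
    have "rp (emb g) N \<otimes> inv g \<in> N" using repr_eq[OF r repr_emb[OF N(1) g(1)]] by simp
    then have "K #> rp (emb g) N = X" using coset_eq_iff[OF K reprD(2)[OF r] g(1)] N(2) g(2) by blast
    then show "X \<in> (\<lambda>f. K #> rp f N) ` carrier Gm" using emb_closed[OF g(1)] by blast
  next
    fix X assume "X \<in> (\<lambda>f. K #> rp f N) ` carrier Gm"
    then obtain f where "f \<in> carrier Gm" "X = K #> rp f N" by blast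
    then show "X \<in> (\<lambda>g. K #> g) ` carrier G" using reprD(2)[OF repr_rp[OF _ N(1)]] by blast
  qed
  finally show ?thesis by (simp add: idx_def)
qed

end

section \<open>Subgroups of finite index in the completion\<close>

text \<open>R is the kernel of the permutation action on the finitely many right cosets of H; it
  fixes the coset H, so it lies in H, and its cosets embed into the finite set of maps between
  cosets.\<close>

lemma (in group) normal_core_finite_index:
  assumes "subgroup H G" "finite ((\<lambda>g. H #> g) ` carrier G)"
  shows "\<exists>R. nsub G R (carrier G) \<and> R \<subseteq> H \<and> finite ((\<lambda>g. R #> g) ` carrier G)"
proof -
  define C where "C = (\<lambda>g. H #> g) ` carrier G"
  have HC: "H \<subseteq> carrier G" by (rule subgroup.subset[OF assms(1)])
  have CC: "X \<subseteq> carrier G" if "X \<in> C" for X using that r_coset_subset_G[OF HC] by (auto simp: C_def)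
  have act: "X #> g #> h = X #> (g \<otimes> h)" if "X \<in> C" "g \<in> carrier G" "h \<in> carrier G" for X g h
    by (rule coset_mult_assoc[OF CC[OF that(1)] that(2,3)])
  have cl: "X #> g \<in> C" if X: "X \<in> C" "g \<in> carrier G" for X g
  proof -
    obtain a where a: "a \<in> carrier G" "X = H #> a" using X(1) by (auto simp: C_def)
    show ?thesis unfolding C_def a(2) coset_mult_assoc[OF HC a(1) X(2)] using a(1) X(2) by blast
  qed
  define R where "R = {g \<in> carrier G. \<forall>X\<in>C. X #> g = X}"
  have s: "subgroup R G"
  proof (rule subgroupI)
    show "R \<subseteq> carrier G" by (auto simp: R_def)
    show "R \<noteq> {}" using CC by (auto simp: R_def intro!: exI[of _ \<one>])
    show "inv g \<in> R" if g: "g \<in> R" for g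
    proof -
      have gc: "g \<in> carrier G" using g by (simp add: R_def)
      have "X #> inv g = X" if X: "X \<in> C" for X
        using act[OF X gc inv_closed[OF gc]] g X gc CC[OF X] by (simp add: R_def)
      then show ?thesis using gc by (simp add: R_def)
    qed
    show "g \<otimes> h \<in> R" if gh: "g \<in> R" "h \<in> R" for g h
    proof -
      have c: "g \<in> carrier G" "h \<in> carrier G" using gh by (simp_all add: R_def)
      have "X #> (g \<otimes> h) = X" if X: "X \<in> C" for X
        using act[OF X c] gh X by (simp add: R_def)
      then show ?thesis using c by (simp add: R_def)
    qed
  qed
  have n: "nsub G R (carrier G)"
    unfolding nsub_def
  proof (intro conjI ballI s subgroup_self subgroup.subset[OF s])
    fix k g assume k: "k \<in> carrier G" and g: "g \<in> R"
    have gc: "g \<in> carrier G" using g by (simp add: R_def)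
    have "X #> (k \<otimes> g \<otimes> inv k) = X" if X: "X \<in> C" for X
    proof -
      have "X #> (k \<otimes> g \<otimes> inv k) = X #> k #> g #> inv k"
        using act[OF cl[OF X k] gc inv_closed[OF k]] act[OF X k m_closed[OF gc inv_closed[OF k]]] k gc by (simp add: m_assoc)
      also have "\<dots> = X #> k #> inv k" using g cl[OF X k] by (simp add: R_def)
      also have "\<dots> = X" using act[OF X k inv_closed[OF k]] k CC[OF X] by simp
      finally show ?thesis .
    qed
    then show "k \<otimes> g \<otimes> inv k \<in> R" using k gc by (simp add: R_def)
  qed
  have RH: "R \<subseteq> H"
  proof
    fix g assume g: "g \<in> R"
    have "H \<in> C" unfolding C_def using coset_mult_one[OF HC] by (metis image_eqI one_closed)
    then have "H #> g = H #> \<one>" using g coset_mult_one[OF HC] by (simp add: R_def)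
    then show "g \<in> H" using coset_eq_iff[OF assms(1), of g \<one>] g by (simp add: R_def)
  qed
  define F where "F g = (\<lambda>X\<in>C. X #> g)" for g
  have iff: "F a = F b \<longleftrightarrow> a \<otimes> inv b \<in> R" if ab: "a \<in> carrier G" "b \<in> carrier G" for a b
  proof -
    have "F a = F b \<longleftrightarrow> (\<forall>X\<in>C. X #> a = X #> b)" by (auto simp: F_def restrict_def fun_eq_iff)
    also have "\<dots> \<longleftrightarrow> (\<forall>X\<in>C. X #> (a \<otimes> inv b) = X)"
    proof (rule ball_cong[OF refl])
      fix X assume X: "X \<in> C"
      have 1: "X #> (a \<otimes> inv b) = X #> a #> inv b" using act[OF X ab(1) inv_closed[OF ab(2)]] by simp
      have 2: "X #> b #> inv b = X" using act[OF X ab(2) inv_closed[OF ab(2)]] ab CC[OF X] by simp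
      have 3: "X #> a #> inv b #> b = X #> a" using act[OF cl[OF X ab(1)] inv_closed[OF ab(2)] ab(2)] ab CC[OF cl[OF X ab(1)]] by simp
      show "(X #> a = X #> b) = (X #> (a \<otimes> inv b) = X)" using 1 2 3 by metis
    qed
    also have "\<dots> \<longleftrightarrow> a \<otimes> inv b \<in> R" using ab by (simp add: R_def)
    finally show ?thesis .
  qed
  have "F ` carrier G \<subseteq> C \<rightarrow>\<^sub>E C" using cl by (auto simp: F_def)
  then have "finite (F ` carrier G)" using finite_PiE[of C "\<lambda>_. C"] assms(2) finite_subset unfolding C_def by blast
  then have "finite ((\<lambda>g. R #> g) ` carrier G)" using idx_eqI(2)[OF s subset_refl iff] by blast
  then show ?thesis using n RH by blast
qed

context group_prime
begin

text \<open>A descending sequence that is cofinal among the normal subgroups of p-power index. It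
  lets elements of the completion be built as limits of sequences instead of over the whole directed
  family.\<close>

definition pchain :: "(nat \<Rightarrow> 'a set) \<Rightarrow> bool" where
  "pchain c \<longleftrightarrow> (\<forall>k. c k \<in> NN) \<and> (\<forall>k. c (Suc k) \<subseteq> c k) \<and> (\<forall>N\<in>NN. \<exists>k. c k \<subseteq> N)"

lemma pchain_exists:
  assumes "finitely_generated G" "p_open p G L"
  obtains c where "pchain c" "c 0 \<subseteq> L"
proof -
  \<comment> \<open>Only finitely many normal subgroups have index at most p^k, so their
    intersection \<open>c k\<close> still has p-power index.\<close>
  define F where "F k = {N \<in> NN. idx G (carrier G) N \<le> p ^ k}" for k
  define c where "c k = \<Inter> (F k)" for k
  have fin: "finite (F k)" for k
    by (rule finite_subset[OF _ finite_open_of_index_le[OF assms(1), of "p ^ k"]]) (auto simp: F_def NND(6))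
  have "carrier G \<in> NN"
    using p_open_carrier p_open_pidx subgroup_self by (auto simp: p_power_normal_iff nsub_def)
  then have ne: "F k \<noteq> {}" for k using idx_carrier_self p_gt_1 by (auto simp: F_def)
  have cN: "c k \<in> NN" for k
    unfolding c_def p_power_normal_iff by (rule nsub_pidx_Inter[OF fin ne]) (simp add: F_def NND)
  have Fmono: "F k \<subseteq> F j" if "k \<le> j" for k j
  proof -
    have "p ^ k \<le> p ^ j" using power_increasing[OF that, of p] p_gt_1 by simp
    then show ?thesis by (auto simp: F_def)
  qed
  have cmono: "c j \<subseteq> c k" if "k \<le> j" for k j unfolding c_def using Fmono[OF that] by blast
  have cof: "\<exists>k. c k \<subseteq> N" if N: "N \<in> NN" for N
  proof -
    obtain k where "idx G (carrier G) N = p ^ k" using NND(2)[OF N] by (auto simp: pidx_def)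
    then have "N \<in> F k" using N by (simp add: F_def)
    then show ?thesis unfolding c_def by blast
  qed
  from p_open_NN[OF assms(2)] obtain N where N: "N \<in> NN" "N \<subseteq> L" .
  obtain k0 where k0: "c k0 \<subseteq> N" using cof[OF N(1)] by blast
  have "\<exists>k. c (k0 + k) \<subseteq> N" if "N \<in> NN" for N
    using cof[OF that] cmono by (meson le_add2 order_trans)
  then have "pchain (\<lambda>k. c (k0 + k))" using cN cmono by (simp add: pchain_def)
  then show thesis by (rule that) (use k0 N(2) in simp)
qed

lemma pchain_mono: "pchain c \<Longrightarrow> k \<le> j \<Longrightarrow> c j \<subseteq> c k"
  by (rule lift_Suc_antimono_le) (simp_all add: pchain_def)

text \<open>Completeness: a sequence that is compatible along a cofinal chain defines a compatible
  family on all of \<open>NN\<close>. Its value at N is read off at any chain member below N, and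
  the choice does not matter.\<close>

lemma pchain_lim:
  assumes c: "pchain c" and g: "\<And>k. g k \<in> carrier G" "\<And>k. c k #> g (Suc k) = c k #> g k"
  shows "\<exists>h\<in>carrier Gm. \<forall>k. repr h (c k) (g k)"
proof -
  have cN: "c k \<in> NN" for k using c by (simp add: pchain_def)
  have step: "g (Suc k) \<otimes> inv (g k) \<in> c k" for k using g(2) coset_eq_iff[OF NND(3)[OF cN] g(1) g(1)] by simp
  have gj: "c k #> g j = c k #> g k" if "k \<le> j" for j k
    using that
  proof (induction rule: dec_induct)
    case (step j)
    have "g (Suc j) \<otimes> inv (g j) \<in> c k" using \<open>\<And>k. g (Suc k) \<otimes> inv (g k) \<in> c k\<close>[of j] pchain_mono[OF c step(1)] by blast
    then have "c k #> g (Suc j) = c k #> g j" using coset_eq_iff[OF NND(3)[OF cN] g(1) g(1)] by simp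
    then show ?case using step.IH by simp
  qed simp
  have eq: "N #> g j = N #> g k" if N: "N \<in> NN" "c j \<subseteq> N" "c k \<subseteq> N" for N j k
  proof -
    have *: "N #> g j = N #> g k" if "k \<le> j" "c k \<subseteq> N" for j k
      using gj[OF that(1)] coset_eq_iff[OF NND(3)[OF cN] g(1) g(1)] coset_eq_iff[OF NND(3)[OF N(1)] g(1) g(1)] that(2) by blast
    show ?thesis using *[of j k] *[of k j] N(2,3) by (metis nle_le)
  qed
  define \<kappa> where "\<kappa> N = (SOME k. c k \<subseteq> N)" for N
  have \<kappa>: "c (\<kappa> N) \<subseteq> N" if "N \<in> NN" for N
    unfolding \<kappa>_def by (rule someI_ex) (use c that in \<open>simp add: pchain_def\<close>)
  define h where "h = (\<lambda>N\<in>NN. N #> g (\<kappa> N))"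
  have rh: "repr h N (g (\<kappa> N))" if "N \<in> NN" for N using that g(1) by (simp add: repr_def h_def)
  have "h \<in> carrier Gm"
  proof (rule GmI[OF _ rh])
    show "M #> g (\<kappa> M) = M #> g (\<kappa> N)" if "N \<in> NN" "M \<in> NN" "N \<subseteq> M" for N M
      by (rule eq[OF that(2) \<kappa>[OF that(2)]]) (use \<kappa>[OF that(1)] that(3) in blast)
  qed (simp_all add: h_def)
  moreover have "repr h (c k) (g k)" for k
    using rh[OF cN[of k]] eq[OF cN \<kappa>[OF cN] subset_refl, of k] g(1) by (simp add: repr_def)
  ultimately show ?thesis by blast
qed

lemma pchain_eqI:
  assumes c: "pchain c" and "f \<in> carrier Gm" "h \<in> carrier Gm" "\<And>k. \<exists>a. repr f (c k) a \<and> repr h (c k) a"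
  shows "f = h"
proof (rule repr_eqI[OF assms(2,3)])
  fix N assume N: "N \<in> NN"
  obtain k where k: "c k \<subseteq> N" using c N unfolding pchain_def by blast
  obtain a where "repr f (c k) a" "repr h (c k) a" using assms(4) by blast
  then show "\<exists>a. repr f N a \<and> repr h N a"
    using repr_compat[OF assms(2) _ N k] repr_compat[OF assms(3) _ N k] by blast
qed

lemma repr_pow: "N \<in> NN \<Longrightarrow> repr f N a \<Longrightarrow> repr (f [^]\<^bsub>Gm\<^esub> (n::nat)) N (a [^] n)"
proof (induction n)
  case 0 then show ?case using repr_one by simp
next
  case (Suc n) then show ?case using repr_mult[of "f [^]\<^bsub>Gm\<^esub> n" N "a [^] n" f a] by simp
qed

lemma pow_cong_mem:
  assumes "N \<in> NN" "[a = b] (mod idx G (carrier G) N)" "x \<in> carrier G"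
  shows "x [^] a \<otimes> inv (x [^] b) \<in> N"
proof -
  let ?q = "idx G (carrier G) N"
  have "int ?q dvd int a - int b" using assms(2) by (metis cong_iff_dvd_diff cong_int_iff)
  then obtain t where t: "int a - int b = int ?q * t" by (elim dvdE)
  have "x [^] ?q \<in> N" by (rule nsub_pow_idx[OF NND(1)[OF assms(1)] assms(3)])
  then have "(x [^] ?q) [^] t \<in> N" by (rule sub_ipow[OF NND(3)[OF assms(1)]])
  moreover have "(x [^] ?q) [^] t = x [^] (int a - int b)"
    using int_pow_pow[OF assms(3), of "int ?q" t] by (simp add: int_pow_int t)
  moreover have "x [^] (int a - int b) = x [^] a \<otimes> inv (x [^] b)"
    using int_pow_diff[OF assms(3)] by (simp add: int_pow_int)
  ultimately show ?thesis by simp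
qed

text \<open>In the finite p-group G/N the m-th root is the power with exponent an inverse of m
  modulo [G : N]. Inverses are unique modulo the index, so the roots at different N are
  compatible.\<close>

lemma Gm_root:
  assumes "coprime m p" "f \<in> carrier Gm"
  shows "\<exists>h\<in>carrier Gm. h [^]\<^bsub>Gm\<^esub> m = f"
proof -
  let ?q = "\<lambda>N. idx G (carrier G) N"
  have cop: "coprime m (?q N)" if "N \<in> NN" for N
    using NND(2)[OF that] assms(1) by (auto simp: pidx_def)
  have "\<exists>e. [m * e = 1] (mod ?q N)" if "N \<in> NN" for N
    using cong_solve_coprime_nat[OF cop[OF that]] by simp
  then obtain e where e: "\<And>N. N \<in> NN \<Longrightarrow> [m * e N = 1] (mod ?q N)" by metis
  define h where "h = (\<lambda>N\<in>NN. N #> rp f N [^] e N)"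
  note r = repr_rp[OF assms(2)]
  have rh: "repr h N (rp f N [^] e N)" if "N \<in> NN" for N
    using that reprD(2)[OF r[OF that]] by (simp add: repr_def h_def)
  have hG: "h \<in> carrier Gm"
  proof (rule GmI[OF _ rh])
    fix N M assume NM: "N \<in> NN" "M \<in> NN" "N \<subseteq> M"
    note c = reprD(2)[OF r[OF NM(1)]] reprD(2)[OF r[OF NM(2)]]
    have "?q N = ?q M * idx G M N"
      by (rule idx_tower[OF NND(3)[OF NM(1)] NND(3)[OF NM(2)] subgroup_self NM(3) NND(4)[OF NM(2)]])
    then have "[m * e N = 1] (mod ?q M)" using e[OF NM(1)] by (metis cong_modulus_mult_nat)
    then have "[m * e M = m * e N] (mod ?q M)" using e[OF NM(2)] by (metis cong_sym cong_trans)
    then have "[e M = e N] (mod ?q M)" using cop[OF NM(2)] by (simp add: cong_mult_lcancel_nat coprime_commute)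
    then have "rp f N [^] e M \<otimes> inv (rp f N [^] e N) \<in> M" by (rule pow_cong_mem[OF NM(2) _ c(1)])
    then have "M #> rp f N [^] e M = M #> rp f N [^] e N"
      using coset_eq_iff[OF NND(3)[OF NM(2)], of "rp f N [^] e M" "rp f N [^] e N"] c by simp
    moreover have "M #> rp f M [^] e M = M #> rp f N [^] e M"
      using normal.FactGroup_pow[OF NND(5)[OF NM(2)] c(1), of "e M"] normal.FactGroup_pow[OF NND(5)[OF NM(2)] c(2), of "e M"]
        rp_coset[OF assms(2) NM] by simp
    ultimately show "M #> rp f M [^] e M = M #> rp f N [^] e N" by simp
  qed (simp_all add: h_def)
  have "h [^]\<^bsub>Gm\<^esub> m = f"
  proof (rule Gm_eqI)
    interpret Gm: group Gm by (rule Gm_group)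
    show "h [^]\<^bsub>Gm\<^esub> m \<in> carrier Gm" using hG by simp
    show "f \<in> carrier Gm" by (rule assms(2))
    fix N assume N: "N \<in> NN"
    note c = reprD(2)[OF r[OF N]]
    have "rp f N [^] (m * e N) \<otimes> inv (rp f N [^] (1::nat)) \<in> N" by (rule pow_cong_mem[OF N e[OF N] c])
    then show "(h [^]\<^bsub>Gm\<^esub> m) N = f N"
      using repr_eq[OF repr_pow[OF N rh[OF N]] r[OF N]] c by (simp add: nat_pow_pow mult.commute)
  qed
  then show ?thesis using hG by blast
qed

text \<open>Let the index be p^r m with m prime to p. Each element of the quotient is an m-th power,
  so its p^r-th power is trivial; hence no prime divisor of m can be the order of an element, and m
  = 1.\<close>

lemma Gm_finite_index_p_power:
  assumes "nsub Gm R (carrier Gm)" "finite ((\<lambda>g. R #>\<^bsub>Gm\<^esub> g) ` carrier Gm)"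
  shows "\<exists>k. idx Gm (carrier Gm) R = p ^ k"
proof -
  interpret Gm: group_prime Gm p by (rule Gm_group_prime)
  let ?q = "idx Gm (carrier Gm) R"
  have q0: "?q \<noteq> 0" using assms(2) Gm.one_closed by (auto simp: idx_def)
  obtain m where m: "?q = p ^ multiplicity p ?q * m" "\<not> p dvd m"
    using multiplicity_decompose'[of ?q p] q0 p_gt_1 by (metis nat_dvd_1_iff_1 less_irrefl)
  define r where "r = multiplicity p ?q"
  have cop: "coprime m p" using m(2) prime_p by (metis coprime_commute prime_imp_coprime)
  interpret N: normal R Gm using assms(1) Gm.normal_iff_nsub_carrier by blast
  let ?Q = "Gm Mod R"
  interpret Q: group ?Q by (rule N.factorgroup_is_group)
  have car: "carrier ?Q = (\<lambda>g. R #>\<^bsub>Gm\<^esub> g) ` carrier Gm" by (simp add: carrier_FactGroup)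
  have ord: "order ?Q = ?q" by (simp add: order_def car idx_def)
  have kill: "X [^]\<^bsub>?Q\<^esub> (p ^ r) = \<one>\<^bsub>?Q\<^esub>" if X: "X \<in> carrier ?Q" for X
  proof -
    obtain f where f: "f \<in> carrier Gm" "X = R #>\<^bsub>Gm\<^esub> f" using X car by blast
    obtain h where h: "h \<in> carrier Gm" "h [^]\<^bsub>Gm\<^esub> m = f" using Gm_root[OF cop f(1)] by blast
    have Y: "R #>\<^bsub>Gm\<^esub> h \<in> carrier ?Q" using h(1) car by blast
    have "X = (R #>\<^bsub>Gm\<^esub> h) [^]\<^bsub>?Q\<^esub> m" using f(2) h(2) N.FactGroup_pow[OF h(1), of m] by simp
    then have "X [^]\<^bsub>?Q\<^esub> (p ^ r) = (R #>\<^bsub>Gm\<^esub> h) [^]\<^bsub>?Q\<^esub> (m * p ^ r)" using Q.nat_pow_pow[OF Y] by simp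
    also have "m * p ^ r = order ?Q" using m(1) ord by (simp add: r_def mult.commute)
    finally show ?thesis using Q.pow_order_eq_1[OF Y] by simp
  qed
  have "m = 1"
  proof (rule ccontr)
    assume "m \<noteq> 1"
    \<comment> \<open>Cauchy's theorem for s, obtained from Sylow's with exponent 1. An element of
      order s that is also killed by p^r is trivial by Bezout.\<close>
    then obtain s where s: "Factorial_Ring.prime s" "s dvd m" using prime_factor_nat by blast
    then obtain t where t: "m = s * t" by (elim dvdE)
    have "order ?Q = p ^ r * m" unfolding ord r_def by (rule m(1))
    then have "order ?Q = s ^ 1 * (p ^ r * t)" using t by simp
    moreover have "finite (carrier ?Q)" using assms(2) car by simp
    ultimately obtain S where S: "subgroup S ?Q" "card S = s ^ 1"
      using sylow_thm[OF s(1) Q.is_group] by blast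
    have "card S > 1" using S(2) prime_gt_1_nat[OF s(1)] by simp
    then obtain X where X: "X \<in> S" "X \<noteq> \<one>\<^bsub>?Q\<^esub>"
      by (metis card_1_singletonE less_irrefl Q.sub_one[OF S(1)] card_le_Suc0_iff_eq card.infinite not_one_less_zero One_nat_def not_le)
    have XQ: "X \<in> carrier ?Q" by (rule Q.sub_in[OF S(1) X(1)])
    interpret S: group "?Q\<lparr>carrier := S\<rparr>" by (rule Q.subgroup_imp_group[OF S(1)])
    have Xs: "X [^]\<^bsub>?Q\<^esub> s = \<one>\<^bsub>?Q\<^esub>"
      using S.pow_order_eq_1[of X] X(1) S(2) by (simp add: order_def flip: Q.nat_pow_consistent)
    have "coprime s (p ^ r)" using coprime_divisors[OF s(2) dvd_refl cop] by simp
    then obtain u v where uv: "u * int s + v * int (p ^ r) = 1"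
      using bezout_int[of "int s" "int (p ^ r)"] by (metis coprime_iff_gcd_eq_1 coprime_int_iff)
    have "X = X [^]\<^bsub>?Q\<^esub> (int s * u + int (p ^ r) * v)" using uv XQ by (simp add: Q.int_pow_1 mult.commute)
    also have "\<dots> = (X [^]\<^bsub>?Q\<^esub> int s) [^]\<^bsub>?Q\<^esub> u \<otimes>\<^bsub>?Q\<^esub> (X [^]\<^bsub>?Q\<^esub> int (p ^ r)) [^]\<^bsub>?Q\<^esub> v"
      by (simp only: Q.int_pow_mult[OF XQ] Q.int_pow_pow[OF XQ])
    also have "\<dots> = \<one>\<^bsub>?Q\<^esub>" unfolding int_pow_int Xs kill[OF XQ] Q.int_pow_one by (rule Q.l_one[OF Q.one_closed])
    finally show False using X(2) by blast
  qed
  then show ?thesis using m(1) by (metis mult.right_neutral)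
qed

lemma Gm_finite_index_p_open:
  assumes "finite_index Gm H" shows "p_open p Gm H"
proof -
  interpret Gm: group_prime Gm p by (rule Gm_group_prime)
  have H: "subgroup H Gm" "finite ((\<lambda>g. H #>\<^bsub>Gm\<^esub> g) ` carrier Gm)"
    using assms by (simp_all add: finite_index_def RCOSETS_def UNION_singleton_eq_range)
  from Gm.normal_core_finite_index[OF H] obtain R
    where R: "nsub Gm R (carrier Gm)" "R \<subseteq> H" "finite ((\<lambda>g. R #>\<^bsub>Gm\<^esub> g) ` carrier Gm)" by blast
  then have "R \<in> p_power_normal p Gm"
    using Gm_finite_index_p_power[OF R(1,3)] by (simp add: Gm.p_power_normal_iff Gm.pidx_def)
  then show ?thesis using H(1) R(2) unfolding p_open_def by blast
qed

section \<open>Openness of the subgroups of finite index in the completion\<close>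

lemma idx_subgroup: "idx (G\<lparr>carrier := K\<rparr>) A B = idx G A B"
  by (simp add: idx_def)

lemma nsub_subgroup_iff:
  assumes "subgroup K G" "B \<subseteq> K"
  shows "nsub (G\<lparr>carrier := K\<rparr>) A B \<longleftrightarrow> nsub G A B"
proof -
  have sg: "subgroup H (G\<lparr>carrier := K\<rparr>) \<longleftrightarrow> subgroup H G" if "H \<subseteq> K" for H
    using incl_subgroup[OF assms(1), of H] subgroup_incl[OF _ assms(1) that] by blast
  have inv: "inv\<^bsub>G\<lparr>carrier := K\<rparr>\<^esub> k = inv k" if "k \<in> B" for k
    using m_inv_consistent[OF assms(1)] that assms(2) by blast
  show ?thesis
    unfolding nsub_def using sg[of A] sg[of B] inv assms(2) by auto
qed

text \<open>L is the Frattini subgroup of K. The list xs generates K and is fixed before N is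
  chosen, so the number of commutators needed modulo N does not grow with N. Nilpotency of K/N turns
  approximation along the lower central series into equality modulo N.\<close>

lemma p_open_frattini:
  assumes "finitely_generated G" "p_open p G K"
  obtains xs L where "set xs \<subseteq> K" "p_open p G L" "L \<subseteq> K"
    "\<And>l N. l \<in> L \<Longrightarrow> N \<in> NN \<Longrightarrow> N \<subseteq> K \<Longrightarrow>
      \<exists>y as. y \<in> K \<and> set as \<subseteq> K \<and> length as = length xs \<and> N #> l = N #> (commut_prod xs as \<otimes> y [^] p)"
proof -
  have K: "subgroup K G" by (rule p_open_subgroup[OF assms(2)])
  let ?K = "G\<lparr>carrier := K\<rparr>"
  interpret K: group_prime ?K p by (rule group_prime_subgroup[OF K])
  have KC: "K \<subseteq> carrier G" by (rule subgroup.subset[OF K])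
  obtain S where S: "finite S" "S \<subseteq> K" "generate ?K S = K"
    using p_open_finitely_generated[OF assms] by (auto simp: finitely_generated_def)
  from S(1) obtain xs where xs: "set xs = S" using finite_list by blast
  have xsK: "set xs \<subseteq> carrier ?K" "generate ?K (set xs) = carrier ?K" using S(2,3) xs by simp_all
  have commut_prod: "K.commut_prod xs as = commut_prod xs as" if "set as \<subseteq> K" "length as = length xs" for as
  proof -
    have "(\<lambda>x. x) \<in> hom ?K G" using KC by (auto simp: hom_def)
    from commut_prod_hom(2)[OF K.is_group is_group this xsK(1), of as] that show ?thesis by simp
  qed
  have pidx_eq: "K.pidx A B \<longleftrightarrow> pidx A B" for A B by (simp add: K.pidx_def pidx_def idx_subgroup)
  have nK: "nsub G K.frattini K" using K.nsub_frattini nsub_subgroup_iff[OF K subset_refl] by simp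
  have L: "p_open p G K.frattini"
    using p_open_nsub[OF assms(2) nK] K.pidx_frattini[OF xsK] by (simp add: pidx_eq)
  have width: "\<exists>y as. y \<in> K \<and> set as \<subseteq> K \<and> length as = length xs \<and> N #> l = N #> (commut_prod xs as \<otimes> y [^] p)"
    if l: "l \<in> K.frattini" and N: "N \<in> NN" "N \<subseteq> K" for l N
  proof -
    obtain y where y: "l \<in> K" "y \<in> K" "l \<otimes>\<^bsub>?K\<^esub> inv\<^bsub>?K\<^esub> (y [^]\<^bsub>?K\<^esub> p) \<in> K.lower_central 1"
      using l unfolding K.frattini_def by auto
    define b where "b = l \<otimes> inv (y [^] p)"
    have yp: "y [^] p \<in> K" by (rule sub_pow[OF K y(2)])
    have b: "b \<in> K.lower_central 1"
      using y(3) m_inv_consistent[OF K yp] by (simp add: b_def del: K.lower_central.simps flip: nat_pow_consistent)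
    have nN: "nsub ?K N (carrier ?K)" "K.pidx (carrier ?K) N"
    proof -
      have "nsub G N K" using NND(1)[OF N(1)] K N(2) KC by (auto simp: nsub_def)
      then show "nsub ?K N (carrier ?K)" using nsub_subgroup_iff[OF K subset_refl] by simp
      show "K.pidx (carrier ?K) N"
        using pidx_tower[OF NND(3)[OF N(1)] K subgroup_self N(2) KC] NND(2)[OF N(1)] by (simp add: pidx_eq)
    qed
    from K.lower_central_le_p_power_index[OF nN] obtain n where n: "K.lower_central n \<subseteq> N" by blast
    from K.derived_width[OF xsK b, of n] obtain as
      where as: "set as \<subseteq> K" "length as = length xs" "inv\<^bsub>?K\<^esub> (K.commut_prod xs as) \<otimes>\<^bsub>?K\<^esub> b \<in> K.lower_central (Suc n)" by auto
    have "K.commut_prod xs as \<in> carrier ?K" by (rule K.commut_prod_closed) (use xsK as in simp_all)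
    then have cpK: "commut_prod xs as \<in> K" using commut_prod[OF as(1,2)] by simp
    have c: "commut_prod xs as \<in> carrier G" "b \<in> carrier G" "y [^] p \<in> carrier G" "l \<in> carrier G"
      using cpK yp y(1) KC by (auto simp: b_def)
    have "inv (commut_prod xs as) \<otimes> b \<in> N"
      using as(3) K.lower_central_Suc_subset[of n] n m_inv_consistent[OF K cpK] commut_prod[OF as(1,2)] by auto
    then have "commut_prod xs as \<otimes> (inv (commut_prod xs as) \<otimes> b) \<otimes> inv (commut_prod xs as) \<in> N"
      using nsubD(4)[OF NND(1)[OF N(1)] c(1)] by blast
    then have "b \<otimes> inv (commut_prod xs as) \<in> N" using c by (simp add: m_assoc)
    then have "l \<otimes> inv (commut_prod xs as \<otimes> y [^] p) \<in> N" using c by (simp add: b_def m_assoc inv_mult_group)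
    then have "N #> l = N #> (commut_prod xs as \<otimes> y [^] p)"
      using coset_eq_iff[OF NND(3)[OF N(1)], of l "commut_prod xs as \<otimes> y [^] p"] c by simp
    then show ?thesis using y(2) as(1,2) by blast
  qed
  show thesis by (rule that[OF _ L nsubD(3)[OF nK] width]) (use S(2) xs in simp_all)
qed

lemma repr_commut_prod:
  assumes "length fs = length xs" "length hs = length xs" "length as = length xs" "N \<in> NN"
    "\<And>i. i < length xs \<Longrightarrow> fs ! i \<in> carrier Gm \<and> repr (fs ! i) N (xs ! i)"
    "\<And>i. i < length xs \<Longrightarrow> hs ! i \<in> carrier Gm \<and> repr (hs ! i) N (as ! i)"
  shows "repr (group.commut_prod Gm fs hs) N (commut_prod xs as)"
  using assms
proof (induction xs arbitrary: fs hs as)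
  case Nil
  then show ?case using repr_one by (simp add: group.commut_prod.simps[OF Gm_group])
next
  case (Cons x xs)
  interpret Gm: group Gm by (rule Gm_group)
  obtain f fs' where fs: "fs = f # fs'" using Cons.prems by (cases fs) auto
  obtain h hs' where hs: "hs = h # hs'" using Cons.prems by (cases hs) auto
  obtain a as' where as: "as = a # as'" using Cons.prems by (cases as) auto
  have f: "f \<in> carrier Gm" "repr f N x" using Cons.prems(5)[of 0] fs by simp_all
  have h: "h \<in> carrier Gm" "repr h N a" using Cons.prems(6)[of 0] hs as by simp_all
  have "repr (Gm.commut f h) N (commut x a)"
    unfolding Gm.commut_def commut_def by (rule repr_mult[OF repr_mult[OF repr_mult[OF f(2) h(2)] repr_inv[OF f]] repr_inv[OF h]])
  moreover have "repr (Gm.commut_prod fs' hs') N (commut_prod xs as')"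
  proof (rule Cons.IH)
    show "fs' ! i \<in> carrier Gm \<and> repr (fs' ! i) N (xs ! i)" if "i < length xs" for i
      using Cons.prems(5)[of "Suc i"] that fs by simp
    show "hs' ! i \<in> carrier Gm \<and> repr (hs' ! i) N (as' ! i)" if "i < length xs" for i
      using Cons.prems(6)[of "Suc i"] that hs as by simp
  qed (use Cons.prems fs hs as in simp_all)
  ultimately show ?case using repr_mult fs hs as by simp
qed

lemma homs_commut_prod:
  assumes "\<chi> \<in> homs p G K" "subgroup K G"
  shows "set xs \<subseteq> K \<Longrightarrow> set as \<subseteq> K \<Longrightarrow> length as = length xs \<Longrightarrow> commut_prod xs as \<in> K \<and> \<chi> (commut_prod xs as) = 0"
proof (induction xs arbitrary: as)
  case Nil then show ?case using homs_one[OF assms] sub_one[OF assms(2)] by simp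
next
  case (Cons x xs)
  obtain a as' where as: "as = a # as'" using Cons.prems by (cases as) auto
  have x: "x \<in> K" "a \<in> K" using Cons.prems as by auto
  have xa: "x \<otimes> a \<otimes> inv x \<in> K" using sub_m[OF assms(2) sub_m[OF assms(2) x] sub_i[OF assms(2) x(1)]] .
  have cmK: "commut x a \<in> K" unfolding commut_def by (rule sub_m[OF assms(2) xa sub_i[OF assms(2) x(2)]])
  have "\<chi> (commut x a) = 0"
    unfolding commut_def homsD(5)[OF assms(1) xa sub_i[OF assms(2) x(2)]]
    using homs_conj[OF assms x] homs_inv[OF assms x(2)] by (simp add: mod_simps)
  moreover have "commut_prod xs as' \<in> K \<and> \<chi> (commut_prod xs as') = 0" using Cons as by simp
  ultimately show ?case using as cmK sub_m[OF assms(2) cmK] homsD(5)[OF assms(1) cmK] by simp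
qed

text \<open>Solving the width equation in all the finite groups \<open>K/c k\<close> compatibly (by Koenig's lemma) shows
  that the closure of \<open>K\<^sup>p[K, K]\<close> consists of products of \<open>p\<close>-th powers and commutators of \<open>hat K\<close>, so
  that it lies in every subgroup of index \<open>p\<close>.\<close>

lemma hat_max_open:
  assumes fg: "finitely_generated G" and K: "p_open p G K" and M: "nsub Gm M (hat K)" "idx Gm (hat K) M = p"
  shows "\<exists>L. p_open p G L \<and> L \<subseteq> K \<and> hat L \<subseteq> M"
proof -
  interpret Gm: group_prime Gm p by (rule Gm_group_prime)
  from p_open_frattini[OF fg K] obtain xs L where xs: "set xs \<subseteq> K" and L: "p_open p G L" "L \<subseteq> K"
    and width: "\<And>l N. l \<in> L \<Longrightarrow> N \<in> NN \<Longrightarrow> N \<subseteq> K \<Longrightarrow>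
      \<exists>y as. y \<in> K \<and> set as \<subseteq> K \<and> length as = length xs \<and> N #> l = N #> (commut_prod xs as \<otimes> y [^] p)" by metis
  have Ks: "subgroup K G" and Ls: "subgroup L G" using p_open_subgroup K L(1) by auto
  have KC: "K \<subseteq> carrier G" by (rule subgroup.subset[OF Ks])
  have hK: "subgroup (hat K) Gm" by (rule hat_subgroup[OF K])
  have "M \<in> Gm.index_p_normals (hat K)" using M by (simp add: Gm.index_p_normals_def)
  from Gm.index_p_normals_proper[OF this] obtain x where x: "x \<in> hat K" "x \<notin> M" .
  \<comment> \<open>The subgroup M is the kernel of an abstract homomorphism \<chi> to the prime
    field. It will be evaluated only on commutators and p-th powers, where it vanishes.\<close>
  from Gm.hom_of_nsub[OF M x] obtain \<chi> where \<chi>: "\<chi> \<in> homs p Gm (hat K)" "{g \<in> hat K. \<chi> g = 0} = M" .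
  have "f \<in> M" if fL: "f \<in> hat L" for f
  proof -
    from pchain_exists[OF fg L(1)] obtain c where c: "pchain c" "c 0 \<subseteq> L" .
    have cN: "c k \<in> NN" for k using c(1) by (simp add: pchain_def)
    have cL: "c k \<subseteq> L" for k using pchain_mono[OF c(1), of 0 k] c(2) by simp
    have cK: "c k \<subseteq> K" for k using cL L(2) by blast
    have f: "f \<in> carrier Gm" using fL hat_subset by blast
    \<comment> \<open>A vector v solves the width equation for f modulo \<open>c k\<close>: its head
      is the element whose p-th power occurs, its tail holds the second entries of the
      commutators.\<close>
    define good where "good k v \<longleftrightarrow> set v \<subseteq> K \<and> length v = Suc (length xs) \<and> repr f (c k) (commut_prod xs (tl v) \<otimes> hd v [^] p)" for k v
    \<comment> \<open>Solutions are recorded by the cosets of their entries modulo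
      \<open>c k\<close>. There are finitely many of these, as required for Koenig's lemma, and they
      project from level k + 1 to level k.\<close>
    define X where "X k = map (\<lambda>g. c k #> g) ` {v. good k v}" for k
    have "\<exists>F. \<forall>k. F k \<in> X k \<and> F k = map (\<lambda>Y. c k <#> Y) (F (Suc k))"
    proof (rule koenig[where R = "\<lambda>k C C'. C = map (\<lambda>Y. c k <#> Y) C'"])
      show "finite (X k)" for k
      proof (rule finite_subset)
        show "X k \<subseteq> {C. set C \<subseteq> (\<lambda>g. c k #> g) ` carrier G \<and> length C = Suc (length xs)}"
        proof
          fix C assume "C \<in> X k"
          then obtain v where v: "set v \<subseteq> K" "length v = Suc (length xs)" "C = map (\<lambda>g. c k #> g) v"
            by (auto simp: X_def good_def)
          then show "C \<in> {C. set C \<subseteq> (\<lambda>g. c k #> g) ` carrier G \<and> length C = Suc (length xs)}"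
            using KC by (simp add: image_mono subset_trans)
        qed
        show "finite {C. set C \<subseteq> (\<lambda>g. c k #> g) ` carrier G \<and> length C = Suc (length xs)}"
          by (rule finite_lists_length_eq[OF pidx_finite[OF NND(2)[OF cN]]])
      qed
      show "X k \<noteq> {}" for k
      proof -
        note r = repr_rp[OF f cN[of k]]
        have "rp f (c k) \<in> L" using hat_iff[OF Ls f r cL] fL by simp
        from width[OF this cN cK] obtain y as where "y \<in> K" "set as \<subseteq> K" "length as = length xs"
          "c k #> rp f (c k) = c k #> (commut_prod xs as \<otimes> y [^] p)" by blast
        moreover from this have "commut_prod xs as \<otimes> y [^] p \<in> carrier G"
          using commut_prod_closed[of xs as] xs KC by (simp add: subset_iff)
        ultimately have "good k (y # as)" using r by (simp add: good_def repr_def)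
        then show ?thesis by (auto simp: X_def)
      qed
      show "\<exists>C\<in>X k. C = map (\<lambda>Y. c k <#> Y) C'" if C': "C' \<in> X (Suc k)" for k C'
      proof -
        obtain v where v: "good (Suc k) v" "C' = map (\<lambda>g. c (Suc k) #> g) v" using C' by (auto simp: X_def)
        have sub: "c (Suc k) \<subseteq> c k" using c(1) by (simp add: pchain_def)
        have "good k v" using v(1) repr_compat[OF f _ cN sub] by (auto simp: good_def)
        moreover have "map (\<lambda>Y. c k <#> Y) C' = map (\<lambda>g. c k #> g) v"
          unfolding v(2) using v(1) KC NN_proj[OF cN cN sub] by (auto simp: good_def)
        ultimately show ?thesis by (auto simp: X_def)
      qed
    qed
    then obtain F where F: "\<And>k. F k \<in> X k" "\<And>k. F k = map (\<lambda>Y. c k <#> Y) (F (Suc k))" by blast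
    have "\<forall>k. \<exists>v. good k v \<and> F k = map (\<lambda>g. c k #> g) v" using F(1) by (auto simp: X_def)
    then obtain v where v: "\<And>k. good k (v k)" "\<And>k. F k = map (\<lambda>g. c k #> g) (v k)" by metis
    have len: "length (v k) = Suc (length xs)" for k using v(1) by (simp add: good_def)
    have vK: "v k ! i \<in> K" if "i < Suc (length xs)" for k i
      using v(1)[of k] len[of k] that by (auto simp: good_def)
    \<comment> \<open>Along the infinite path the i-th entries are compatible from level to level,
      so each coordinate has a limit in the completion.\<close>
    have "\<exists>h\<in>carrier Gm. \<forall>k. repr h (c k) (v k ! i)" if i: "i < Suc (length xs)" for i
    proof (rule pchain_lim[OF c(1)])
      show "v k ! i \<in> carrier G" for k using vK[OF i] KC by blast
      fix k
      have sub: "c (Suc k) \<subseteq> c k" using c(1) by (simp add: pchain_def)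
      have "c k #> (v k ! i) = F k ! i" using v(2) len i by simp
      also have "\<dots> = c k <#> (F (Suc k) ! i)"
        by (subst F(2)) (use v(2)[of "Suc k"] len i in simp)
      also have "\<dots> = c k <#> (c (Suc k) #> (v (Suc k) ! i))" using v(2)[of "Suc k"] len i by simp
      also have "\<dots> = c k #> (v (Suc k) ! i)"
        by (rule NN_proj[OF cN cN sub]) (use vK[OF i] KC in blast)
      finally show "c k #> (v (Suc k) ! i) = c k #> (v k ! i)" by simp
    qed
    then obtain h where h: "\<And>i. i < Suc (length xs) \<Longrightarrow> h i \<in> carrier Gm"
      "\<And>i k. i < Suc (length xs) \<Longrightarrow> repr (h i) (c k) (v k ! i)" by metis
    have hhK: "h i \<in> hat K" if "i < Suc (length xs)" for i
      using hat_iff[OF Ks h(1)[OF that] h(2)[OF that] cK] vK[OF that] by blast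
    define hs where "hs = map (\<lambda>i. h (Suc i)) [0..<length xs]"
    have hs: "set hs \<subseteq> hat K" "length hs = length xs" using hhK by (auto simp: hs_def)
    define es where "es = map emb xs"
    have es: "set es \<subseteq> hat K" "length es = length xs" using emb_hat[OF K] xs KC by (auto simp: es_def)
    let ?w = "Gm.commut_prod es hs \<otimes>\<^bsub>Gm\<^esub> h 0 [^]\<^bsub>Gm\<^esub> p"
    have cp: "Gm.commut_prod es hs \<in> hat K" "\<chi> (Gm.commut_prod es hs) = 0"
      using Gm.homs_commut_prod[OF \<chi>(1) hK es(1) hs(1)] es(2) hs(2) by auto
    have h0: "h 0 [^]\<^bsub>Gm\<^esub> p \<in> hat K" "\<chi> (h 0 [^]\<^bsub>Gm\<^esub> p) = 0"
      using Gm.sub_pow[OF hK hhK] Gm.homs_pow[OF \<chi>(1) hK hhK] by simp_all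
    have w: "?w \<in> hat K" by (rule Gm.sub_m[OF hK cp(1) h0(1)])
    \<comment> \<open>Both sides have a common representative modulo every \<open>c k\<close>: the
      width equation holds at each level, and the chain is cofinal.\<close>
    have "f = ?w"
    proof (rule pchain_eqI[OF c(1) f])
      show "?w \<in> carrier Gm" using w hat_subset by blast
      fix k
      have vk: "v k = (v k ! 0) # tl (v k)" using len[of k] by (cases "v k") auto
      have "repr (Gm.commut_prod es hs) (c k) (commut_prod xs (tl (v k)))"
      proof (rule repr_commut_prod[OF es(2) hs(2) _ cN])
        show "length (tl (v k)) = length xs" using len by simp
        show "es ! i \<in> carrier Gm \<and> repr (es ! i) (c k) (xs ! i)" if "i < length xs" for i
        proof -
          have "xs ! i \<in> carrier G" using xs KC nth_mem[OF that] by blast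
          then show ?thesis using emb_closed repr_emb[OF cN] that by (simp add: es_def)
        qed
        show "hs ! i \<in> carrier Gm \<and> repr (hs ! i) (c k) (tl (v k) ! i)" if "i < length xs" for i
          using h(1)[of "Suc i"] h(2)[of "Suc i" k] that len[of k] by (simp add: hs_def nth_tl)
      qed
      moreover have "repr (h 0 [^]\<^bsub>Gm\<^esub> p) (c k) (hd (v k) [^] p)"
        using repr_pow[OF cN h(2)[of 0 k]] vk by (metis list.sel(1) zero_less_Suc)
      ultimately have "repr ?w (c k) (commut_prod xs (tl (v k)) \<otimes> hd (v k) [^] p)" by (rule repr_mult)
      then show "\<exists>a. repr f (c k) a \<and> repr ?w (c k) a" using v(1)[of k] by (auto simp: good_def)
    qed
    moreover have "\<chi> ?w = 0" using Gm.homsD(5)[OF \<chi>(1) cp(1) h0(1)] cp(2) h0(2) by simp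
    ultimately show ?thesis using \<chi>(2) w by blast
  qed
  then show ?thesis using L by blast
qed

text \<open>H is a union of cosets of the open subgroup \<open>hat L\<close>, each of which meets
  the image of G; hence H is the closure of its inverse image K in G.\<close>

lemma hat_overgroup:
  assumes "p_open p G L" "subgroup H Gm" "hat L \<subseteq> H"
  shows "\<exists>K. p_open p G K \<and> H = hat K"
proof -
  interpret Gm: group_prime Gm p by (rule Gm_group_prime)
  define K where "K = {g \<in> carrier G. emb g \<in> H}"
  have emb_inv: "emb (inv g) = inv\<^bsub>Gm\<^esub> emb g" if "g \<in> carrier G" for g
  proof (rule repr_eqI)
    show "emb (inv g) \<in> carrier Gm" "inv\<^bsub>Gm\<^esub> emb g \<in> carrier Gm" using that emb_closed by simp_all
    show "\<exists>a. repr (emb (inv g)) N a \<and> repr (inv\<^bsub>Gm\<^esub> emb g) N a" if "N \<in> NN" for N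
      using repr_emb[OF that] repr_inv[OF emb_closed repr_emb[OF that]] \<open>g \<in> carrier G\<close> by blast
  qed
  have LK: "L \<subseteq> K"
  proof
    fix g assume g: "g \<in> L"
    then have gc: "g \<in> carrier G" using sub_in[OF p_open_subgroup[OF assms(1)]] by blast
    then show "g \<in> K" using emb_hat[OF assms(1) gc] g assms(3) by (auto simp: K_def)
  qed
  have "subgroup K G"
  proof (rule subgroupI)
    show "K \<subseteq> carrier G" by (auto simp: K_def)
    show "K \<noteq> {}" using LK sub_one[OF p_open_subgroup[OF assms(1)]] by blast
    show "inv g \<in> K" if "g \<in> K" for g
      using that emb_inv Gm.sub_i[OF assms(2)] by (simp add: K_def)
    show "g \<otimes> h \<in> K" if "g \<in> K" "h \<in> K" for g h
      using that emb_mult Gm.sub_m[OF assms(2)] by (simp add: K_def)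
  qed
  then have K: "p_open p G K" by (rule p_open_mono[OF assms(1) _ LK])
  from p_open_NN[OF assms(1)] obtain N where N: "N \<in> NN" "N \<subseteq> L" .
  have "f \<in> H \<longleftrightarrow> f \<in> hat K" if f: "f \<in> carrier Gm" for f
  proof -
    note r = repr_rp[OF f N(1)]
    define g where "g = rp f N"
    have r: "repr f N g" unfolding g_def by (rule r)
    have gc: "g \<in> carrier G" by (rule reprD(2)[OF r])
    \<comment> \<open>Here g represents f at a level inside L, so f and the image of g differ by an
      element of \<open>hat L\<close>, which lies in H.\<close>
    let ?d = "f \<otimes>\<^bsub>Gm\<^esub> inv\<^bsub>Gm\<^esub> emb g"
    have dc: "?d \<in> carrier Gm" using f emb_closed[OF gc] by simp
    have "repr ?d N (g \<otimes> inv g)" by (rule repr_mult[OF r repr_inv[OF emb_closed[OF gc] repr_emb[OF N(1) gc]]])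
    from hat_iff[OF p_open_subgroup[OF assms(1)] dc this N(2)] have "?d \<in> hat L"
      using gc sub_one[OF p_open_subgroup[OF assms(1)]] by simp
    then have dH: "?d \<in> H" using assms(3) by blast
    have fd: "f = ?d \<otimes>\<^bsub>Gm\<^esub> emb g" "emb g = inv\<^bsub>Gm\<^esub> ?d \<otimes>\<^bsub>Gm\<^esub> f"
      using f emb_closed[OF gc] by (simp_all add: Gm.m_assoc Gm.inv_mult_group)
    have "f \<in> H \<longleftrightarrow> emb g \<in> H"
      using Gm.sub_m[OF assms(2) dH] Gm.sub_m[OF assms(2) Gm.sub_i[OF assms(2) dH]] fd by metis
    also have "\<dots> \<longleftrightarrow> g \<in> K" using gc by (simp add: K_def)
    also have "\<dots> \<longleftrightarrow> f \<in> hat K" using hat_iff[OF p_open_subgroup[OF K] f r] N(2) LK by auto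
    finally show ?thesis .
  qed
  then have "H = hat K" using subgroup.subset[OF assms(2)] hat_subset[of K] by blast
  then show ?thesis using K by blast
qed

text \<open>Serre's theorem in this setting. H is reached from the whole completion through normal
  steps of index p; at each step \<open>hat_max_open\<close> yields an open subgroup inside, and
  \<open>hat_overgroup\<close> identifies the group.\<close>

lemma Gm_finite_index_hat:
  assumes "finitely_generated G" "finite_index Gm H"
  shows "\<exists>K. p_open p G K \<and> H = hat K"
proof -
  interpret Gm: group_prime Gm p by (rule Gm_group_prime)
  from Gm_finite_index_p_open[OF assms(2)] show ?thesis
  proof (induction rule: Gm.p_open_induct)
    case carrier
    from p_open_NN[OF p_open_carrier] obtain N where "N \<in> NN" .
    have "hat (carrier G) = carrier Gm"
    proof
      show "carrier Gm \<subseteq> hat (carrier G)"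
      proof
        fix f assume f: "f \<in> carrier Gm"
        note r = repr_rp[OF f \<open>N \<in> NN\<close>]
        show "f \<in> hat (carrier G)" using hat_iff[OF subgroup_self f r NND(4)[OF \<open>N \<in> NN\<close>]] reprD(2)[OF r] by simp
      qed
    qed (rule hat_subset)
    then show ?case using p_open_carrier by blast
  next
    case (step H H')
    then obtain K where K: "p_open p G K" "H' = hat K" by blast
    from hat_max_open[OF assms(1) K(1)] step(3,4) K(2) obtain L where "p_open p G L" "hat L \<subseteq> H" by blast
    then show ?case using hat_overgroup Gm.p_open_subgroup[OF step(1)] by blast
  qed
qed

text \<open>Taking closures is an index-preserving bijection; it is injective because K is recovered
  as the inverse image of \<open>hat K\<close> in G.\<close>

lemma subgroup_count_Gm:
  assumes "finitely_generated G"
  shows "subgroup_count n Gm = open_count n"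
proof -
  interpret Gm: group_prime Gm p by (rule Gm_group_prime)
  let ?P = "{K. p_open p G K \<and> idx G (carrier G) K \<le> n}"
  have "{H. finite_index Gm H \<and> index Gm H \<le> n} = hat ` ?P"
  proof (intro equalityI subsetI)
    fix H assume "H \<in> {H. finite_index Gm H \<and> index Gm H \<le> n}"
    then have H: "finite_index Gm H" "idx Gm (carrier Gm) H \<le> n" by (simp_all add: index_idx)
    from Gm_finite_index_hat[OF assms H(1)] obtain K where "p_open p G K" "H = hat K" by blast
    then show "H \<in> hat ` ?P" using H(2) idx_hat by auto
  next
    fix H assume "H \<in> hat ` ?P"
    then obtain K where K: "p_open p G K" "idx G (carrier G) K \<le> n" "H = hat K" by blast
    have "Gm.pidx (carrier Gm) (hat K)" using p_open_pidx[OF K(1)] by (simp add: Gm.pidx_def pidx_def idx_hat[OF K(1)])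
    then have "finite ((\<lambda>g. hat K #>\<^bsub>Gm\<^esub> g) ` carrier Gm)" by (rule Gm.pidx_finite)
    then show "H \<in> {H. finite_index Gm H \<and> index Gm H \<le> n}"
      using K hat_subgroup[OF K(1)] idx_hat[OF K(1)]
      by (simp add: finite_index_def index_idx RCOSETS_def UNION_singleton_eq_range)
  qed
  moreover have "inj_on hat ?P"
  proof (rule inj_onI)
    fix K K' assume K: "K \<in> ?P" "K' \<in> ?P" "hat K = hat K'"
    have "g \<in> K \<longleftrightarrow> g \<in> K'" if "g \<in> carrier G" for g
      using emb_hat[of K g] emb_hat[of K' g] K that by simp
    moreover have "K \<subseteq> carrier G" "K' \<subseteq> carrier G" using K p_open_subgroup subgroup.subset by blast+
    ultimately show "K = K'" by blast
  qed
  ultimately show ?thesis by (simp add: subgroup_count_def open_count_def card_image)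
qed

end

theorem theorem8p1:
  fixes G :: "('a, 'm) monoid_scheme" and p :: nat
  assumes "group G" and "finitely_generated G" and "Factorial_Ring.prime p"
  defines "cond_i \<equiv>
      \<exists>H :: nat \<Rightarrow> 'a set.
        (\<forall>i. H (Suc i) \<subseteq> H i) \<and> infinite (range H) \<and>
        (\<forall>i. subnormal G (H i) \<and> (\<exists>k. index G (H i) = p ^ k)) \<and>
        linear_growth_mod_p_homology p G (range H)"
    and "cond_ii \<equiv> exponential_subgroup_growth (pro_p_completion p G)"
    and "cond_iii \<equiv>
      limsup (\<lambda>n. log_count (subnormal_count (p ^ n) G) / ereal (real (p ^ n))) > 0"
    and "cond_iv \<equiv>
      (INF n \<in> {1..}. log_count (subnormal_count (p ^ n) G) / ereal (real (p ^ n))) > 0"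
  shows "(cond_i \<longleftrightarrow> cond_ii) \<and> (cond_ii \<longleftrightarrow> cond_iii) \<and> (cond_iii \<longleftrightarrow> cond_iv)"
proof -
  interpret group_prime G p using assms(1,3) by (simp add: group_prime_def group_prime_axioms_def)
  have iii: "cond_iii \<longleftrightarrow> limsup logratio > 0"
    by (simp add: cond_iii_def logratio_def[abs_def] subnormal_count_open_of_index)
  have iv: "cond_iv \<longleftrightarrow> (INF n\<in>{1..}. logratio n) > 0"
    by (simp add: cond_iv_def logratio_def subnormal_count_open_of_index)
  have ii: "cond_ii \<longleftrightarrow> limsup (\<lambda>n. log_count (open_count n) / ereal (real n)) > 0"
    by (simp add: cond_ii_def exponential_subgroup_growth_def subgroup_count_Gm[OF assms(2)])
  \<comment> \<open>The common reformulation of all four conditions. It implies (iv), which implies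
    (iii), (ii) and then \<open>?large\<close> again; its equivalence with (i) is shown
    separately.\<close>
  let ?large = "\<exists>c>0. \<forall>n. large n c"
  have "?large \<Longrightarrow> cond_iv" unfolding iv using inf_logratio_pos[OF assms(2)] by blast
  moreover have "cond_iv \<Longrightarrow> cond_iii" unfolding iii iv by (rule limsup_logratio_pos)
  moreover have "cond_iii \<Longrightarrow> cond_ii" unfolding ii iii by (rule limsup_logratio_imp_open_count[OF assms(2)])
  moreover have "cond_ii \<Longrightarrow> ?large" unfolding ii by (rule limsup_open_count_imp_large[OF assms(2)])
  moreover have "?large \<Longrightarrow> cond_i"
  proof -
    assume ?large
    then obtain c where c: "c > 0" "\<And>n. large n c" by blast
    from large_imp_nested[OF assms(2) c(2)] obtain H where H: "\<And>i. H (Suc i) \<subseteq> H i" "\<And>i. H i \<in> open_of_index i"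
      "\<And>i. c * real p ^ i \<le> real (rk (H i)) - 1" by blast
    have fin: "finite_index G (H i) \<and> subnormal G (H i) \<and> index G (H i) = p ^ i" for i
      using H(2)[of i] open_of_index_alt by blast
    \<comment> \<open>The i-th subgroup has index exactly p^i, so the sequence has infinitely many
      distinct terms.\<close>
    have "inj H"
    proof (rule injI)
      fix i j assume "H i = H j"
      then have "p ^ i = p ^ j" using fin by metis
      then show "i = j" using p_gt_1 by simp
    qed
    then have "infinite (range H)" by (rule range_inj_infinite)
    moreover have "linear_growth_mod_p_homology p G (range H)"
    proof -
      have "ereal c \<le> (INF K\<in>range H. ereal (real (d_p p (G\<lparr>carrier := K\<rparr>)) / real (index G K)))"
      proof (rule INF_greatest)
        fix K assume "K \<in> range H"
        then obtain i where i: "K = H i" by blast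
        have "c * real p ^ i \<le> real (d_p p (G\<lparr>carrier := H i\<rparr>))" using H(3)[of i] by (simp add: rk_def)
        then show "ereal c \<le> ereal (real (d_p p (G\<lparr>carrier := K\<rparr>)) / real (index G K))"
          using fin[of i] p_gt_1 i by (simp add: field_simps)
      qed
      moreover have "0 < ereal c" using c(1) by simp
      ultimately have "0 < (INF K\<in>range H. ereal (real (d_p p (G\<lparr>carrier := K\<rparr>)) / real (index G K)))"
        by (rule order_less_le_trans[rotated])
      then show ?thesis unfolding linear_growth_mod_p_homology_def using fin by blast
    qed
    ultimately show cond_i unfolding cond_i_def using H(1) fin by blast
  qed
  moreover have "cond_i \<Longrightarrow> ?large"
  proof -
    assume cond_i
    then obtain H :: "nat \<Rightarrow> 'a set" where H: "infinite (range H)"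
      "\<And>i. subnormal G (H i) \<and> (\<exists>k. index G (H i) = p ^ k)" "linear_growth_mod_p_homology p G (range H)"
      unfolding cond_i_def by blast
    have po: "p_open p G (H i)" for i
      using H(2)[of i] p_open_iff_subnormal by (simp add: index_idx pidx_def)
    let ?r = "\<lambda>K. ereal (real (d_p p (G\<lparr>carrier := K\<rparr>)) / real (index G K))"
    have "0 < (INF K\<in>range H. ?r K)" using H(3) by (simp add: linear_growth_mod_p_homology_def)
    then obtain c where c: "0 < ereal c" "ereal c < (INF K\<in>range H. ?r K)" using ereal_dense2 by blast
    have "c \<le> real (rk (H i)) / real (idx G (carrier G) (H i))" for i
    proof -
      have "(INF K\<in>range H. ?r K) \<le> ?r (H i)" by (rule INF_lower) simp
      from order_trans[OF less_imp_le[OF c(2)] this] have "ereal c \<le> ?r (H i)" .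
      then show ?thesis by (simp add: rk_def index_idx)
    qed
    then have "large n (c / 2)" for n using nested_imp_large[OF assms(2) H(1) po, of c n] c(1) by simp
    then show ?large using c(1) by (intro exI[of _ "c / 2"]) simp
  qed
  ultimately show ?thesis by blast
qed

end
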